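(* The Semipaired Domination Decision problem is NP-complete for split graphs. That is, the following problem is NP-complete: given a split graph $G$ with no isolated vertices and a positive integer $k$, decide whether $G$ has a semipaired dominating set of cardinality at most $k$.
   Context: All graphs are finite and simple. For a graph $G=(V,E)$, a set $D\subseteq V$ is a dominating set if every vertex of $V\setminus D$ has a neighbor in $D$. For a graph $G$ with no isolated vertices, a semipaired dominating set is a dominating set $D$ of $G$ that can be partitioned into $2$-element subsets $\{u,v\}$ such that the distance between $u$ and $v$ in $G$ is at most $2$. A graph $G$ is a split graph if its vertex set can be partitioned into a clique $C$ and an independent set $I$. *)

theory Defs
  imports Complex_Main "HOL-Library.Extended_Nat" "HOL-Library.Disjoint_Sets"
    "HOL-Computational_Algebra.Polynomial"
begin

section \<open>Finite simple graphs and semipaired domination\<close>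

definition simple_graph :: "'a set \<Rightarrow> 'a set set \<Rightarrow> bool" where
  "simple_graph V E \<longleftrightarrow> finite V \<and> (\<forall>e\<in>E. e \<subseteq> V \<and> card e = 2)"

definition clique :: "'a set set \<Rightarrow> 'a set \<Rightarrow> bool" where
  "clique E C \<longleftrightarrow> (\<forall>u\<in>C. \<forall>v\<in>C. u \<noteq> v \<longrightarrow> {u, v} \<in> E)"

definition independent :: "'a set set \<Rightarrow> 'a set \<Rightarrow> bool" where
  "independent E I \<longleftrightarrow> (\<forall>u\<in>I. \<forall>v\<in>I. {u, v} \<notin> E)"

definition split_graph :: "'a set \<Rightarrow> 'a set set \<Rightarrow> bool" where
  "split_graph V E \<longleftrightarrow> simple_graph V E \<and>
     (\<exists>C I. C \<union> I = V \<and> C \<inter> I = {} \<and> clique E C \<and> independent E I)"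

definition no_isolated_vertices :: "'a set \<Rightarrow> 'a set set \<Rightarrow> bool" where
  "no_isolated_vertices V E \<longleftrightarrow> (\<forall>v\<in>V. \<exists>u\<in>V. {u, v} \<in> E)"

definition walk :: "'a set \<Rightarrow> 'a set set \<Rightarrow> 'a list \<Rightarrow> bool" where
  "walk V E p \<longleftrightarrow> p \<noteq> [] \<and> set p \<subseteq> V \<and> successively (\<lambda>u v. {u, v} \<in> E) p"

text \<open>The distance is \<open>\<infinity>\<close> if there is no walk from \<open>u\<close> to \<open>v\<close>.\<close>

definition gdist :: "'a set \<Rightarrow> 'a set set \<Rightarrow> 'a \<Rightarrow> 'a \<Rightarrow> enat" where
  "gdist V E u v = (INF p \<in> {p. walk V E p \<and> hd p = u \<and> last p = v}. enat (length p - 1))"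

definition dominating_set :: "'a set \<Rightarrow> 'a set set \<Rightarrow> 'a set \<Rightarrow> bool" where
  "dominating_set V E D \<longleftrightarrow> D \<subseteq> V \<and> (\<forall>v\<in>V - D. \<exists>u\<in>D. {u, v} \<in> E)"

definition semipaired_dominating_set :: "'a set \<Rightarrow> 'a set set \<Rightarrow> 'a set \<Rightarrow> bool" where
  "semipaired_dominating_set V E D \<longleftrightarrow> dominating_set V E D \<and>
     (\<exists>P. partition_on D P \<and> (\<forall>B\<in>P. \<exists>u v. u \<noteq> v \<and> B = {u, v} \<and> gdist V E u v \<le> 2))"


section \<open>Deterministic multi-tape Turing machines\<close>

text \<open>
  States and tape symbols are natural numbers below fixed bounds. Symbol 0 is the blank,
  1 and 2 stand for the bits 0 and 1, and 3 is a separator. Tapes are infinite in both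
  directions; a tape consists of its contents and the position of its head.
\<close>

datatype move = MoveLeft | Stay | MoveRight

fun offset :: "move \<Rightarrow> int" where
  "offset MoveLeft = -1"
| "offset Stay = 0"
| "offset MoveRight = 1"

type_synonym tape = "(int \<Rightarrow> nat) \<times> int"
type_synonym config = "nat \<times> tape list"

record tm =
  num_tapes :: nat
  num_symbols :: nat
  num_states :: nat
  start_state :: nat
  accept_state :: nat
  reject_state :: nat
  delta :: "nat \<Rightarrow> nat list \<Rightarrow> nat \<times> (nat \<times> move) list"

definition turing_machine :: "tm \<Rightarrow> bool" where
  "turing_machine M \<longleftrightarrow>
     num_tapes M \<ge> 1 \<and> num_symbols M \<ge> 4 \<and>
     start_state M < num_states M \<and> accept_state M < num_states M \<and>
     reject_state M < num_states M \<and> accept_state M \<noteq> reject_state M \<and>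
     (\<forall>q ss. q < num_states M \<and> length ss = num_tapes M \<and> set ss \<subseteq> {..<num_symbols M} \<longrightarrow>
        (let (q', acts) = delta M q ss
         in q' < num_states M \<and> length acts = num_tapes M \<and>
            fst ` set acts \<subseteq> {..<num_symbols M}))"

definition tape_read :: "tape \<Rightarrow> nat" where
  "tape_read tp = fst tp (snd tp)"

definition tape_act :: "nat \<times> move \<Rightarrow> tape \<Rightarrow> tape" where
  "tape_act a tp = ((fst tp)(snd tp := fst a), snd tp + offset (snd a))"

definition halted :: "tm \<Rightarrow> config \<Rightarrow> bool" where
  "halted M c \<longleftrightarrow> fst c = accept_state M \<or> fst c = reject_state M"

definition tm_step :: "tm \<Rightarrow> config \<Rightarrow> config" where
  "tm_step M c = (if halted M c then c else
     let (q', acts) = delta M (fst c) (map tape_read (snd c))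
     in (q', map2 tape_act acts (snd c)))"

definition word_contents :: "nat list \<Rightarrow> int \<Rightarrow> nat" where
  "word_contents w i = (if 0 \<le> i \<and> i < int (length w) then w ! nat i else 0)"

text \<open>The input is on the first tape; the output, if any, is expected on the last tape.\<close>

definition init_config :: "tm \<Rightarrow> nat list \<Rightarrow> config" where
  "init_config M w =
     (start_state M, (word_contents w, 0) # replicate (num_tapes M - 1) (word_contents [], 0))"

definition run :: "tm \<Rightarrow> nat list \<Rightarrow> nat \<Rightarrow> config" where
  "run M w t = (tm_step M ^^ t) (init_config M w)"

definition accepts :: "tm \<Rightarrow> nat list \<Rightarrow> bool" where
  "accepts M w \<longleftrightarrow> (\<exists>t. fst (run M w t) = accept_state M)"


section \<open>Polynomial time, NP and NP-completeness\<close>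

definition bit_word :: "bool list \<Rightarrow> nat list" where
  "bit_word x = map (\<lambda>b. if b then 2 else 1) x"

definition pair_word :: "bool list \<Rightarrow> bool list \<Rightarrow> nat list" where
  "pair_word x y = bit_word x @ [3] @ bit_word y"

definition poly_time_computable :: "(bool list \<Rightarrow> bool list) \<Rightarrow> bool" where
  "poly_time_computable f \<longleftrightarrow> (\<exists>M (p :: nat poly). turing_machine M \<and>
     (\<forall>x. let c = run M (bit_word x) (poly p (length x))
          in halted M c \<and> fst (last (snd c)) = word_contents (bit_word (f x))))"

definition poly_time_verifier :: "tm \<Rightarrow> bool" where
  "poly_time_verifier M \<longleftrightarrow> turing_machine M \<and>
     (\<exists>p :: nat poly. \<forall>x y.
        halted M (run M (pair_word x y) (poly p (length (pair_word x y)))))"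

definition NP :: "bool list set set" where
  "NP = {L. \<exists>M (p :: nat poly). poly_time_verifier M \<and>
     (\<forall>x. x \<in> L \<longleftrightarrow> (\<exists>y. length y \<le> poly p (length x) \<and> accepts M (pair_word x y)))}"

definition poly_time_reducible :: "bool list set \<Rightarrow> bool list set \<Rightarrow> bool" where
  "poly_time_reducible L L' \<longleftrightarrow>
     (\<exists>f. poly_time_computable f \<and> (\<forall>x. x \<in> L \<longleftrightarrow> f x \<in> L'))"

definition NP_complete :: "bool list set \<Rightarrow> bool" where
  "NP_complete L \<longleftrightarrow> L \<in> NP \<and> (\<forall>L'\<in>NP. poly_time_reducible L' L)"


section \<open>The decision problem as a language\<close>

text \<open>Binary representation, least significant bit first, without superfluous zeros.\<close>

fun bits_of_nat :: "nat \<Rightarrow> bool list" where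
  "bits_of_nat n = (if n = 0 then [] else odd n # bits_of_nat (n div 2))"

declare bits_of_nat.simps [simp del]

text \<open>
  A graph on the vertices \<open>0, \<dots>, n - 1\<close> together with a number \<open>k\<close> is encoded by \<open>n\<close> in unary,
  a terminating 0, the adjacency matrix row by row, and \<open>k\<close> in binary.
\<close>

definition adjacency_bits :: "nat \<Rightarrow> nat set set \<Rightarrow> bool list" where
  "adjacency_bits n E = concat (map (\<lambda>i. map (\<lambda>j. {i, j} \<in> E) [0..<n]) [0..<n])"

definition encode_instance :: "nat \<Rightarrow> nat set set \<Rightarrow> nat \<Rightarrow> bool list" where
  "encode_instance n E k = replicate n True @ [False] @ adjacency_bits n E @ bits_of_nat k"

definition semipaired_domination_split :: "bool list set" where
  "semipaired_domination_split =
     {encode_instance n E k | n E k.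
        split_graph {..<n} E \<and> no_isolated_vertices {..<n} E \<and> k > 0 \<and>
        (\<exists>D. semipaired_dominating_set {..<n} E D \<and> card D \<le> k)}"

lemma bits_of_nat_inj: "bits_of_nat m = bits_of_nat n \<Longrightarrow> m = n"
proof (induction m arbitrary: n rule: less_induct)
  case (less m)
  show ?case
  proof (cases "m = 0 \<or> n = 0")
    case True
    then show ?thesis
      using less.prems by (subst (asm) (1 2) bits_of_nat.simps) (auto split: if_splits)
  next
    case False
    then have "odd m = odd n" "bits_of_nat (m div 2) = bits_of_nat (n div 2)"
      using less.prems by (subst (asm) (1 2) bits_of_nat.simps, simp)+
    moreover have "m div 2 = n div 2"
      using less.IH[of "m div 2" "n div 2"] calculation False by simp
    ultimately show ?thesis
      by (metis (no_types) div_mult_mod_eq odd_iff_mod_2_eq_one parity_cases)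
  qed
qed

lemma length_adjacency_bits: "length (adjacency_bits n E) = n * n"
  by (simp add: adjacency_bits_def length_concat comp_def sum_list_triv)

lemma adjacency_bits_inj:
  assumes "adjacency_bits n E = adjacency_bits n E'"
    and "simple_graph {..<n} E" "simple_graph {..<n} E'"
  shows "E = E'"
proof -
  have "map (\<lambda>i. map (\<lambda>j. {i, j} \<in> E) [0..<n]) [0..<n] =
        map (\<lambda>i. map (\<lambda>j. {i, j} \<in> E') [0..<n]) [0..<n]"
    using assms(1) unfolding adjacency_bits_def
    by (rule concat_injective) (auto simp: in_set_zip)
  then have "\<And>i j. i < n \<Longrightarrow> j < n \<Longrightarrow> {i, j} \<in> E \<longleftrightarrow> {i, j} \<in> E'"
    by simp
  then show ?thesis
    using assms(2,3) unfolding simple_graph_def card_2_iff by (fastforce intro!: set_eqI)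
qed

lemma encode_instance_inj:
  assumes "encode_instance n E k = encode_instance n' E' k'"
    and "simple_graph {..<n} E" "simple_graph {..<n'} E'"
  shows "n = n' \<and> E = E' \<and> k = k'"
proof -
  have tw: "takeWhile id (encode_instance m F l) = replicate m True" for m F l
    unfolding encode_instance_def by (subst takeWhile_append2) auto
  have n: "n = n'"
    using arg_cong[OF assms(1), of "\<lambda>w. length (takeWhile id w)"] by (simp add: tw)
  then have "adjacency_bits n E = adjacency_bits n E'" "bits_of_nat k = bits_of_nat k'"
    using assms(1) by (auto simp: encode_instance_def length_adjacency_bits)
  then show ?thesis
    using n assms(2,3) adjacency_bits_inj bits_of_nat_inj by blast
qed

lemma encode_instance_in_semipaired_domination_split_iff:
  assumes "split_graph {..<n} E" "no_isolated_vertices {..<n} E" "k > 0"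
  shows "encode_instance n E k \<in> semipaired_domination_split \<longleftrightarrow>
    (\<exists>D. semipaired_dominating_set {..<n} E D \<and> card D \<le> k)"
  using assms encode_instance_inj
  unfolding semipaired_domination_split_def split_graph_def by blast

end

theory Submission imports Defs "HOL-Library.Countable" begin

text \<open>
  Hardness is shown directly from machine computations. Seen from the tape heads, a deterministic
  multi-tape machine evolves locally, except that all cells also depend on the symbols under the
  heads. Clauses saying that these local rules hold force every satisfying assignment to contain the
  actual computation on some guessed certificate, so acceptance becomes satisfiability. A formula with
  an even number \<open>m\<close> of variables becomes a split graph: its literals form the clique, its variables
  and clauses the independent set, adjacent to the literals that satisfy them. A semipaired dominating
  set of size at most \<open>m\<close> needs a vertex for each variable, hence consists of exactly one per variable
  and reads off an assignment; conversely the \<open>m\<close> literals of an assignment lie in a clique and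
  can be paired arbitrarily.

  Polynomial time is obtained from a class of functions on natural numbers in unary representation
  that is closed under primitive recursion with polynomially bounded values. Such functions are
  computed by programs on counters, and a counter is a tape whose value is its head position. Both
  the bits of the constructed instance and the predicate checking a certificate lie in this class.
\<close>

section \<open>Counter programs\<close>

text \<open>No restriction on clause width is needed, since a clause is just an independent vertex
  of arbitrary degree. So clauses and variables are indexed by all tuples below one bound
  \<open>B\<close>, meaningless indices give trivially true clauses, and a single predicate in the
  unary class decides whether a literal occurs in a clause.

  Coordinates are relative to the heads because head positions would otherwise have to be recorded
  in the cells, separately for each tape. The symbols under all heads then lie in one central
  column; the price is that whole tapes shift, which is a rule about neighbouring cells. The window
  has radius \<open>T\<close> and each step loses a cell on both sides, so after \<open>T\<close>
  steps exactly the centre is known, and it contains the state.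

  Two things resist unary numbers. The bound \<open>k\<close> is written in binary and may be
  exponential, so the verifier caps it at \<open>n\<close>, which is harmless because no vertex set
  is larger. Bits of a number are found by repeated halving, since \<open>2 ^ i\<close> would be too
  large.\<close>

datatype oper = Nop | Inc nat | Dec nat | Out bool
datatype tst = Pos nat | Sym nat | NotSym nat
datatype com = Skip | Op oper | Seq com com | Cond tst com com | While tst com

instance oper :: countable by countable_datatype
instance tst :: countable by countable_datatype
instance com :: countable by countable_datatype

text \<open>What a head sees: register 0 is the input head, while every other register only reveals
  whether it is zero, the symbol 1 standing for a mark at the origin.\<close>

definition rd :: "nat list \<Rightarrow> (nat \<Rightarrow> int) \<Rightarrow> nat \<Rightarrow> nat" where
  "rd w s r = (if r = 0 then word_contents w (s 0) else if s r = 0 then 1 else 0)"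

fun holds :: "(nat \<Rightarrow> nat) \<Rightarrow> tst \<Rightarrow> bool" where
  "holds \<rho> (Pos r) \<longleftrightarrow> \<rho> r \<noteq> 1"
| "holds \<rho> (Sym a) \<longleftrightarrow> \<rho> 0 = a"
| "holds \<rho> (NotSym a) \<longleftrightarrow> \<rho> 0 \<noteq> a"

text \<open>The program that remains to be run serves as control state, so a machine needs one state
  per remainder. Passing from \<open>Seq Skip d\<close> to \<open>d\<close> costs a step of its
  own.\<close>

fun nxt :: "com \<Rightarrow> (nat \<Rightarrow> nat) \<Rightarrow> com \<times> oper" where
  "nxt Skip \<rho> = (Skip, Nop)"
| "nxt (Op a) \<rho> = (Skip, a)"
| "nxt (Seq c d) \<rho> = (if c = Skip then (d, Nop) else (Seq (fst (nxt c \<rho>)) d, snd (nxt c \<rho>)))"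
| "nxt (Cond b c d) \<rho> = (if holds \<rho> b then c else d, Nop)"
| "nxt (While b c) \<rho> = (if holds \<rho> b then Seq c (While b c) else Skip, Nop)"

type_synonym pstate = "com \<times> (nat \<Rightarrow> int) \<times> bool list"

fun apply_op :: "oper \<Rightarrow> (nat \<Rightarrow> int) \<times> bool list \<Rightarrow> (nat \<Rightarrow> int) \<times> bool list" where
  "apply_op Nop (s, u) = (s, u)"
| "apply_op (Inc r) (s, u) = (s(r := s r + 1), u)"
| "apply_op (Dec r) (s, u) = (s(r := s r - 1), u)"
| "apply_op (Out b) (s, u) = (s, u @ [b])"

fun pstep :: "nat list \<Rightarrow> pstate \<Rightarrow> pstate" where
  "pstep w (c, s, u) = (fst (nxt c (rd w s)), apply_op (snd (nxt c (rd w s))) (s, u))"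

text \<open>Since \<^term>\<open>Skip\<close> is a fixed point of the step function, \<open>n\<close> is only an upper bound
  on the running time.\<close>

definition exec :: "nat list \<Rightarrow> com \<Rightarrow> nat \<Rightarrow> (nat \<Rightarrow> int) \<Rightarrow> bool list \<Rightarrow> (nat \<Rightarrow> int) \<Rightarrow> bool list \<Rightarrow> bool"
  where "exec w c n s u s' u' \<longleftrightarrow> (pstep w ^^ n) (c, s, u) = (Skip, s', u')"

lemma pstep_Skip: "(pstep w ^^ n) (Skip, s, u) = (Skip, s, u)"
  by (induction n) auto

lemma exec_mono: "exec w c m s u s' u' \<Longrightarrow> m \<le> n \<Longrightarrow> exec w c n s u s' u'"
  using funpow_add[of "n - m" m "pstep w"] by (simp add: exec_def pstep_Skip)

lemma exec_Skip: "exec w Skip n s u s u"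
  by (simp add: exec_def pstep_Skip)

lemma exec_Op: "apply_op a (s, u) = (s', u') \<Longrightarrow> n \<ge> 1 \<Longrightarrow> exec w (Op a) n s u s' u'"
  by (rule exec_mono[of _ _ 1]) (simp_all add: exec_def)

lemma exec_step:
  "exec w c' n s u s' u' \<Longrightarrow> nxt c (rd w s) = (c', Nop) \<Longrightarrow> exec w c (Suc n) s u s' u'"
  by (simp add: exec_def funpow_Suc_right del: funpow.simps)

text \<open>\<open>c\<close> may reach \<open>Skip\<close> early and idle there, whereas the
  sequence would go on with \<open>d\<close>; hence only some \<open>n' <= n\<close>.\<close>

lemma pstep_Seq:
  assumes "(pstep w ^^ n) (c, s, u) = (Skip, s', u')"
  shows "\<exists>n'\<le>n. (pstep w ^^ n') (Seq c d, s, u) = (Seq Skip d, s', u')"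
  using assms
proof (induction n arbitrary: c s u)
  case 0
  then show ?case by (intro exI[of _ 0]) auto
next
  case (Suc n)
  show ?case
  proof (cases "c = Skip")
    case True
    then show ?thesis using Suc.prems pstep_Skip[of "Suc n" w s u] by (intro exI[of _ 0]) auto
  next
    case False
    obtain c1 s1 u1 where e: "pstep w (c, s, u) = (c1, s1, u1)" by (metis prod_cases3)
    then obtain n' where "n' \<le> n" "(pstep w ^^ n') (Seq c1 d, s1, u1) = (Seq Skip d, s', u')"
      using Suc.IH[of c1 s1 u1] Suc.prems by (auto simp: funpow_Suc_right simp del: funpow.simps pstep.simps)
    moreover have "pstep w (Seq c d, s, u) = (Seq c1 d, s1, u1)" using e False by auto
    ultimately show ?thesis
      by (intro exI[of _ "Suc n'"]) (simp add: funpow_Suc_right del: funpow.simps pstep.simps)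
  qed
qed

lemma exec_Seq:
  assumes "exec w c m s u s1 u1" "exec w d n s1 u1 s' u'" "k \<ge> m + n + 1"
  shows "exec w (Seq c d) k s u s' u'"
proof -
  obtain m' where m': "m' \<le> m" "(pstep w ^^ m') (Seq c d, s, u) = (Seq Skip d, s1, u1)"
    using assms(1) pstep_Seq unfolding exec_def by blast
  have "exec w (Seq Skip d) (Suc n) s1 u1 s' u'" using assms(2) by (rule exec_step) simp
  then have "exec w (Seq c d) (Suc n + m') s u s' u'"
    using m' by (simp only: exec_def funpow_add comp_apply)
  then show ?thesis by (rule exec_mono) (use m' assms(3) in simp)
qed

lemma exec_Cond:
  assumes "holds (rd w s) b \<Longrightarrow> exec w c n s u s' u'" "\<not> holds (rd w s) b \<Longrightarrow> exec w d n s u s' u'"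
    "k \<ge> n + 1"
  shows "exec w (Cond b c d) k s u s' u'"
  by (rule exec_mono[OF exec_step[of w "if holds (rd w s) b then c else d" n]]) (use assms in auto)

text \<open>\<open>S i\<close> and \<open>U i\<close> are the store and the output before round
  \<open>i\<close>. A round costs the body plus two steps, one for the test and one for leaving the
  \<open>Seq\<close>.\<close>

lemma exec_While:
  assumes "\<And>i. i < k \<Longrightarrow> holds (rd w (S i)) b \<and> exec w c t (S i) (U i) (S (Suc i)) (U (Suc i))"
    and "\<not> holds (rd w (S k)) b" and "n \<ge> k * (t + 2) + 1"
  shows "exec w (While b c) n (S 0) (U 0) (S k) (U k)"
proof -
  have "exec w (While b c) ((k - i) * (t + 2) + 1) (S i) (U i) (S k) (U k)" if "i \<le> k" for i
    using that
  proof (induction i rule: inc_induct)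
    case base
    have "exec w (While b c) (Suc 0) (S k) (U k) (S k) (U k)"
      by (rule exec_step[OF exec_Skip]) (use assms in simp)
    then show ?case by simp
  next
    case (step i)
    have "exec w (Seq c (While b c)) (t + ((k - Suc i) * (t + 2) + 1) + 1) (S i) (U i) (S k) (U k)"
      using assms(1)[of i] step by (intro exec_Seq) auto
    then have "exec w (While b c) (Suc (t + ((k - Suc i) * (t + 2) + 1) + 1)) (S i) (U i) (S k) (U k)"
      by (rule exec_step) (use assms(1)[of i] step in simp)
    moreover have "Suc (t + ((k - Suc i) * (t + 2) + 1) + 1) = (k - i) * (t + 2) + 1"
      using step(2) by (simp add: Suc_diff_Suc[symmetric])
    ultimately show ?case by simp
  qed
  from this[of 0] show ?thesis using assms(3) exec_mono by simp
qed

section \<open>Compilation to Turing machines\<close>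

text \<open>Contains every remainder that can occur during a run; its finiteness gives the compiled
  machine finitely many states.\<close>

fun conts :: "com \<Rightarrow> com set" where
  "conts Skip = {Skip}"
| "conts (Op a) = {Op a, Skip}"
| "conts (Seq c d) = (\<lambda>x. Seq x d) ` conts c \<union> conts d"
| "conts (Cond b c d) = {Cond b c d} \<union> conts c \<union> conts d"
| "conts (While b c) = {While b c, Skip} \<union> (\<lambda>x. Seq x (While b c)) ` conts c"

lemma conts_self: "c \<in> conts c" and conts_Skip: "Skip \<in> conts c"
  by (induction c) auto

lemma finite_conts: "finite (conts c)"
  by (induction c) auto

lemma conts_nxt: "c' \<in> conts c \<Longrightarrow> fst (nxt c' \<rho>) \<in> conts c"
  by (induction c arbitrary: c') (auto simp: conts_self conts_Skip split: if_splits)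

fun op_ok :: "nat \<Rightarrow> oper \<Rightarrow> bool" where
  "op_ok R (Inc r) \<longleftrightarrow> r < R"
| "op_ok R (Dec r) \<longleftrightarrow> r < R"
| "op_ok R a \<longleftrightarrow> True"

fun tst_ok :: "nat \<Rightarrow> tst \<Rightarrow> bool" where
  "tst_ok R (Pos r) \<longleftrightarrow> r < R"
| "tst_ok R b \<longleftrightarrow> True"

fun com_ok :: "nat \<Rightarrow> com \<Rightarrow> bool" where
  "com_ok R Skip \<longleftrightarrow> True"
| "com_ok R (Op a) \<longleftrightarrow> op_ok R a"
| "com_ok R (Seq c d) \<longleftrightarrow> com_ok R c \<and> com_ok R d"
| "com_ok R (Cond b c d) \<longleftrightarrow> tst_ok R b \<and> com_ok R c \<and> com_ok R d"
| "com_ok R (While b c) \<longleftrightarrow> tst_ok R b \<and> com_ok R c"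

lemma op_ok_mono: "op_ok R a \<Longrightarrow> R \<le> R' \<Longrightarrow> op_ok R' a"
  by (cases a) auto

lemma tst_ok_mono: "tst_ok R a \<Longrightarrow> R \<le> R' \<Longrightarrow> tst_ok R' a"
  by (cases a) auto

lemma com_ok_mono: "com_ok R c \<Longrightarrow> R \<le> R' \<Longrightarrow> com_ok R' c"
  by (induction c) (auto intro: op_ok_mono tst_ok_mono)

lemma com_ok_ex: "\<exists>R. com_ok R c"
proof (induction c)
  case (Op a)
  have "\<exists>R. op_ok R a" by (cases a) (auto simp: gt_ex)
  then show ?case by simp
next
  case (Seq c d)
  then obtain R R' where "com_ok R c" "com_ok R' d" by auto
  then show ?case by (intro exI[of _ "max R R'"]) (auto intro: com_ok_mono)
next
  case (Cond b c d)
  have "\<exists>R. tst_ok R b" by (cases b) (auto simp: gt_ex)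
  then obtain R0 R R' where "tst_ok R0 b" "com_ok R c" "com_ok R' d" using Cond by auto
  then show ?case
    by (intro exI[of _ "max R0 (max R R')"]) (auto intro: com_ok_mono tst_ok_mono)
next
  case (While b c)
  have "\<exists>R. tst_ok R b" by (cases b) (auto simp: gt_ex)
  then obtain R0 R where "tst_ok R0 b" "com_ok R c" using While by auto
  then show ?case
    by (intro exI[of _ "max R0 R"]) (auto intro: com_ok_mono tst_ok_mono)
qed simp

lemma com_ok_nxt: "com_ok R c \<Longrightarrow> com_ok R (fst (nxt c \<rho>)) \<and> op_ok R (snd (nxt c \<rho>))"
  by (induction c) auto

lemma nxt_cong: "com_ok R c \<Longrightarrow> 0 < R \<Longrightarrow> (\<And>r. r < R \<Longrightarrow> \<rho> r = \<rho>' r) \<Longrightarrow> nxt c \<rho> = nxt c \<rho>'"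
proof (induction c)
  case (Cond b c d)
  then show ?case by (cases b) auto
next
  case (While b c)
  then show ?case by (cases b) auto
qed auto

text \<open>Every counter tape carries the symbol 1 at position 0, and the value of the counter is the
  position of the head.\<close>

definition prog_tape :: "nat list \<Rightarrow> nat \<Rightarrow> (nat \<Rightarrow> int) \<Rightarrow> bool list \<Rightarrow> nat \<Rightarrow> tape" where
  "prog_tape w R s u r = (if r = 0 then (word_contents w, s 0)
     else if r = R then (word_contents (bit_word u), int (length u))
     else ((\<lambda>i. if i = 0 then 1 else 0), s r))"

fun op_act :: "nat \<Rightarrow> oper \<Rightarrow> nat list \<Rightarrow> nat \<Rightarrow> nat \<times> move" where
  "op_act R Nop ss r = (ss ! r, Stay)"
| "op_act R (Inc q) ss r = (ss ! r, if r = q then MoveRight else Stay)"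
| "op_act R (Dec q) ss r = (ss ! r, if r = q then MoveLeft else Stay)"
| "op_act R (Out b) ss r = (if r = R then (if b then 2 else 1, MoveRight) else (ss ! r, Stay))"

text \<open>States 0, 1 and 2 accept, reject and start; the remainder \<open>c\<close> is state
  \<open>3 + to_nat c\<close>. The start state writes the origin marks of the counter tapes.
  \<open>Skip\<close> turns into a verdict: reject iff tape 2 shows its origin mark. Tape
  \<open>R\<close> receives the output.\<close>

definition com_delta :: "nat \<Rightarrow> com \<Rightarrow> nat \<Rightarrow> nat list \<Rightarrow> nat \<times> (nat \<times> move) list" where
  "com_delta R c0 q ss =
    (if q = 2 then (3 + to_nat c0, map (\<lambda>r. (if 0 < r \<and> r < R then 1 else ss ! r, Stay)) [0..<Suc R])
     else if \<exists>c\<in>conts c0. q = 3 + to_nat c then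
       let c = from_nat (q - 3) :: com in
       if c = Skip then (if ss ! 2 = 1 then 1 else 0, map (\<lambda>a. (a, Stay)) ss)
       else (3 + to_nat (fst (nxt c (\<lambda>r. ss ! r))),
             map (op_act R (snd (nxt c (\<lambda>r. ss ! r))) ss) [0..<Suc R])
     else (q, map (\<lambda>a. (a, Stay)) ss))"

definition com_tm :: "nat \<Rightarrow> com \<Rightarrow> tm" where
  "com_tm R c0 = \<lparr>num_tapes = Suc R, num_symbols = 4,
     num_states = Suc (Max (insert 2 ((\<lambda>c. 3 + to_nat c) ` conts c0))),
     start_state = 2, accept_state = 0, reject_state = 1, delta = com_delta R c0\<rparr>"

lemma op_act_symbol: "set ss \<subseteq> {..<4} \<Longrightarrow> r < length ss \<Longrightarrow> fst (op_act R a ss r) < 4"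
  by (cases a) (auto dest: nth_mem)

lemma turing_machine_com_tm: "turing_machine (com_tm R c0)"
proof -
  let ?Q = "insert 2 ((\<lambda>c. 3 + to_nat c) ` conts c0)"
  have le: "q < Suc (Max ?Q)" if "q \<in> ?Q" for q
    using that finite_conts by (simp add: less_Suc_eq_le del: image_insert)
  have two: "2 < Suc (Max ?Q)" by (rule le) simp
  have "case com_delta R c0 q ss of (q', acts) \<Rightarrow> q' < Suc (Max ?Q) \<and> length acts = Suc R \<and>
      fst ` set acts \<subseteq> {..<4}"
    if "q < Suc (Max ?Q)" and ss: "length ss = Suc R" "set ss \<subseteq> {..<4}" for q ss
  proof -
    have sym: "ss ! r < 4" if "r < Suc R" for r using ss that nth_mem[of r ss] by (metis lessThan_iff subsetD)
    show ?thesis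
    proof (cases "q = 2")
      case True
      then show ?thesis using le[of "3 + to_nat c0"] sym conts_self by (auto simp: com_delta_def less_Suc_eq)
    next
      case F: False
      show ?thesis
      proof (cases "\<exists>c\<in>conts c0. q = 3 + to_nat c")
        case True
        then obtain c where c: "c \<in> conts c0" "q = 3 + to_nat c" by auto
        show ?thesis
        proof (cases "c = Skip")
          case True
          then show ?thesis using F c two ss by (auto simp: com_delta_def)
        next
          case False
          then have "com_delta R c0 q ss = (3 + to_nat (fst (nxt c (\<lambda>r. ss ! r))),
             map (op_act R (snd (nxt c (\<lambda>r. ss ! r))) ss) [0..<Suc R])"
            using F c by (auto simp: com_delta_def)
          moreover have "3 + to_nat (fst (nxt c (\<lambda>r. ss ! r))) < Suc (Max ?Q)"
            by (rule le) (use conts_nxt[OF c(1)] in auto)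
          ultimately show ?thesis using op_act_symbol[OF ss(2)] ss(1) by auto
        qed
      next
        case False
        then show ?thesis using F that by (auto simp: com_delta_def)
      qed
    qed
  qed
  then show ?thesis unfolding turing_machine_def com_tm_def using two by auto
qed

definition prog_config :: "nat list \<Rightarrow> nat \<Rightarrow> pstate \<Rightarrow> config" where
  "prog_config w R = (\<lambda>(c, s, u). (3 + to_nat c, map (prog_tape w R s u) [0..<Suc R]))"

lemma word_contents_snoc:
  "word_contents (v @ [a]) = (word_contents v)(int (length v) := a)"
  by (auto simp: word_contents_def fun_eq_iff nth_append)

lemma map2_map_same: "map2 f (map g xs) (map h xs) = map (\<lambda>x. f (g x) (h x)) xs"
  by (induction xs) auto

lemma tm_step_com_tm:
  assumes "c \<in> conts c0" "com_ok R c" "c \<noteq> Skip" "0 < R"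
  shows "tm_step (com_tm R c0) (prog_config w R (c, s, u)) = prog_config w R (pstep w (c, s, u))"
proof -
  let ?ss = "map (\<lambda>r. tape_read (prog_tape w R s u r)) [0..<Suc R]"
  have rd: "?ss ! r = rd w s r" if "r < R" for r
    using that by (auto simp: nth_append tape_read_def prog_tape_def rd_def)
  have nx: "nxt c (\<lambda>r. ?ss ! r) = nxt c (rd w s)"
    using assms rd by (intro nxt_cong) auto
  have rd': "?ss ! r = tape_read (prog_tape w R s u r)" if "r < Suc R" for r
    using that by (simp del: upt_Suc)
  have ok: "op_ok R (snd (nxt c (rd w s)))" using com_ok_nxt assms by blast
  have key: "tape_act (op_act R a ?ss r) (prog_tape w R s u r) =
      prog_tape w R (fst (apply_op a (s, u))) (snd (apply_op a (s, u))) r"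
    if "r < Suc R" "op_ok R a" for a r
    using that(2) unfolding atomize_all
    by (cases a) (simp_all add: rd'[OF that(1)] del: map_append upt_Suc,
       auto simp: tape_act_def tape_read_def prog_tape_def bit_word_def word_contents_snoc assms)
  have d: "com_delta R c0 (3 + to_nat c) ?ss = (3 + to_nat (fst (nxt c (rd w s))),
      map (op_act R (snd (nxt c (rd w s))) ?ss) [0..<Suc R])"
    using assms(1,3) unfolding com_delta_def by (auto simp: nx simp del: upt_Suc)
  have "map tape_read (map (prog_tape w R s u) [0..<Suc R]) = ?ss" by (simp del: upt_Suc)
  then have "tm_step (com_tm R c0) (prog_config w R (c, s, u)) =
    (3 + to_nat (fst (nxt c (rd w s))), map2 tape_act (map (op_act R (snd (nxt c (rd w s))) ?ss) [0..<Suc R])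
      (map (prog_tape w R s u) [0..<Suc R]))"
    using d by (simp add: tm_step_def halted_def com_tm_def prog_config_def comp_def del: upt_Suc)
  also have "\<dots> = prog_config w R (pstep w (c, s, u))"
    unfolding map2_map_same prog_config_def using key ok
    by (auto simp del: upt_Suc split: prod.split)
  finally show ?thesis .
qed

lemma tm_step_halted: "halted M c \<Longrightarrow> (tm_step M ^^ n) c = c"
  by (induction n) (auto simp: tm_step_def)

lemma run_add: "run M w (m + n) = (tm_step M ^^ n) (run M w m)"
  by (simp only: run_def funpow_add comp_apply add.commute[of m])

text \<open>The two extra steps are the marking of the origins and the verdict. The machine may stop
  sooner because the program may reach \<open>Skip\<close> before step \<open>n\<close>.\<close>

lemma run_com_tm:
  assumes "exec w c0 n (\<lambda>_. 0) [] s' u'" "com_ok R c0" "2 < R"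
  shows "\<exists>m\<le>n + 2. run (com_tm R c0) w m =
    (if s' 2 = 0 then 1 else 0, map (prog_tape w R s' u') [0..<Suc R])"
proof -
  let ?M = "com_tm R c0"
  have i: "map (prog_tape w R (\<lambda>_. 0) []) [0..<Suc R] = map2 tape_act
      (map (\<lambda>r. (if 0 < r \<and> r < R then 1 else
         map tape_read (snd (init_config ?M w)) ! r, Stay)) [0..<Suc R]) (snd (init_config ?M w))"
    using assms(3)
    by (intro nth_equalityI)
      (auto simp: init_config_def com_tm_def prog_tape_def tape_act_def tape_read_def
         word_contents_def bit_word_def nth_Cons' fun_eq_iff simp del: upt_Suc)
  have 1: "run ?M w 1 = prog_config w R (c0, \<lambda>_. 0, [])"
  proof -
    define ts where "ts = snd (init_config ?M w)"
    have "init_config ?M w = (2, ts)" by (simp add: ts_def init_config_def com_tm_def)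
    then show ?thesis unfolding prog_config_def prod.case i ts_def[symmetric]
      by (simp add: run_def tm_step_def halted_def com_tm_def com_delta_def del: upt_Suc)
  qed
  have sim: "\<exists>m\<le>n. (tm_step ?M ^^ m) (prog_config w R (c, s, u)) = prog_config w R (Skip, s', u')"
    if "exec w c n s u s' u'" "c \<in> conts c0" "com_ok R c" for c s u n
    using that
  proof (induction n arbitrary: c s u)
    case 0
    then show ?case by (auto simp: exec_def)
  next
    case (Suc n)
    show ?case
    proof (cases "c = Skip")
      case True
      then show ?thesis using Suc.prems exec_Skip[of w "Suc n" s u]
        by (intro exI[of _ 0]) (auto simp: exec_def)
    next
      case False
      obtain c1 s1 u1 where e: "pstep w (c, s, u) = (c1, s1, u1)" by (metis prod_cases3)
      have c1: "c1 = fst (nxt c (rd w s))" using e by auto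
      have "exec w c1 n s1 u1 s' u'"
        using Suc.prems(1) e by (simp add: exec_def funpow_Suc_right del: funpow.simps pstep.simps)
      moreover have "c1 \<in> conts c0" "com_ok R c1"
        using Suc.prems conts_nxt com_ok_nxt c1 by auto
      ultimately obtain m where "m \<le> n"
        "(tm_step ?M ^^ m) (prog_config w R (c1, s1, u1)) = prog_config w R (Skip, s', u')"
        using Suc.IH by blast
      moreover have "tm_step ?M (prog_config w R (c, s, u)) = prog_config w R (c1, s1, u1)"
        using tm_step_com_tm[of c c0 R w s u] Suc.prems assms(3) False e by simp
      ultimately show ?thesis
        by (intro exI[of _ "Suc m"]) (simp add: funpow_Suc_right del: funpow.simps)
    qed
  qed
  obtain m where m: "m \<le> n"
    "(tm_step ?M ^^ m) (prog_config w R (c0, \<lambda>_. 0, [])) = prog_config w R (Skip, s', u')"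
    using sim[OF assms(1) conts_self assms(2)] by blast
  have r: "run ?M w (1 + m) = prog_config w R (Skip, s', u')" by (simp only: run_add 1 m(2))
  have stay: "map2 tape_act (map (\<lambda>a. (a, Stay)) (map tape_read ts)) ts = ts" for ts
    by (induction ts) (auto simp: tape_act_def tape_read_def)
  have "run ?M w (1 + m + 1) = (if s' 2 = 0 then 1 else 0, map (prog_tape w R s' u') [0..<Suc R])"
    unfolding run_add[of _ _ "1 + m" 1] r
    using assms(3) stay[of "map (prog_tape w R s' u') [0..<Suc R]"]
    by (auto simp: tm_step_def halted_def prog_config_def com_tm_def com_delta_def conts_Skip
        prog_tape_def tape_read_def nth_append numeral_2_eq_2 simp del: upt_Suc)
  then show ?thesis using m(1) by (intro exI[of _ "1 + m + 1"]) auto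
qed

section \<open>Polynomial-time functions with unary values\<close>

definition vsize :: "('e \<Rightarrow> nat) list \<Rightarrow> 'e \<Rightarrow> nat" where
  "vsize vs e = (\<Sum>v\<leftarrow>vs. v e)"

text \<open>The base is at least 2, so constants, sums and products are all absorbed by a larger
  exponent.\<close>

definition PB :: "('e \<Rightarrow> nat) list \<Rightarrow> ('e \<Rightarrow> nat) \<Rightarrow> bool" where
  "PB vs f \<longleftrightarrow> (\<exists>k. \<forall>e. f e \<le> (vsize vs e + 2) ^ k)"

lemma PB_mono: "PB vs g \<Longrightarrow> (\<And>e. f e \<le> g e) \<Longrightarrow> PB vs f"
  unfolding PB_def by (meson order_trans)

lemma PB_const: "PB vs (\<lambda>e. c)"
proof -
  have "c \<le> (vsize vs e + 2) ^ c" for e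
    using less_exp[of c] power_mono[of 2 "vsize vs e + 2" c] by linarith
  then show ?thesis unfolding PB_def by blast
qed

lemma PB_vsize: "PB vs (vsize vs)"
  unfolding PB_def by (rule exI[of _ 1]) simp

lemma PB_var: "v \<in> set vs \<Longrightarrow> PB vs v"
  by (rule PB_mono[OF PB_vsize]) (auto simp: vsize_def intro: member_le_sum_list)

lemma PB_add: assumes "PB vs f" "PB vs g" shows "PB vs (\<lambda>e. f e + g e)"
proof -
  obtain k l where kl: "f e \<le> (vsize vs e + 2) ^ k" "g e \<le> (vsize vs e + 2) ^ l" for e
    using assms unfolding PB_def by blast
  have "f e + g e \<le> (vsize vs e + 2) ^ Suc (k + l)" for e
  proof -
    let ?x = "vsize vs e + 2"
    have "f e \<le> ?x ^ (k + l)" "g e \<le> ?x ^ (k + l)"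
      using kl[of e] power_increasing[of k "k + l" ?x] power_increasing[of l "k + l" ?x] by linarith+
    then have "f e + g e \<le> 2 * ?x ^ (k + l)" by linarith
    also have "\<dots> \<le> ?x * ?x ^ (k + l)" by (intro mult_right_mono) auto
    finally show ?thesis by simp
  qed
  then show ?thesis unfolding PB_def by blast
qed

lemma PB_mult: assumes "PB vs f" "PB vs g" shows "PB vs (\<lambda>e. f e * g e)"
proof -
  obtain k l where kl: "f e \<le> (vsize vs e + 2) ^ k" "g e \<le> (vsize vs e + 2) ^ l" for e
    using assms unfolding PB_def by blast
  have "f e * g e \<le> (vsize vs e + 2) ^ (k + l)" for e
    unfolding power_add by (intro mult_mono kl) auto
  then show ?thesis unfolding PB_def by blast
qed

lemma PB_power: "PB vs f \<Longrightarrow> PB vs (\<lambda>e. f e ^ k)"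
  by (induction k) (auto intro: PB_mult PB_const)

lemmas PB_intros = PB_const PB_vsize PB_add PB_mult PB_power

definition lift :: "('e \<Rightarrow> nat) list \<Rightarrow> ('e \<times> nat \<Rightarrow> nat) list" where
  "lift vs = map (\<lambda>v z. v (fst z)) vs @ [snd]"

lemma vsize_lift: "vsize (lift vs) z = vsize vs (fst z) + snd z"
  by (simp add: vsize_def lift_def comp_def)

lemma PB_fst: assumes "PB vs f" shows "PB (lift vs) (\<lambda>z. f (fst z))"
proof -
  obtain k where k: "f e \<le> (vsize vs e + 2) ^ k" for e
    using assms unfolding PB_def by blast
  have "f (fst z) \<le> (vsize (lift vs) z + 2) ^ k" for z
    using k[of "fst z"] power_mono[of "vsize vs (fst z) + 2" "vsize (lift vs) z + 2" k]
    by (simp add: vsize_lift)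
  then show ?thesis unfolding PB_def by blast
qed

text \<open>The cost of a loop body depends on the loop variable too; restricting that variable to
  \<open>i <= m e\<close> gives one bound for all rounds.\<close>

lemma PB_lift_bound:
  assumes "PB (lift vs) g" "PB vs m"
  shows "\<exists>g'. PB vs g' \<and> (\<forall>e i. i \<le> m e \<longrightarrow> g (e, i) \<le> g' e)"
proof -
  obtain k where k: "g z \<le> (vsize (lift vs) z + 2) ^ k" for z
    using assms(1) unfolding PB_def by blast
  have "g (e, i) \<le> (vsize vs e + m e + 2) ^ k" if "i \<le> m e" for e i
    using k[of "(e, i)"] that power_mono[of "vsize vs e + i + 2" "vsize vs e + m e + 2" k]
    by (simp add: vsize_lift)
  moreover have "PB vs (\<lambda>e. (vsize vs e + m e + 2) ^ k)" by (intro PB_intros assms)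
  ultimately show ?thesis by (intro exI[of _ "\<lambda>e. (vsize vs e + m e + 2) ^ k"]) simp
qed

definition fits :: "('e \<Rightarrow> nat) list \<Rightarrow> nat list \<Rightarrow> nat \<Rightarrow> 'e \<Rightarrow> (nat \<Rightarrow> int) \<Rightarrow> bool" where
  "fits vs rs b e s \<longleftrightarrow> s 0 = 0 \<and> (\<forall>r\<ge>b. s r = 0) \<and>
     (\<forall>i<length vs. s (rs ! i) = int ((vs ! i) e))"

text \<open>\<open>PF W vs f\<close>: with the word \<open>W e\<close> on the input tape and the variables \<open>vs\<close> stored in
  arbitrary counters below \<open>b\<close>, the value \<open>f e\<close> can be computed in counter \<open>b\<close>, in time
  polynomial in the values of the variables.\<close>

definition PF :: "('e \<Rightarrow> nat list) \<Rightarrow> ('e \<Rightarrow> nat) list \<Rightarrow> ('e \<Rightarrow> nat) \<Rightarrow> bool" where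
  "PF W vs f \<longleftrightarrow> PB vs f \<and>
     (\<forall>b rs. 0 < b \<and> length rs = length vs \<and> set rs \<subseteq> {0<..<b} \<longrightarrow>
        (\<exists>c t. PB vs t \<and> (\<forall>e s u. fits vs rs b e s \<longrightarrow>
            exec (W e) c (t e) s u (s(b := int (f e))) u)))"

lemma PF_bound: "PF W vs f \<Longrightarrow> PB vs f"
  by (simp add: PF_def)

lemma PF_obtain:
  assumes "PF W vs f" "0 < b" "length rs = length vs" "set rs \<subseteq> {0<..<b}"
  obtains c t where "PB vs t"
    "\<And>e s u. fits vs rs b e s \<Longrightarrow> exec (W e) c (t e) s u (s(b := int (f e))) u"
  using assms unfolding PF_def by meson

lemma PF_I:
  assumes "PB vs f" "\<And>b rs. 0 < b \<Longrightarrow> length rs = length vs \<Longrightarrow> set rs \<subseteq> {0<..<b} \<Longrightarrow>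
        \<exists>c t. PB vs t \<and> (\<forall>e s u. fits vs rs b e s \<longrightarrow> exec (W e) c (t e) s u (s(b := int (f e))) u)"
  shows "PF W vs f"
  using assms unfolding PF_def by blast

section \<open>Loops that count a register down to zero\<close>

lemma exec_loop:
  assumes "0 < r" "s r = int v"
    and "\<And>i. i < v \<Longrightarrow> exec w c t (S i) (U i) (S (Suc i)) (U (Suc i))"
    and "\<And>i. i \<le> v \<Longrightarrow> S i r = int (v - i)" "S 0 = s" "n \<ge> v * (t + 2) + 1" "U 0 = u"
    "S v = s'" "U v = u'"
  shows "exec w (While (Pos r) c) n s u s' u'"
proof -
  have "exec w (While (Pos r) c) n (S 0) (U 0) (S v) (U v)"
    by (rule exec_While) (use assms in \<open>auto simp: rd_def\<close>)
  then show ?thesis using assms by simp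
qed

abbreviation clr :: "nat \<Rightarrow> com" where
  "clr r \<equiv> While (Pos r) (Op (Dec r))"

abbreviation mov :: "nat \<Rightarrow> nat \<Rightarrow> com" where
  "mov r q \<equiv> While (Pos r) (Seq (Op (Dec r)) (Op (Inc q)))"

abbreviation mov2 :: "nat \<Rightarrow> nat \<Rightarrow> nat \<Rightarrow> com" where
  "mov2 r q p \<equiv> While (Pos r) (Seq (Op (Dec r)) (Seq (Op (Inc q)) (Op (Inc p))))"

abbreviation unmov :: "nat \<Rightarrow> nat \<Rightarrow> com" where
  "unmov r q \<equiv> While (Pos r) (Seq (Op (Dec r)) (Op (Dec q)))"

lemma exec_Inc: "exec w (Op (Inc r)) 1 s u (s(r := s r + 1)) u"
  and exec_Dec: "exec w (Op (Dec r)) 1 s u (s(r := s r - 1)) u"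
  by (auto intro: exec_Op)

lemma exec_eq: "exec w c m s u s1 u' \<Longrightarrow> s1 = s' \<Longrightarrow> m \<le> n \<Longrightarrow> exec w c n s u s' u'"
  using exec_mono by blast

lemma registers_nth:
  assumes "length rs = n" "set rs \<subseteq> {0<..<b}" "i < n" shows "0 < rs ! i" "rs ! i < b"
  using assms nth_mem[of i rs] by (meson greaterThanLessThan_iff subsetD)+

lemma exec_clr:
  assumes "0 < r" "s r = int v" "n \<ge> v * 3 + 1"
  shows "exec w (clr r) n s u (s(r := 0)) u"
  by (rule exec_loop[where S = "\<lambda>i. s(r := int (v - i))" and U = "\<lambda>_. u" and t = 1])
    (use assms in \<open>auto intro!: exec_Op simp: fun_eq_iff\<close>)

lemma exec_mov:
  assumes "0 < r" "s r = int v" "r \<noteq> q" "n \<ge> v * 5 + 1"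
  shows "exec w (mov r q) n s u (s(r := 0, q := s q + int v)) u"
  by (rule exec_loop[where S = "\<lambda>i. s(r := int (v - i), q := s q + int i)" and U = "\<lambda>_. u" and t = 3])
    (use assms in \<open>auto intro!: exec_eq[OF exec_Seq[OF exec_Dec exec_Inc order_refl]] simp: fun_eq_iff\<close>)

lemma exec_unmov:
  assumes "0 < r" "s r = int v" "r \<noteq> q" "n \<ge> v * 5 + 1"
  shows "exec w (unmov r q) n s u (s(r := 0, q := s q - int v)) u"
  by (rule exec_loop[where S = "\<lambda>i. s(r := int (v - i), q := s q - int i)" and U = "\<lambda>_. u" and t = 3])
    (use assms in \<open>auto intro!: exec_eq[OF exec_Seq[OF exec_Dec exec_Dec order_refl]] simp: fun_eq_iff\<close>)

lemma exec_mov2: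
  assumes "0 < r" "s r = int v" "r \<noteq> q" "r \<noteq> p" "p \<noteq> q" "n \<ge> v * 7 + 1"
  shows "exec w (mov2 r q p) n s u (s(r := 0, q := s q + int v, p := s p + int v)) u"
  by (rule exec_loop[where S = "\<lambda>i. s(r := int (v - i), q := s q + int i, p := s p + int i)"
        and U = "\<lambda>_. u" and t = 5])
    (use assms in \<open>auto intro!: exec_eq[OF exec_Seq[OF exec_Dec exec_Seq[OF exec_Inc exec_Inc order_refl]
      order_refl]] simp: fun_eq_iff\<close>)

text \<open>Reading a counter by a loop destroys it, so its value is poured into two fresh counters
  and one of them is poured back.\<close>

lemma PF_var:
  assumes "v \<in> set vs" shows "PF W vs v"
proof (rule PF_I)
  show "PB vs v" using assms by (rule PB_var)
  fix b :: nat and rs :: "nat list"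
  assume b: "0 < b" "length rs = length vs" "set rs \<subseteq> {0<..<b}"
  obtain i where i: "i < length vs" "v = vs ! i" using assms by (auto simp: in_set_conv_nth)
  let ?r = "rs ! i"
  have r: "0 < ?r" "?r < b" using registers_nth[OF b(2,3) i(1)] .
  have "exec (W e) (Seq (mov2 ?r b (b + 1)) (mov (b + 1) ?r)) (12 * v e + 3) s u (s(b := int (v e))) u"
    if "fits vs rs b e s" for e s u
  proof -
    have s: "s ?r = int (v e)" "s b = 0" "s (b + 1) = 0" using that i by (auto simp: fits_def)
    let ?s = "s(?r := 0, b := s b + int (v e), b + 1 := s (b + 1) + int (v e))"
    have "exec (W e) (mov (b + 1) ?r) (v e * 5 + 1) ?s u
        (?s(b + 1 := 0, ?r := ?s ?r + int (v e))) u"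
      by (rule exec_mov) (use r s in auto)
    moreover have "?s(b + 1 := 0, ?r := ?s ?r + int (v e)) = s(b := int (v e))"
      using r s by (auto simp: fun_eq_iff)
    moreover have "exec (W e) (mov2 ?r b (b + 1)) (v e * 7 + 1) s u ?s u"
      by (rule exec_mov2) (use r s in auto)
    ultimately show ?thesis by (auto intro!: exec_Seq)
  qed
  moreover have "PB vs (\<lambda>e. 12 * v e + 3)" by (intro PB_intros PB_var assms)
  ultimately show "\<exists>c t. PB vs t \<and> (\<forall>e s u. fits vs rs b e s \<longrightarrow>
      exec (W e) c (t e) s u (s(b := int (v e))) u)"
    by (intro exI[of _ "Seq (mov2 ?r b (b + 1)) (mov (b + 1) ?r)"] exI[of _ "\<lambda>e. 12 * v e + 3"]) auto
qed

lemma PF_0: "PF W vs (\<lambda>e. 0)"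
proof (rule PF_I)
  show "PB vs (\<lambda>e. 0)" by (rule PB_const)
  fix b :: nat and rs :: "nat list"
  have "exec (W e) Skip 0 s u (s(b := int 0)) u" if "fits vs rs b e s" for e s u
  proof -
    have "s(b := int 0) = s" using that by (auto simp: fits_def fun_eq_iff)
    then show ?thesis by (metis exec_Skip)
  qed
  then show "\<exists>c t. PB vs t \<and> (\<forall>e s u. fits vs rs b e s \<longrightarrow>
      exec (W e) c (t e) s u (s(b := int 0)) u)"
    using PB_const by blast
qed

lemma PF_Suc: assumes "PF W vs f" shows "PF W vs (\<lambda>e. Suc (f e))"
proof (rule PF_I)
  show "PB vs (\<lambda>e. Suc (f e))"
    using PB_add[OF PF_bound[OF assms] PB_const[of vs 1]] by simp
  fix b :: nat and rs :: "nat list"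
  assume b: "0 < b" "length rs = length vs" "set rs \<subseteq> {0<..<b}"
  obtain c t where ct: "PB vs t"
    "\<And>e s u. fits vs rs b e s \<Longrightarrow> exec (W e) c (t e) s u (s(b := int (f e))) u"
    using PF_obtain[OF assms b] by metis
  have "exec (W e) (Seq c (Op (Inc b))) (t e + 2) s u (s(b := int (Suc (f e)))) u"
    if "fits vs rs b e s" for e s u
    by (rule exec_Seq[OF ct(2)[OF that] exec_Op[of _ _ _ _ _ 1]]) auto
  moreover have "PB vs (\<lambda>e. t e + 2)" by (intro PB_intros ct)
  ultimately show "\<exists>c t. PB vs t \<and> (\<forall>e s u. fits vs rs b e s \<longrightarrow>
      exec (W e) c (t e) s u (s(b := int (Suc (f e)))) u)"
    by (intro exI[of _ "Seq c (Op (Inc b))"] exI[of _ "\<lambda>e. t e + 2"]) auto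
qed

text \<open>Symbols above 3 count as 0, so that tests for 1, 2 and 3 determine the value.\<close>

definition sym_at :: "nat list \<Rightarrow> nat \<Rightarrow> nat" where
  "sym_at w p = (let a = word_contents w (int p) in if a \<le> 3 then a else 0)"

text \<open>Counter \<open>b\<close> carries the input head to position \<open>f e\<close> while
  \<open>b + 1\<close> remembers the way back. The symbol found there is counted into the emptied
  \<open>b\<close>, and \<open>unmov\<close> rewinds the head.\<close>

lemma PF_sym_at: assumes "PF W vs f" shows "PF W vs (\<lambda>e. sym_at (W e) (f e))"
proof (rule PF_I)
  show "PB vs (\<lambda>e. sym_at (W e) (f e))"
    by (rule PB_mono[OF PB_const[of _ 3]]) (auto simp: sym_at_def Let_def)
  fix b :: nat and rs :: "nat list"
  assume b: "0 < b" "length rs = length vs" "set rs \<subseteq> {0<..<b}"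
  obtain c t where ct: "PB vs t"
    "\<And>e s u. fits vs rs b e s \<Longrightarrow> exec (W e) c (t e) s u (s(b := int (f e))) u"
    using PF_obtain[OF assms b] by metis
  let ?i = "Op (Inc b)"
  let ?R = "Cond (Sym 1) ?i (Cond (Sym 2) (Seq ?i ?i) (Cond (Sym 3) (Seq ?i (Seq ?i ?i)) Skip))"
  let ?C = "Seq c (Seq (mov2 b 0 (b + 1)) (Seq ?R (unmov (b + 1) 0)))"
  let ?T = "\<lambda>e. t e + 12 * f e + 30"
  have "exec (W e) ?C (?T e) s u (s(b := int (sym_at (W e) (f e)))) u"
    if fit: "fits vs rs b e s" for e s u
  proof -
    have s: "s b = 0" "s (b + 1) = 0" "s 0 = 0" using fit by (auto simp: fits_def)
    let ?s0 = "s(b := int (f e))"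
    let ?s1 = "?s0(b := 0, 0 := ?s0 0 + int (f e), b + 1 := ?s0 (b + 1) + int (f e))"
    have e1: "exec (W e) (mov2 b 0 (b + 1)) (f e * 7 + 1) ?s0 u ?s1 u"
      by (rule exec_mov2) (use b in auto)
    define a where "a = word_contents (W e) (int (f e))"
    define A where "A x = s(b := int x, 0 := int (f e), b + 1 := int (f e))" for x
    have rd: "rd (W e) (A x) 0 = a" for x
      by (simp add: rd_def A_def a_def)
    have eq1: "?s1 = A 0"
      using s b by (auto simp: fun_eq_iff A_def)
    have i: "exec (W e) ?i 1 (A x) u (A (Suc x)) u" for x
      by (rule exec_Op) (use b in \<open>auto simp: fun_eq_iff A_def\<close>)
    have "exec (W e) (Cond (Sym 3) (Seq ?i (Seq ?i ?i)) Skip) 6 (A 0) u (A (if a = 3 then 3 else 0)) u"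
      using exec_Seq[OF i exec_Seq[OF i i order_refl] order_refl, of 0]
      by - (rule exec_Cond[where n = 5], auto simp: rd exec_Skip eval_nat_numeral)
    then have "exec (W e) (Cond (Sym 2) (Seq ?i ?i) (Cond (Sym 3) (Seq ?i (Seq ?i ?i)) Skip)) 7
        (A 0) u (A (if a = 2 then 2 else if a = 3 then 3 else 0)) u"
      using exec_Seq[OF i i, of 6 0]
      by - (rule exec_Cond[where n = 6], auto simp: rd eval_nat_numeral split: if_splits)
    then have "exec (W e) ?R 8 (A 0) u (A (if a = 1 then 1 else if a = 2 then 2 else if a = 3 then 3 else 0)) u"
      using exec_mono[OF i, of 7 0]
      by - (rule exec_Cond[where n = 7], auto simp: rd split: if_splits)
    moreover have "(if a = 1 then 1 else if a = 2 then 2 else if a = 3 then 3 else 0) = sym_at (W e) (f e)"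
      by (auto simp: sym_at_def a_def Let_def)
    ultimately have e2: "exec (W e) ?R 8 ?s1 u (A (sym_at (W e) (f e))) u"
      unfolding eq1 by simp
    let ?s2 = "A (sym_at (W e) (f e))"
    let ?s3 = "?s2(b + 1 := 0, 0 := ?s2 0 - int (f e))"
    have e3: "exec (W e) (unmov (b + 1) 0) (f e * 5 + 1) ?s2 u ?s3 u"
      by (rule exec_unmov) (use b in \<open>auto simp: A_def\<close>)
    have eq: "?s3 = s(b := int (sym_at (W e) (f e)))" using s b by (auto simp: fun_eq_iff A_def)
    show ?thesis
      using exec_Seq[OF ct(2)[OF fit] exec_Seq[OF e1 exec_Seq[OF e2 e3 order_refl] order_refl], of "?T e"]
      unfolding eq by simp
  qed
  moreover have "PB vs ?T" by (intro PB_intros ct PF_bound[OF assms])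
  ultimately show "\<exists>c t. PB vs t \<and> (\<forall>e s u. fits vs rs b e s \<longrightarrow>
      exec (W e) c (t e) s u (s(b := int (sym_at (W e) (f e)))) u)"
    by (intro exI[of _ ?C] exI[of _ ?T]) auto
qed

text \<open>Register \<open>b\<close> holds the accumulator, \<open>b + 1\<close> the rounds left,
  \<open>b + 2\<close> the index and \<open>b + 3\<close> the next value. The time of a step is
  polynomial in its arguments, among them the accumulator; the bound \<open>bd\<close> on all
  intermediate values makes it polynomial in the variables.\<close>

lemma PF_rec:
  assumes m: "PF W vs m" and a: "PF W vs a"
    and h: "PF (\<lambda>z. W (fst (fst z))) (lift (lift vs)) (\<lambda>z. h (fst (fst z)) (snd (fst z)) (snd z))"
    and bd: "PB vs bd" "\<And>e i. i \<le> m e \<Longrightarrow> rec_nat (a e) (h e) i \<le> bd e"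
  shows "PF W vs (\<lambda>e. rec_nat (a e) (h e) (m e))"
proof (rule PF_I)
  show "PB vs (\<lambda>e. rec_nat (a e) (h e) (m e))" by (rule PB_mono[OF bd(1)]) (simp add: bd)
  fix b :: nat and rs :: "nat list"
  assume b: "0 < b" "length rs = length vs" "set rs \<subseteq> {0<..<b}"
  obtain ca ta where ca: "PB vs ta"
    "\<And>e s u. fits vs rs b e s \<Longrightarrow> exec (W e) ca (ta e) s u (s(b := int (a e))) u"
    using PF_obtain[OF a b] by metis
  obtain cm tm where cm: "PB vs tm" "\<And>e s u. fits vs rs (b + 1) e s \<Longrightarrow>
      exec (W e) cm (tm e) s u (s(b + 1 := int (m e))) u"
  proof (rule PF_obtain[OF m, of "b + 1" rs])
    show "set rs \<subseteq> {0<..<b + 1}" using b by auto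
  qed (use b in auto)
  \<comment> \<open>Index and accumulator, in the order in which the two uses of \<open>lift\<close>
    append them.\<close>
  let ?rs = "rs @ [b + 2, b]"
  obtain ch th where ch: "PB (lift (lift vs)) th"
    "\<And>z s u. fits (lift (lift vs)) ?rs (b + 3) z s \<Longrightarrow> exec (W (fst (fst z))) ch (th z) s u
      (s(b + 3 := int (h (fst (fst z)) (snd (fst z)) (snd z)))) u"
  proof (rule PF_obtain[OF h, of "b + 3" ?rs])
    show "set ?rs \<subseteq> {0<..<b + 3}" using b by auto
    show "length ?rs = length (lift (lift vs))" using b by (simp add: lift_def)
  qed auto
  \<comment> \<open>First the accumulator, then the index is eliminated from the time bound.\<close>
  obtain t1 where t1: "PB (lift vs) t1" "\<And>z x. x \<le> bd (fst z) \<Longrightarrow> th (z, x) \<le> t1 z"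
    using PB_lift_bound[OF ch(1) PB_fst[OF bd(1)]] by blast
  obtain t2 where t2: "PB vs t2" "\<And>e i. i \<le> m e \<Longrightarrow> t1 (e, i) \<le> t2 e"
    using PB_lift_bound[OF t1(1) PF_bound[OF m]] by blast
  let ?B = "Seq (Op (Dec (b + 1))) (Seq ch (Seq (clr b) (Seq (mov (b + 3) b) (Op (Inc (b + 2))))))"
  let ?tB = "\<lambda>e. t2 e + 8 * bd e + 8"
  let ?C = "Seq ca (Seq cm (Seq (While (Pos (b + 1)) ?B) (clr (b + 2))))"
  let ?T = "\<lambda>e. ta e + tm e + m e * (?tB e + 2) + m e * 3 + 5"
    have "exec (W e) ?C (?T e) s u (s(b := int (rec_nat (a e) (h e) (m e)))) u"
    if fit: "fits vs rs b e s" for e s u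
  proof -
    have rs: "rs ! i < b" "0 < rs ! i" if "i < length vs" for i
      using registers_nth[OF b(2,3) that] by auto
    define g where "g i = rec_nat (a e) (h e) i" for i
    define S where "S i = s(b := int (g i), b + 1 := int (m e - i), b + 2 := int i)" for i
    have s: "s 0 = 0" "s r = 0" if "r \<ge> b" for r using fit that by (auto simp: fits_def)
    have e1: "exec (W e) ca (ta e) s u (s(b := int (a e))) u" by (rule ca(2)[OF fit])
    have "fits vs rs (b + 1) e (s(b := int (a e)))"
      using fit rs b unfolding fits_def by (metis Suc_eq_plus1 Suc_leD fun_upd_apply less_irrefl not_less_eq_eq)
    then have e2: "exec (W e) cm (tm e) (s(b := int (a e))) u (s(b := int (a e), b + 1 := int (m e))) u"
      by (rule cm(2))
    have S0: "s(b := int (a e), b + 1 := int (m e)) = S 0"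
      using s by (auto simp: S_def g_def fun_eq_iff)
    have body: "exec (W e) ?B (?tB e) (S i) u (S (Suc i)) u" if i: "i < m e" for i
    proof -
      let ?s1 = "s(b := int (g i), b + 1 := int (m e - Suc i), b + 2 := int i)"
      let ?s2 = "?s1(b + 3 := int (g (Suc i)))"
      let ?s3 = "?s2(b := 0)"
      let ?s4 = "?s3(b + 3 := 0, b := ?s3 b + int (g (Suc i)))"
      have f1: "exec (W e) (Op (Dec (b + 1))) 1 (S i) u ?s1 u"
        by (rule exec_Op) (use i in \<open>auto simp: S_def fun_eq_iff\<close>)
      have "fits (lift (lift vs)) ?rs (b + 3) ((e, i), g i) ?s1"
        unfolding fits_def
      proof (intro conjI allI impI)
        show "?s1 0 = 0" "\<And>r. r \<ge> b + 3 \<Longrightarrow> ?s1 r = 0" using fit b by (auto simp: fits_def)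
        fix j assume "j < length (lift (lift vs))"
        then consider "j < length vs" | "j = length vs" | "j = Suc (length vs)"
          by (auto simp: lift_def less_Suc_eq)
        then show "?s1 (?rs ! j) = int ((lift (lift vs) ! j) ((e, i), g i))"
        proof cases
          case 1
          then show ?thesis using rs[of j] fit b by (simp add: fits_def lift_def nth_append)
        qed (use b in \<open>auto simp: lift_def nth_append\<close>)
      qed
      from ch(2)[OF this, of u] have f2: "exec (W e) ch (th ((e, i), g i)) ?s1 u ?s2 u"
        by (simp add: g_def)
      have bdi: "g i \<le> bd e" "g (Suc i) \<le> bd e" using bd(2) i by (auto simp: g_def simp del: nat.rec)
      have "th ((e, i), g i) \<le> t1 (e, i)" using t1(2)[of "g i" "(e, i)"] bdi by simp
      also have "\<dots> \<le> t2 e" using t2(2) i by simp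
      finally have th: "th ((e, i), g i) \<le> t2 e" .
      have f3: "exec (W e) (clr b) (g i * 3 + 1) ?s2 u ?s3 u"
        by (rule exec_clr) (use b in auto)
      have f4: "exec (W e) (mov (b + 3) b) (g (Suc i) * 5 + 1) ?s3 u ?s4 u"
        by (rule exec_mov) auto
      have f5: "exec (W e) (Op (Inc (b + 2))) 1 ?s4 u (S (Suc i)) u"
        by (rule exec_Op) (use s in \<open>auto simp: S_def fun_eq_iff\<close>)
      show ?thesis
        by (rule exec_Seq[OF f1 exec_Seq[OF f2 exec_Seq[OF f3 exec_Seq[OF f4 f5 order_refl]
            order_refl] order_refl]]) (use th bdi in simp)
    qed
    have e3: "exec (W e) (While (Pos (b + 1)) ?B) (m e * (?tB e + 2) + 1) (S 0) u (S (m e)) u"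
    proof (rule exec_loop[where S = S and U = "\<lambda>_. u" and t = "?tB e"])
      show "exec (W e) ?B (?tB e) (S i) u (S (Suc i)) u" if "i < m e" for i by (rule body[OF that])
    qed (use b in \<open>auto simp: S_def\<close>)
    have e4: "exec (W e) (clr (b + 2)) (m e * 3 + 1) (S (m e)) u ((S (m e))(b + 2 := 0)) u"
      by (rule exec_clr) (auto simp: S_def)
    have fin: "(S (m e))(b + 2 := 0) = s(b := int (rec_nat (a e) (h e) (m e)))"
      using s by (auto simp: S_def g_def fun_eq_iff)
    show ?thesis
      using exec_Seq[OF e1 exec_Seq[OF e2[unfolded S0] exec_Seq[OF e3 e4 order_refl] order_refl], of "?T e"]
      unfolding fin by simp
  qed
  moreover have "PB vs ?T" by (intro PB_intros ca cm t2 bd PF_bound[OF m])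
  ultimately show "\<exists>c t. PB vs t \<and> (\<forall>e s u. fits vs rs b e s \<longrightarrow>
      exec (W e) c (t e) s u (s(b := int (rec_nat (a e) (h e) (m e)))) u)"
    by (intro exI[of _ ?C] exI[of _ ?T]) auto
qed

lemma PF_const: "PF W vs (\<lambda>e. c)"
  by (induction c) (auto intro: PF_0 PF_Suc)

lemma PF_fst: assumes "PF W vs f" shows "PF (\<lambda>z. W (fst z)) (lift vs) (\<lambda>z. f (fst z))"
proof (rule PF_I)
  show "PB (lift vs) (\<lambda>z. f (fst z))" by (rule PB_fst[OF PF_bound[OF assms]])
  fix b :: nat and rs :: "nat list"
  assume b: "0 < b" "length rs = length (lift vs)" "set rs \<subseteq> {0<..<b}"
  let ?rs = "butlast rs"
  have l: "length ?rs = length vs" using b(2) by (simp add: lift_def)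
  have "set ?rs \<subseteq> {0<..<b}" using b(3) by (meson in_set_butlastD subset_eq)
  then obtain c t where ct: "PB vs t"
    "\<And>e s u. fits vs ?rs b e s \<Longrightarrow> exec (W e) c (t e) s u (s(b := int (f e))) u"
    using PF_obtain[OF assms b(1) l] by metis
  have "fits vs ?rs b (fst z) s" if "fits (lift vs) rs b z s" for z s
    unfolding fits_def
  proof (intro conjI allI impI)
    fix i assume i: "i < length vs"
    then have "s (rs ! i) = int ((lift vs ! i) z)" using that by (auto simp: fits_def lift_def)
    then show "s (?rs ! i) = int ((vs ! i) (fst z))"
      using i l by (simp add: lift_def nth_append nth_butlast)
  qed (use that in \<open>auto simp: fits_def\<close>)
  then show "\<exists>c t. PB (lift vs) t \<and> (\<forall>z s u. fits (lift vs) rs b z s \<longrightarrow>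
      exec (W (fst z)) c (t z) s u (s(b := int (f (fst z)))) u)"
    using ct PB_fst[OF ct(1)] by (intro exI[of _ c] exI[of _ "\<lambda>z. t (fst z)"]) auto
qed

lemma PF_snd: "PF W (lift vs) snd"
  by (rule PF_var) (simp add: lift_def)

section \<open>Arithmetic by primitive recursion\<close>

lemma PF_add: assumes "PF W vs f" "PF W vs g" shows "PF W vs (\<lambda>e. f e + g e)"
proof -
  have e: "rec_nat a (\<lambda>i acc. Suc acc) n = a + n" for a n by (induction n) auto
  show ?thesis
    using PF_rec[OF assms(2,1) PF_Suc[OF PF_snd] PB_add[OF PF_bound[OF assms(1)] PF_bound[OF assms(2)]]]
    by (simp add: e)
qed

text \<open>The predecessor is the recursion whose step returns its own index; truncated subtraction
  iterates it.\<close>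

lemma PF_diff: assumes "PF W vs f" "PF W vs g" shows "PF W vs (\<lambda>e. f e - g e)"
proof -
  have e: "rec_nat 0 (\<lambda>i acc. i) n = n - 1" for n by (induction n) auto
  have pred: "PF W' ws (\<lambda>e. v e - 1)" if "PF W' ws v" for W' and ws :: "('b \<Rightarrow> nat) list" and v
    using PF_rec[OF that PF_0 PF_fst[OF PF_snd] PF_bound[OF that]] by (auto simp: e)
  have e: "rec_nat a (\<lambda>i acc. acc - 1) n = a - n" for a n by (induction n) auto
  show ?thesis
    using PF_rec[OF assms(2,1) pred[OF PF_snd], of f] PF_bound[OF assms(1)] by (simp only: e)
qed

lemma PF_sum:
  assumes m: "PF W vs m" and g: "PF (\<lambda>z. W (fst z)) (lift vs) (\<lambda>z. g (fst z) (snd z))"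
  shows "PF W vs (\<lambda>e. \<Sum>i<m e. g e i)"
proof -
  have e: "rec_nat 0 (\<lambda>i acc. acc + h i) n = (\<Sum>i<n. h i)" for h :: "nat \<Rightarrow> nat" and n
    by (induction n) auto
  obtain g' where g': "PB vs g'" "\<And>e i. i \<le> m e \<Longrightarrow> g e i \<le> g' e"
    using PB_lift_bound[OF PF_bound[OF g] PF_bound[OF m]] by auto
  have le: "(\<Sum>i<n. g e i) \<le> m e * g' e" if "n \<le> m e" for n e
  proof -
    have "(\<Sum>i<n. g e i) \<le> n * g' e" using sum_bounded_above[of "{..<n}" "g e" "g' e"] g'(2) that by simp
    then show ?thesis using that by (meson le_trans mult_right_mono zero_le)
  qed
  have "PF W vs (\<lambda>e. rec_nat 0 (\<lambda>i acc. acc + g e i) (m e))"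
    by (rule PF_rec[OF m PF_0, of _ "\<lambda>e. m e * g' e"])
      (auto simp: e le intro!: PF_add PF_snd PF_fst[OF g] PB_mult[OF PF_bound[OF m] g'(1)])
  then show ?thesis by (simp add: e)
qed

lemma PF_mult: assumes "PF W vs f" "PF W vs g" shows "PF W vs (\<lambda>e. f e * g e)"
  using PF_sum[OF assms(1) PF_fst[OF assms(2)]] by simp

section \<open>Predicates and bounded quantifiers\<close>

definition PD :: "('e \<Rightarrow> nat list) \<Rightarrow> ('e \<Rightarrow> nat) list \<Rightarrow> ('e \<Rightarrow> bool) \<Rightarrow> bool" where
  "PD W vs P \<longleftrightarrow> PF W vs (\<lambda>e. of_bool (P e))"

lemma PF_of_bool: "PD W vs P \<Longrightarrow> PF W vs (\<lambda>e. of_bool (P e))"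
  by (simp add: PD_def)

lemma PD_I:
  assumes "PF W vs f" "\<And>e. f e = of_bool (P e)" shows "PD W vs P"
proof -
  have "f = (\<lambda>e. of_bool (P e))" using assms(2) by (rule ext)
  then show ?thesis using assms(1) by (simp add: PD_def)
qed

lemma PD_fst: "PD W vs P \<Longrightarrow> PD (\<lambda>z. W (fst z)) (lift vs) (\<lambda>z. P (fst z))"
  unfolding PD_def by (rule PF_fst)

lemma PD_const: "PD W vs (\<lambda>e. P)"
  unfolding PD_def by (rule PF_const)

lemma PD_not: assumes "PD W vs P" shows "PD W vs (\<lambda>e. \<not> P e)"
  by (rule PD_I[OF PF_diff[OF PF_const[where c = 1] PF_of_bool[OF assms]]]) auto

lemma PD_conj: "PD W vs P \<Longrightarrow> PD W vs Q \<Longrightarrow> PD W vs (\<lambda>e. P e \<and> Q e)"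
  unfolding PD_def of_bool_conj by (rule PF_mult)

lemma PD_disj: assumes "PD W vs P" "PD W vs Q" shows "PD W vs (\<lambda>e. P e \<or> Q e)"
  using PD_not[OF PD_conj[OF assms[THEN PD_not]]] by simp

lemma PD_imp: assumes "PD W vs P" "PD W vs Q" shows "PD W vs (\<lambda>e. P e \<longrightarrow> Q e)"
  using PD_disj[OF PD_not[OF assms(1)] assms(2)] by (simp only: imp_conv_disj)

lemma PD_iff: assumes "PD W vs P" "PD W vs Q" shows "PD W vs (\<lambda>e. P e \<longleftrightarrow> Q e)"
  using PD_conj[OF PD_imp[OF assms] PD_imp[OF assms(2,1)]] by (simp only: iff_conv_conj_imp)

lemma PD_le: assumes "PF W vs f" "PF W vs g" shows "PD W vs (\<lambda>e. f e \<le> g e)"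
  by (rule PD_I[OF PF_diff[OF PF_const[where c = 1] PF_diff[OF assms]]]) auto

lemma PD_less: assumes "PF W vs f" "PF W vs g" shows "PD W vs (\<lambda>e. f e < g e)"
  using PD_le[OF PF_Suc[OF assms(1)] assms(2)] by (simp add: Suc_le_eq)

lemma PD_eq: assumes "PF W vs f" "PF W vs g" shows "PD W vs (\<lambda>e. f e = g e)"
  using PD_conj[OF PD_le[OF assms] PD_le[OF assms(2,1)]] by (simp only: eq_iff)

lemma PD_ex:
  assumes "PF W vs m" "PD (\<lambda>z. W (fst z)) (lift vs) (\<lambda>z. P (fst z) (snd z))"
  shows "PD W vs (\<lambda>e. \<exists>i<m e. P e i)"
proof -
  have "0 < (\<Sum>i<n. of_bool (Q i) :: nat) \<longleftrightarrow> (\<exists>i<n. Q i)" for Q and n :: nat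
    by (subst neq0_conv[symmetric], subst sum_eq_0_iff) auto
  then show ?thesis using PD_less[OF PF_0 PF_sum[OF assms(1) PF_of_bool[OF assms(2)]]] by simp
qed

lemma PD_all:
  assumes "PF W vs m" "PD (\<lambda>z. W (fst z)) (lift vs) (\<lambda>z. P (fst z) (snd z))"
  shows "PD W vs (\<lambda>e. \<forall>i<m e. P e i)"
  using PD_not[OF PD_ex[OF assms(1) PD_not[OF assms(2)]]] by simp

lemma PF_if:
  assumes "PD W vs P" "PF W vs f" "PF W vs g" shows "PF W vs (\<lambda>e. if P e then f e else g e)"
proof -
  have "PF W vs (\<lambda>e. of_bool (P e) * f e + of_bool (\<not> P e) * g e)"
    by (intro PF_add PF_mult PF_of_bool PD_not assms)
  moreover have "of_bool P * x + of_bool (\<not> P) * y = (if P then x else y)" for P and x y :: nat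
    by simp
  ultimately show ?thesis by (simp del: of_bool_not_iff)
qed

text \<open>For \<open>b > 0\<close>, \<open>a div b\<close> is the number of positive multiples of
  \<open>b\<close> not exceeding \<open>a\<close>, and testing the first \<open>a\<close> multiples
  is enough.\<close>

lemma PF_div: assumes "PF W vs f" "PF W vs g" shows "PF W vs (\<lambda>e. f e div g e)"
proof -
  have "PF W vs (\<lambda>e. if g e = 0 then 0 else \<Sum>i<f e. of_bool (Suc i * g e \<le> f e))"
    by (intro PF_if PF_sum PF_of_bool PD_le PF_mult PF_Suc PF_snd PF_fst PD_eq PF_const assms)
  moreover have "(if b = 0 then 0 else \<Sum>i<a. of_bool (Suc i * b \<le> a)) = a div b" for a b :: nat
  proof (cases "b = 0")
    case False
    then have "(Suc i * b \<le> a) = (i < a div b)" for i by (simp add: less_eq_div_iff_mult_less_eq Suc_le_eq[symmetric])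
    moreover have "{..<a} \<inter> {i. i < a div b} = {..<a div b}"
      by (auto intro: less_le_trans[OF _ div_le_dividend])
    ultimately show ?thesis using False by (simp add: sum.If_cases of_bool_def del: mult_Suc)
  qed simp
  ultimately show ?thesis by simp
qed

lemma PF_mod: assumes "PF W vs f" "PF W vs g" shows "PF W vs (\<lambda>e. f e mod g e)"
  using PF_diff[OF assms(1) PF_mult[OF PF_div[OF assms] assms(2)]] by (simp add: minus_div_mult_eq_mod)

lemma PF_power: "PF W vs f \<Longrightarrow> PF W vs (\<lambda>e. f e ^ k)"
  by (induction k) (auto intro: PF_mult PF_const)

lemma PF_poly: "PF W vs f \<Longrightarrow> PF W vs (\<lambda>e. poly p (f e))"
  by (induction p) (auto intro!: PF_add PF_mult PF_const)

lemma PF_min: "PF W vs f \<Longrightarrow> PF W vs g \<Longrightarrow> PF W vs (\<lambda>e. min (f e) (g e))"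
  unfolding min_def by (intro PF_if PD_le)

text \<open>A constant number of comparisons selects the branch, so \<open>g\<close> may depend on
  \<open>c\<close> in any way. This is how arbitrary functions on a finite range, such as transition
  functions, enter the class.\<close>

lemma PF_cases:
  assumes "PF W vs f" "\<And>c. c < n \<Longrightarrow> PF W vs (g c)"
  shows "PF W vs (\<lambda>e. if f e < n then g (f e) e else 0)"
  using assms(2)
proof (induction n)
  case (Suc n)
  have "PF W vs (\<lambda>e. if f e = n then g n e else if f e < n then g (f e) e else 0)"
    by (rule PF_if[OF PD_eq[OF assms(1) PF_const] Suc.prems Suc.IH[OF Suc.prems]]) auto
  moreover have "(\<lambda>e. if f e = n then g n e else if f e < n then g (f e) e else 0) =
      (\<lambda>e. if f e < Suc n then g (f e) e else 0)" by (auto simp: fun_eq_iff)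
  ultimately show ?case by simp
qed (simp add: PF_0)

lemma PD_cases: assumes "PF W vs f" shows "PD W vs (\<lambda>e. f e < n \<and> Q (f e))"
  by (rule PD_I[OF PF_cases[OF assms PF_const[where c = "of_bool (Q _)"]]]) auto

lemma PD_even: "PF W vs f \<Longrightarrow> PD W vs (\<lambda>e. even (f e))"
  unfolding even_iff_mod_2_eq_zero by (intro PD_eq PF_mod PF_const)

lemmas PF_intros = PD_conj PD_disj PD_imp PD_iff PD_not PD_ex PD_all PD_le PD_less PD_eq PD_even
  PF_if PF_add PF_diff PF_mult PF_div PF_mod PF_power PF_poly PF_min PF_sum PF_of_bool
  PF_sym_at PF_Suc PF_snd PF_const PD_const PF_fst PD_fst

section \<open>Polynomial-time Turing machines\<close>

abbreviation len_com :: com where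
  "len_com \<equiv> Seq (While (NotSym 0) (Seq (Op (Inc 0)) (Seq (Op (Inc 1)) (Op (Inc 2))))) (unmov 2 0)"

text \<open>A word without blanks ends at the first blank. One copy of the count is kept, the other
  brings the head back.\<close>

lemma exec_len:
  assumes "0 \<notin> set w"
  shows "exec w len_com (12 * length w + 3) (\<lambda>_. 0) u ((\<lambda>_. 0)(1 := int (length w))) u"
proof -
  define S where "S i = (\<lambda>r::nat. if r \<le> 2 then int i else 0)" for i
  have 1: "exec w (While (NotSym 0) (Seq (Op (Inc 0)) (Seq (Op (Inc 1)) (Op (Inc 2)))))
     (length w * 7 + 1) (S 0) u (S (length w)) u"
  proof (rule exec_While)
    fix i assume i: "i < length w"
    have "w ! i \<noteq> 0" using assms i nth_mem by metis
    moreover have "exec w (Seq (Op (Inc 0)) (Seq (Op (Inc 1)) (Op (Inc 2)))) 5 (S i) u (S (Suc i)) u"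
      by (rule exec_eq[OF exec_Seq[OF exec_Inc exec_Seq[OF exec_Inc exec_Inc order_refl] order_refl]])
        (auto simp: S_def fun_eq_iff)
    ultimately show "holds (rd w (S i)) (NotSym 0) \<and>
        exec w (Seq (Op (Inc 0)) (Seq (Op (Inc 1)) (Op (Inc 2)))) 5 (S i) u (S (Suc i)) u"
      using i by (simp add: rd_def S_def word_contents_def)
  qed (auto simp: rd_def S_def word_contents_def)
  have 2: "exec w (unmov 2 0) (length w * 5 + 1) (S (length w)) u ((\<lambda>_. 0)(1 := int (length w))) u"
    by (rule exec_eq[OF exec_unmov[OF _ _ _ order_refl, where v = "length w"]]) (auto simp: S_def fun_eq_iff)
  have "S 0 = (\<lambda>_. 0)" by (auto simp: S_def)
  then show ?thesis using exec_Seq[OF 1 2, of "12 * length w + 3"] by simp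
qed

lemma com_tm_correct:
  assumes "\<And>w. 0 \<notin> set w \<Longrightarrow> exec w c (t w) (\<lambda>_. 0) [] (s w) (v w)" "PB [length] t"
  shows "\<exists>M k. turing_machine M \<and> (\<forall>w. 0 \<notin> set w \<longrightarrow>
    (let d = run M w ((length w + 2) ^ k) in halted M d \<and>
      fst d = (if s w 2 = 0 then reject_state M else accept_state M) \<and>
      fst (last (snd d)) = word_contents (bit_word (v w))))"
proof -
  obtain R0 where "com_ok R0 c" using com_ok_ex by blast
  \<comment> \<open>At least three registers, so that tape 2, which decides the verdict, is a
    counter tape.\<close>
  then have R: "com_ok (R0 + 3) c" "2 < R0 + 3" by (auto intro: com_ok_mono)
  define R where "R = R0 + 3"
  note R = R[folded R_def]
  let ?M = "com_tm R c"
  have "PB [length] (\<lambda>w. t w + 2)" by (intro PB_intros assms)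
  then obtain k where k: "t w + 2 \<le> (length w + 2) ^ k" for w
    by (auto simp: PB_def vsize_def)
  have "let d = run ?M w ((length w + 2) ^ k) in halted ?M d \<and>
      fst d = (if s w 2 = 0 then reject_state ?M else accept_state ?M) \<and>
      fst (last (snd d)) = word_contents (bit_word (v w))" if w: "0 \<notin> set w" for w
  proof -
    obtain m where m: "m \<le> t w + 2" "run ?M w m =
        (if s w 2 = 0 then 1 else 0, map (prog_tape w R (s w) (v w)) [0..<Suc R])"
      using run_com_tm[OF assms(1)[OF w] R] by blast
    have h: "halted ?M (run ?M w m)" using m(2) by (auto simp: halted_def com_tm_def)
    have "run ?M w ((length w + 2) ^ k) = run ?M w m"
      using run_add[of ?M w m "(length w + 2) ^ k - m"] m(1) k[of w] tm_step_halted[OF h] by simp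
    then show ?thesis using h m(2) R by (auto simp: com_tm_def prog_tape_def)
  qed
  then show ?thesis using turing_machine_com_tm by blast
qed

lemma run_halted:
  assumes "halted M (run M w t)" "t \<le> t'" shows "run M w t' = run M w t"
  using run_add[of M w t "t' - t"] assms tm_step_halted by simp

lemma accepts_iff_halted:
  assumes "turing_machine M" "halted M (run M w t)"
  shows "accepts M w \<longleftrightarrow> fst (run M w t) = accept_state M"
proof
  assume "accepts M w"
  then obtain t' where t': "fst (run M w t') = accept_state M" by (auto simp: accepts_def)
  then have "halted M (run M w t')" by (simp add: halted_def)
  then show "fst (run M w t) = accept_state M"
    using t' run_halted assms(2) by (metis nat_le_linear)
qed (auto simp: accepts_def)

text \<open>The length is the only variable and sits in counter 1. Hence \<open>b = 2\<close>, and
  the truth value ends up in the counter from which the compiled machine takes its verdict.\<close>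

lemma PF_decider:
  assumes "PD (\<lambda>w. w) [length] P"
  shows "\<exists>M k. turing_machine M \<and> (\<forall>w. 0 \<notin> set w \<longrightarrow>
    halted M (run M w ((length w + 2) ^ k)) \<and> (accepts M w \<longleftrightarrow> P w))"
proof -
  have p: "0 < (2::nat)" "length [1::nat] = length [length]" "set [1] \<subseteq> {0<..<2::nat}" by auto
  obtain c t where ct: "PB [length] t" "\<And>w s u. fits [length] [1] 2 w s \<Longrightarrow>
      exec w c (t w) s u (s(2 := int (of_bool (P w)))) u"
    using PF_obtain[OF assms[unfolded PD_def] p] by metis
  define S where "S w = (\<lambda>_::nat. 0::int)(1 := int (length w), 2 := int (of_bool (P w)))" for w :: "nat list"
  let ?T = "\<lambda>w. t w + (12 * length w + 4)"
  have "exec w (Seq len_com c) (?T w) (\<lambda>_. 0) [] (S w) []" if "0 \<notin> set w" for w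
    unfolding S_def
    by (rule exec_Seq[OF exec_len[OF that] ct(2)]) (auto simp: fits_def)
  moreover have "PB [length] ?T" by (intro PB_intros PB_var[of length] ct(1)) auto
  ultimately obtain M k where M: "turing_machine M" "\<And>w. 0 \<notin> set w \<Longrightarrow>
    halted M (run M w ((length w + 2) ^ k)) \<and>
      fst (run M w ((length w + 2) ^ k)) = (if S w 2 = 0 then reject_state M else accept_state M)"
    using com_tm_correct[of "Seq len_com c" ?T S "\<lambda>_. []"] by (auto simp: Let_def)
  have "reject_state M \<noteq> accept_state M" using M(1) by (simp add: turing_machine_def)
  then have "accepts M w \<longleftrightarrow> P w" if "0 \<notin> set w" for w
    using accepts_iff_halted[OF M(1), of w "(length w + 2) ^ k"] M(2)[OF that] by (simp add: S_def)
  then show ?thesis using M by blast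
qed

text \<open>The output is written bit by bit: counter 2 holds the number of bits still missing,
  counter 3 the position and counter 4 the bit at that position.\<close>

lemma PF_computable:
  assumes L: "PF (\<lambda>w. w) [length] L" and g: "PD fst (lift [length]) g"
  shows "poly_time_computable (\<lambda>x. map (\<lambda>i. g (bit_word x, i)) [0..<L (bit_word x)])"
proof -
  have p: "0 < (2::nat)" "length [1::nat] = length [length]" "set [1] \<subseteq> {0<..<2::nat}" by auto
  obtain c t where ct: "PB [length] t" "\<And>w s u. fits [length] [1] 2 w s \<Longrightarrow>
      exec w c (t w) s u (s(2 := int (L w))) u"
    using PF_obtain[OF L p] by metis
  have p: "0 < (4::nat)" "length [1::nat, 3] = length (lift [length])" "set [1, 3] \<subseteq> {0<..<4::nat}"
    by (auto simp: lift_def)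
  obtain d tg0 where d0: "PB (lift [length]) tg0" "\<And>z s u. fits (lift [length]) [1, 3] 4 z s \<Longrightarrow>
      exec (fst z) d (tg0 z) s u (s(4 := int (of_bool (g z)))) u"
    using PF_obtain[OF g[unfolded PD_def] p] by metis
  obtain tg where tg: "PB [length] tg" "\<And>w i. i \<le> L w \<Longrightarrow> tg0 (w, i) \<le> tg w"
    using PB_lift_bound[OF d0(1) PF_bound[OF L]] by blast
  let ?B = "Seq (Op (Dec 2)) (Seq d (Seq (Cond (Pos 4) (Op (Out True)) (Op (Out False)))
     (Seq (clr 4) (Op (Inc 3)))))"
  let ?C = "Seq len_com (Seq c (While (Pos 2) ?B))"
  let ?T = "\<lambda>w. (12 * length w + 3) + (t w + (L w * (tg w + 12 + 2) + 1) + 1) + 1"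
  define v where "v w = map (\<lambda>i. g (w, i)) [0..<L w]" for w
  define S where "S w i = (\<lambda>_::nat. 0::int)(1 := int (length w), 2 := int (L w - i), 3 := int i)" for w i
  have e: "exec w ?C (?T w) (\<lambda>_. 0) [] (S w (L w)) (v w)" if w: "0 \<notin> set w" for w
  proof -
    let ?s = "(\<lambda>_::nat. 0::int)(1 := int (length w))"
    have e1: "exec w c (t w) ?s [] (?s(2 := int (L w))) []"
      by (rule ct(2)) (auto simp: fits_def)
    have S0: "?s(2 := int (L w)) = S w 0" by (auto simp: S_def fun_eq_iff)
    have "exec w (While (Pos 2) ?B) (L w * (tg w + 12 + 2) + 1) (S w 0) [] (S w (L w)) (v w)"
    proof (rule exec_loop[where S = "S w" and U = "\<lambda>i. map (\<lambda>i. g (w, i)) [0..<i]" and v = "L w"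
          and t = "tg w + 12"])
      fix i assume i: "i < L w"
      let ?u = "map (\<lambda>i. g (w, i)) [0..<i]"
      have u: "map (\<lambda>i. g (w, i)) [0..<Suc i] = ?u @ [g (w, i)]" by simp
      let ?s1 = "(S w i)(2 := S w i 2 - 1)"
      let ?s2 = "?s1(4 := int (of_bool (g (w, i))))"
      have "fits (lift [length]) [1, 3] 4 (w, i) ?s1"
        by (auto simp: fits_def S_def lift_def less_Suc_eq)
      from d0(2)[OF this] have f1: "exec w d (tg0 (w, i)) ?s1 ?u ?s2 ?u" by simp
      have f2: "exec w (Cond (Pos 4) (Op (Out True)) (Op (Out False))) 2 ?s2 ?u ?s2 (?u @ [g (w, i)])"
        by (rule exec_Cond[where n = 1]) (auto intro!: exec_Op simp: rd_def)
      have f3: "exec w (clr 4) 4 ?s2 (?u @ [g (w, i)]) (?s2(4 := 0)) (?u @ [g (w, i)])"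
        by (rule exec_clr[where v = "of_bool (g (w, i))"]) auto
      have "tg0 (w, i) \<le> tg w" using tg(2) i by simp
      then show "exec w ?B (tg w + 12) (S w i) ?u (S w (Suc i)) (map (\<lambda>i. g (w, i)) [0..<Suc i])"
        unfolding u
        by - (rule exec_eq[OF exec_Seq[OF exec_Dec exec_Seq[OF f1 exec_Seq[OF f2
          exec_Seq[OF f3 exec_Inc order_refl] order_refl] order_refl] order_refl]],
          use i in \<open>auto simp: S_def fun_eq_iff\<close>)
    qed (auto simp: S_def v_def)
    then show ?thesis
      by (rule exec_Seq[OF exec_len[OF w] exec_Seq[OF e1[unfolded S0] _ order_refl] order_refl])
  qed
  have "PB [length] ?T" by (intro PB_intros PB_var[of length] ct(1) tg(1) PF_bound[OF L]) auto
  from com_tm_correct[OF e this] obtain M k where M: "turing_machine M" "\<And>w. 0 \<notin> set w \<Longrightarrow>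
    halted M (run M w ((length w + 2) ^ k)) \<and>
      fst (last (snd (run M w ((length w + 2) ^ k)))) = word_contents (bit_word (v w))"
    by (auto simp: Let_def)
  have b: "0 \<notin> set (bit_word x)" "length (bit_word x) = length x" for x
    by (auto simp: bit_word_def)
  have p: "poly ([:2, 1:] ^ k) n = (n + 2) ^ k" for n :: nat by (simp add: poly_power)
  show ?thesis
    unfolding poly_time_computable_def Let_def
    using M(1) M(2)[OF b(1), unfolded b(2)] p[symmetric] unfolding v_def by metis
qed

section \<open>Instances as bit strings\<close>

lemma bits_of_nat_0 [simp]: "bits_of_nat 0 = []"
  by (subst bits_of_nat.simps) simp

lemma bits_of_nat_pos: "k > 0 \<Longrightarrow> bits_of_nat k = odd k # bits_of_nat (k div 2)"
  by (subst bits_of_nat.simps) simp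

lemma bits_of_nat_horner:
  "bs = [] \<or> last bs \<Longrightarrow> bits_of_nat (horner_sum of_bool 2 bs) = bs"
proof (induction bs)
  case (Cons b bs)
  let ?h = "horner_sum of_bool (2::nat) bs"
  have IH: "bits_of_nat ?h = bs" using Cons by (auto split: if_splits)
  have "?h > 0 \<or> b" using Cons.prems IH by (cases "bs = []") (auto intro: ccontr)
  then show ?case using IH bits_of_nat_pos[of "of_bool b + 2 * ?h"] by (cases b) auto
qed simp

lemma bits_of_nat_nonempty: "k > 0 \<Longrightarrow> bits_of_nat k \<noteq> [] \<and> last (bits_of_nat k)"
proof (induction k rule: less_induct)
  case (less k)
  show ?case
  proof (cases "k div 2 = 0")
    case True
    then have "k = 1" using less.prems by auto
    then show ?thesis by (simp add: bits_of_nat_pos)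
  next
    case False
    then show ?thesis using less.IH[of "k div 2"] less.prems by (simp add: bits_of_nat_pos[of k])
  qed
qed

lemma horner_bits_of_nat: "horner_sum of_bool 2 (bits_of_nat k) = k"
  by (rule bits_of_nat_inj, rule bits_of_nat_horner) (use bits_of_nat_nonempty[of k] in \<open>cases "k = 0"; simp\<close>)

lemma concat_rows:
  "concat (map (\<lambda>i. map (f i) [0..<n]) [0..<m]) = map (\<lambda>p. f (p div n) (p mod n)) [0..<m * n]"
proof (induction m)
  case (Suc m)
  have "map (\<lambda>p. f (p div n) (p mod n)) [m * n..<m * n + n] = map (f m) [0..<n]"
    by (rule nth_equalityI) auto
  moreover have "[0..<Suc m * n] = [0..<m * n] @ [m * n..<m * n + n]"
    by (simp only: mult_Suc add.commute[of n] upt_add_eq_append[OF le0])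
  ultimately show ?case using Suc by simp
qed simp

lemma index_less_square: "i < m \<Longrightarrow> j < n \<Longrightarrow> i * n + j < m * (n::nat)"
  using mult_le_mono1[of "Suc i" m n] by simp

lemma nth_rows:
  "i < m \<Longrightarrow> j < n \<Longrightarrow> concat (map (\<lambda>i. map (f i) [0..<n]) [0..<m]) ! (i * n + j) = f i j"
  unfolding concat_rows using index_less_square[of i m j n] by simp

definition code_ok :: "bool list \<Rightarrow> nat \<Rightarrow> bool" where
  "code_ok x n \<longleftrightarrow> n + 1 + n * n < length x \<and> (\<forall>i<n. x ! i) \<and> \<not> x ! n \<and> x ! (length x - 1)"

lemma encode_instance_code:
  assumes "k > 0" "x = encode_instance n E k"
  shows "code_ok x n" "\<And>i j. i < n \<Longrightarrow> j < n \<Longrightarrow> x ! (n + 1 + i * n + j) \<longleftrightarrow> {i, j} \<in> E"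
    "horner_sum of_bool 2 (drop (n + 1 + n * n) x) = k"
proof -
  have b: "bits_of_nat k \<noteq> []" "last (bits_of_nat k)" using bits_of_nat_nonempty assms by auto
  have "last x" "x \<noteq> []" using assms(2) b by (auto simp: encode_instance_def)
  then show "code_ok x n"
    using b assms(2) last_conv_nth[OF \<open>x \<noteq> []\<close>] unfolding code_ok_def
    by (simp add: encode_instance_def length_adjacency_bits nth_append)
  show "x ! (n + 1 + i * n + j) \<longleftrightarrow> {i, j} \<in> E" if "i < n" "j < n" for i j
    using nth_rows[of i n j n "\<lambda>i j. {i, j} \<in> E"] index_less_square[OF that] that assms(2)
    by (auto simp: encode_instance_def nth_append length_adjacency_bits adjacency_bits_def[symmetric])
  show "horner_sum of_bool 2 (drop (n + 1 + n * n) x) = k"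
    using assms(2) by (simp add: encode_instance_def length_adjacency_bits horner_bits_of_nat)
qed

lemma code_encode_instance:
  assumes "code_ok x n" "\<And>i j. i < n \<Longrightarrow> j < n \<Longrightarrow> x ! (n + 1 + i * n + j) \<longleftrightarrow> {i, j} \<in> E"
  shows "x = encode_instance n E (horner_sum of_bool 2 (drop (n + 1 + n * n) x))"
    and "horner_sum of_bool (2::nat) (drop (n + 1 + n * n) x) > 0"
proof -
  let ?d = "drop (n + 1 + n * n) x"
  have l: "n + 1 + n * n < length x" using assms(1) by (simp add: code_ok_def)
  have "x \<noteq> []" using l by auto
  then have "last ?d" "?d \<noteq> []" using l assms(1) last_conv_nth[of x] by (auto simp: code_ok_def)
  then have h: "bits_of_nat (horner_sum of_bool 2 ?d) = ?d" using bits_of_nat_horner by blast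
  then show "horner_sum of_bool (2::nat) ?d > 0" using \<open>?d \<noteq> []\<close> by (intro gr0I) auto
  have 1: "take n x = replicate n True"
    by (rule nth_equalityI) (use assms(1) l in \<open>auto simp: code_ok_def\<close>)
  have 2: "take (n * n) (drop (n + 1) x) = adjacency_bits n E"
  proof (rule nth_equalityI)
    fix p assume "p < length (take (n * n) (drop (n + 1) x))"
    then have p: "p < n * n" by simp
    then have "0 < n" by (cases n) auto
    then have "p div n < n" "p mod n < n" using p by (auto simp: less_mult_imp_div_less)
    then have "x ! (n + 1 + p) \<longleftrightarrow> {p div n, p mod n} \<in> E"
      using assms(2)[of "p div n" "p mod n"] by (simp add: add.assoc)
    then show "take (n * n) (drop (n + 1) x) ! p = adjacency_bits n E ! p"
      using p l by (simp add: adjacency_bits_def concat_rows)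
  qed (use l in \<open>simp add: length_adjacency_bits\<close>)
  have "x = take n x @ drop n x" by simp
  also have "drop n x = x ! n # drop (n + 1) x" using l by (simp add: Cons_nth_drop_Suc)
  also have "drop (n + 1) x = take (n * n) (drop (n + 1) x) @ ?d"
    using append_take_drop_id[of "n * n" "drop (n + 1) x"] by (simp add: ac_simps)
  finally show "x = encode_instance n E (horner_sum of_bool 2 ?d)"
    using assms(1) unfolding encode_instance_def h 1 2 by (simp add: code_ok_def)
qed

section \<open>Membership in NP\<close>

lemma NP_I:
  assumes "PD (\<lambda>w. w) [length] P"
    and "\<And>x. x \<in> L \<longleftrightarrow> (\<exists>y. length y \<le> poly p (length x) \<and> P (pair_word x y))"
  shows "L \<in> NP"
proof -
  obtain M k where M: "turing_machine M" "\<And>w. 0 \<notin> set w \<Longrightarrow>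
      halted M (run M w ((length w + 2) ^ k)) \<and> (accepts M w \<longleftrightarrow> P w)"
    using PF_decider[OF assms(1)] by blast
  have w: "0 \<notin> set (pair_word x y)" for x y by (auto simp: pair_word_def bit_word_def)
  have p: "poly ([:2, 1:] ^ k) n = (n + 2) ^ k" for n :: nat by (simp add: poly_power)
  have "poly_time_verifier M"
    unfolding poly_time_verifier_def using M(1) M(2)[OF w] p by metis
  then show ?thesis unfolding NP_def using assms(2) M(2)[OF w] by blast
qed

lemma gdist_le_2_iff:
  assumes "u \<in> V" "v \<in> V" "u \<noteq> v"
  shows "gdist V E u v \<le> 2 \<longleftrightarrow> {u, v} \<in> E \<or> (\<exists>x\<in>V. {u, x} \<in> E \<and> {x, v} \<in> E)"
proof
  assume "gdist V E u v \<le> 2"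
  then have "gdist V E u v < 3" by (rule le_less_trans) simp
  then obtain p where p: "walk V E p" "hd p = u" "last p = v" "length p - 1 < 3"
    unfolding gdist_def INF_less_iff by (auto simp: numeral_eq_enat)
  then obtain a p' where "p = a # p'" by (cases p) (auto simp: walk_def)
  \<comment> \<open>A walk of length below 3 has at most three vertices; a single one is impossible
    because \<open>u\<close> and \<open>v\<close> differ.\<close>
  then consider "p = [a]" | b where "p = [a, b]" | b c where "p = [a, b, c]"
    using p(4) by (auto simp: less_Suc_eq numeral_3_eq_3 length_Suc_conv)
  then show "{u, v} \<in> E \<or> (\<exists>x\<in>V. {u, x} \<in> E \<and> {x, v} \<in> E)"
    using p assms by cases (auto simp: walk_def)
next
  have le: "gdist V E u v \<le> enat (length p - 1)" if "walk V E p" "hd p = u" "last p = v" for p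
    unfolding gdist_def by (rule INF_lower) (use that in simp)
  assume "{u, v} \<in> E \<or> (\<exists>x\<in>V. {u, x} \<in> E \<and> {x, v} \<in> E)"
  then show "gdist V E u v \<le> 2"
  proof
    assume "{u, v} \<in> E"
    then have "gdist V E u v \<le> enat 1" using le[of "[u, v]"] assms by (simp add: walk_def)
    also have "\<dots> \<le> 2" by (simp add: numeral_eq_enat)
    finally show ?thesis .
  next
    assume "\<exists>x\<in>V. {u, x} \<in> E \<and> {x, v} \<in> E"
    then obtain x where "x \<in> V" "{u, x} \<in> E" "{x, v} \<in> E" by blast
    then have "gdist V E u v \<le> enat 2" using le[of "[u, x, v]"] assms
      by (simp add: walk_def eval_nat_numeral)
    also have "\<dots> \<le> 2" by (simp add: numeral_eq_enat)
    finally show ?thesis .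
  qed
qed

text \<open>A certificate consists of the clique \<open>c\<close> of a split partition and of the adjacency matrix
  \<open>m\<close> of the pairing, which also determines the dominating set.\<close>

definition cert :: "nat \<Rightarrow> (nat \<Rightarrow> nat \<Rightarrow> bool) \<Rightarrow> (nat \<Rightarrow> bool) \<Rightarrow> (nat \<Rightarrow> nat \<Rightarrow> bool) \<Rightarrow> nat \<Rightarrow> bool" where
  "cert n e c m k \<longleftrightarrow>
     (\<forall>i<n. \<not> e i i \<and> (\<exists>j<n. e i j) \<and> ((\<exists>j<n. m i j) \<or> (\<exists>j<n. e j i \<and> (\<exists>u<n. m j u))) \<and>
       (\<forall>j<n. (e i j \<longrightarrow> e j i) \<and> (c i \<and> c j \<and> i \<noteq> j \<longrightarrow> e i j) \<and> (\<not> c i \<and> \<not> c j \<longrightarrow> \<not> e i j) \<and>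
         (m i j \<longrightarrow> m j i \<and> i \<noteq> j \<and> (\<forall>u<n. m i u \<longrightarrow> u = j) \<and> (e i j \<or> (\<exists>u<n. e i u \<and> e u j))))) \<and>
     (\<Sum>i<n. of_bool (\<exists>j<n. m i j)) \<le> k"

lemma cert_count:
  fixes n :: nat
  shows "(\<Sum>i<n. of_bool (\<exists>j<n. m i j) :: nat) = card {i. i < n \<and> (\<exists>j<n. m i j)}"
proof -
  have "{..<n} \<inter> {i. \<exists>j<n. m i j} = {i. i < n \<and> (\<exists>j<n. m i j)}" by auto
  moreover have "(\<Sum>i<n. of_bool (Q i) :: nat) = card ({..<n} \<inter> {i. Q i})" for Q
    by simp
  ultimately show ?thesis by presburger
qed

lemma cert_complete:
  assumes E: "simple_graph {..<n} E" "C \<union> I = {..<n}" "C \<inter> I = {}" "clique E C" "independent E I"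
    and iso: "no_isolated_vertices {..<n} E" and D: "dominating_set {..<n} E D" "card D \<le> k"
    and P: "partition_on D P" "\<And>B. B \<in> P \<Longrightarrow> \<exists>u v. u \<noteq> v \<and> B = {u, v} \<and> gdist {..<n} E u v \<le> 2"
    and e: "\<And>i j. i < n \<Longrightarrow> j < n \<Longrightarrow> e i j \<longleftrightarrow> {i, j} \<in> E"
    and c: "\<And>i. i < n \<Longrightarrow> c i \<longleftrightarrow> i \<in> C"
    and m: "\<And>i j. i < n \<Longrightarrow> j < n \<Longrightarrow> m i j \<longleftrightarrow> {i, j} \<in> P"
  shows "cert n e c m k"
proof -
  have DV: "D \<subseteq> {..<n}" using D by (simp add: dominating_set_def)
  have sing: "{i} \<notin> P" for i using P(2)[of "{i}"] by auto
  have PD: "i \<in> D \<and> j \<in> D \<and> i \<noteq> j" if "{i, j} \<in> P" for i j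
    using that P(1) sing by (auto simp: partition_on_def)
  have ex: "(\<exists>j<n. m i j) \<longleftrightarrow> i \<in> D" if "i < n" for i
  proof
    assume "i \<in> D"
    then obtain B where B: "B \<in> P" "i \<in> B" using P(1) by (auto simp: partition_on_def)
    then obtain u v where "u \<noteq> v" "B = {u, v}" using P(2) by blast
    then obtain j where "B = {i, j}" using B by auto
    then show "\<exists>j<n. m i j" using PD B m[OF that] DV by (metis lessThan_iff subsetD)
  next
    assume "\<exists>j<n. m i j"
    then show "i \<in> D" using m[OF that] PD by blast
  qed
  have dist: "e i j \<or> (\<exists>u<n. e i u \<and> e u j)" if "i < n" "j < n" "{i, j} \<in> P" for i j
  proof -
    note ij = that
    obtain u v where uv: "u \<noteq> v" "{i, j} = {u, v}" "gdist {..<n} E u v \<le> 2" using P(2)[OF ij(3)] by blast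
    then have "{u, v} \<in> E \<or> (\<exists>x\<in>{..<n}. {u, x} \<in> E \<and> {x, v} \<in> E)"
      using gdist_le_2_iff[of u "{..<n}" v E] that by (auto simp: doubleton_eq_iff)
    moreover have "u < n" "v < n" "u = i \<and> v = j \<or> u = j \<and> v = i"
      using uv(2) ij by (auto simp: doubleton_eq_iff)
    ultimately show ?thesis using e ij(1,2) by (metis insert_commute lessThan_iff)
  qed
  have uniq: "j = u" if "{i, j} \<in> P" "{i, u} \<in> P" for i j u
  proof -
    have "disjoint P" "{i, j} \<inter> {i, u} \<noteq> {}" using P(1) by (auto simp: partition_on_def)
    then have "{i, j} = {i, u}" using that disjointD by metis
    then show ?thesis by (auto simp: doubleton_eq_iff)
  qed
  have dom: "i \<in> D \<or> (\<exists>j<n. e j i \<and> j \<in> D)" if i: "i < n" for i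
  proof (cases "i \<in> D")
    case False
    then obtain u where "u \<in> D" "{u, i} \<in> E" using D(1) i unfolding dominating_set_def by blast
    then show ?thesis using e[of u i] DV i by blast
  qed simp
  show ?thesis
    unfolding cert_def
  proof (intro conjI allI impI)
    fix i assume i: "i < n"
    show "\<not> e i i" using e[OF i i] E(1) by (auto simp: simple_graph_def)
    show "\<exists>j<n. e i j" using iso i e unfolding no_isolated_vertices_def by (metis insert_commute lessThan_iff)
    show "(\<exists>j<n. m i j) \<or> (\<exists>j<n. e j i \<and> (\<exists>u<n. m j u))" using dom[OF i] ex i by blast
    fix j assume j: "j < n"
    { assume "e i j" then show "e j i" using e i j by (metis insert_commute) }
    { assume "c i \<and> c j \<and> i \<noteq> j" then show "e i j" using e c i j E(4) by (simp add: clique_def) }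
    { assume "\<not> c i \<and> \<not> c j"
      then have "i \<in> I" "j \<in> I" using c i j E(2) by blast+
      then show "\<not> e i j" using e i j E(5) by (simp add: independent_def) }
    { assume mij: "m i j"
      then have "{i, j} \<in> P" using m i j by simp
      then show "m j i" "i \<noteq> j" "e i j \<or> (\<exists>u<n. e i u \<and> e u j)"
        using m i j PD dist by (metis insert_commute)+
      fix u assume "u < n" "m i u"
      then show "u = j" using m i \<open>{i, j} \<in> P\<close> uniq by blast }
  next
    have "{i. i < n \<and> (\<exists>j<n. m i j)} = D" using ex DV by auto
    then show "(\<Sum>i<n. of_bool (\<exists>j<n. m i j)) \<le> k" using D(2) unfolding cert_count by simp
  qed
qed

lemma cert_sound:
  assumes ct: "cert n e c m k" and E: "E = {{i, j} | i j. i < n \<and> j < n \<and> e i j}"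
  shows "split_graph {..<n} E" "no_isolated_vertices {..<n} E"
    "\<exists>D. semipaired_dominating_set {..<n} E D \<and> card D \<le> k"
    "\<And>i j. i < n \<Longrightarrow> j < n \<Longrightarrow> {i, j} \<in> E \<longleftrightarrow> e i j"
proof -
  have 1: "\<not> e i i" "\<exists>j<n. e i j" "(\<exists>j<n. m i j) \<or> (\<exists>j<n. e j i \<and> (\<exists>u<n. m j u))" if "i < n" for i
    using ct that unfolding cert_def by blast+
  have all: "\<forall>i<n. \<forall>j<n. (e i j \<longrightarrow> e j i) \<and> (c i \<and> c j \<and> i \<noteq> j \<longrightarrow> e i j) \<and>
      (\<not> c i \<and> \<not> c j \<longrightarrow> \<not> e i j) \<and>
      (m i j \<longrightarrow> m j i \<and> i \<noteq> j \<and> (\<forall>u<n. m i u \<longrightarrow> u = j) \<and> (e i j \<or> (\<exists>u<n. e i u \<and> e u j)))"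
    using ct unfolding cert_def by blast
  have 2: "e i j \<Longrightarrow> e j i" "c i \<Longrightarrow> c j \<Longrightarrow> i \<noteq> j \<Longrightarrow> e i j" "\<not> c i \<Longrightarrow> \<not> c j \<Longrightarrow> \<not> e i j"
    "m i j \<Longrightarrow> m j i" "m i j \<Longrightarrow> i \<noteq> j" "m i j \<Longrightarrow> e i j \<or> (\<exists>u<n. e i u \<and> e u j)"
    "\<And>u. u < n \<Longrightarrow> m i j \<Longrightarrow> m i u \<Longrightarrow> u = j" if "i < n" "j < n" for i j
    using all[THEN spec, THEN mp, OF that(1), THEN spec, THEN mp, OF that(2)] by blast+
  show eE: "{i, j} \<in> E \<longleftrightarrow> e i j" if "i < n" "j < n" for i j
    using that 2(1) unfolding E by (auto simp: doubleton_eq_iff)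
  have "simple_graph {..<n} E"
    using 1(1) unfolding simple_graph_def E by (fastforce simp: card_2_iff)
  moreover have "clique E {i. i < n \<and> c i}" "independent E {i. i < n \<and> \<not> c i}"
    using 2(2,3) eE by (auto simp: clique_def independent_def)
  moreover have "{i. i < n \<and> c i} \<union> {i. i < n \<and> \<not> c i} = {..<n}"
    "{i. i < n \<and> c i} \<inter> {i. i < n \<and> \<not> c i} = {}" by auto
  ultimately show "split_graph {..<n} E" unfolding split_graph_def by blast
  show "no_isolated_vertices {..<n} E"
    using 1(2) eE 2(1) unfolding no_isolated_vertices_def by (metis insert_commute lessThan_iff)
  define D where "D = {i. i < n \<and> (\<exists>j<n. m i j)}"
  define P where "P = {{i, j} | i j. i < n \<and> j < n \<and> m i j}"
  have "dominating_set {..<n} E D"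
    unfolding dominating_set_def
  proof (intro conjI ballI)
    fix v assume v: "v \<in> {..<n} - D"
    then obtain j where "j < n" "e j v" "\<exists>u<n. m j u" using 1(3)[of v] by (auto simp: D_def)
    then show "\<exists>u\<in>D. {u, v} \<in> E" using eE v by (auto simp: D_def)
  qed (auto simp: D_def)
  \<comment> \<open>Partners are symmetric and unique, so two pairs that share a vertex
    coincide.\<close>
  moreover have "partition_on D P"
  proof (rule partition_onI)
    show "\<Union> P = D" using 2(4) unfolding P_def D_def by blast
    fix B B' assume "B \<in> P" "B' \<in> P" "B \<noteq> B'"
    then obtain i j i' j' where b: "B = {i, j}" "i < n" "j < n" "m i j" "B' = {i', j'}" "i' < n" "j' < n" "m i' j'"
      unfolding P_def by blast
    have "m j i" "m j' i'" using 2(4) b by auto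
    then have "B = B'" if "i = i' \<or> i = j' \<or> j = i' \<or> j = j'"
      using that b 2(7)[of i j] 2(7)[of j i] 2(7)[of i' j'] by blast
    then show "disjnt B B'" using b \<open>B \<noteq> B'\<close> by (auto simp: disjnt_def)
  qed (auto simp: P_def)
  moreover have "\<exists>u v. u \<noteq> v \<and> B = {u, v} \<and> gdist {..<n} E u v \<le> 2" if B: "B \<in> P" for B
  proof -
    obtain i j where b: "B = {i, j}" "i < n" "j < n" "m i j" using B unfolding P_def by blast
    then have "gdist {..<n} E i j \<le> 2"
      using gdist_le_2_iff[of i "{..<n}" j E] 2(5,6)[of i j] eE by auto
    then show ?thesis using b 2(5) by blast
  qed
  moreover have "card D \<le> k" using ct unfolding cert_def cert_count D_def by blast
  ultimately show "\<exists>D. semipaired_dominating_set {..<n} E D \<and> card D \<le> k"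
    unfolding semipaired_dominating_set_def by blast
qed

text \<open>\<open>k\<close> may be exponential in the input length and thus too large for a unary
  value. Horner's rule runs from the leading bit, which is the last one before the separator, and
  caps every intermediate value at \<open>n\<close>.\<close>

definition bounded_value :: "nat list \<Rightarrow> nat \<Rightarrow> nat \<Rightarrow> nat" where
  "bounded_value w n l =
     rec_nat 0 (\<lambda>i acc. min n (2 * acc + of_bool (sym_at w (l - Suc i) = 2))) (l - (n + 1 + n * n))"

text \<open>A bounded search finds the separator \<open>l\<close> and the number of vertices
  \<open>n\<close>. Behind the separator the certificate lists the \<open>n * n\<close> bits of the
  pairing row by row, then the \<open>n\<close> bits of the clique.\<close>

definition sds_verifier :: "nat list \<Rightarrow> bool" where
  "sds_verifier w \<longleftrightarrow> (\<exists>l<length w. \<exists>n<length w.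
     sym_at w l = 3 \<and> n + 1 + n * n < l \<and> (\<forall>i<n. sym_at w i = 2) \<and> sym_at w n = 1 \<and> sym_at w (l - 1) = 2 \<and>
     cert n (\<lambda>i j. sym_at w (n + 1 + i * n + j) = 2) (\<lambda>i. sym_at w (l + 1 + (n * n + i)) = 2)
       (\<lambda>i j. sym_at w (l + 1 + (i * n + j)) = 2) (bounded_value w n l))"

lemma PD_sds_verifier: "PD (\<lambda>w. w) [length] sds_verifier"
proof -
  have bv: "PF W vs (\<lambda>e. bounded_value (W e) (n e) (l e))" if "PF W vs n" "PF W vs l" for W vs n l
    unfolding bounded_value_def
  proof (rule PF_rec)
    show "PB vs n" using that PF_bound by blast
    show "rec_nat 0 (\<lambda>i acc. min (n e) (2 * acc + of_bool (sym_at (W e) (l e - Suc i) = 2))) i \<le> n e" for e i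
      by (cases i) auto
  qed (intro PF_intros that)+
  have len: "PF W [length] length" for W by (rule PF_var) simp
  show ?thesis
    unfolding sds_verifier_def[abs_def] cert_def
    by (intro PF_intros bv len)
qed

lemma sym_at_pair_word:
  "p < length x \<Longrightarrow> sym_at (pair_word x y) p = (if x ! p then 2 else 1)"
  "sym_at (pair_word x y) (length x) = 3"
  "q < length y \<Longrightarrow> sym_at (pair_word x y) (length x + 1 + q) = (if y ! q then 2 else 1)"
  "p \<noteq> length x \<Longrightarrow> sym_at (pair_word x y) p \<noteq> 3"
proof -
  have *: "sym_at w p = (if p < length w then if w ! p \<le> 3 then w ! p else 0 else 0)" for w p
    by (simp add: sym_at_def word_contents_def Let_def)
  show "p < length x \<Longrightarrow> sym_at (pair_word x y) p = (if x ! p then 2 else 1)"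
    "sym_at (pair_word x y) (length x) = 3"
    "q < length y \<Longrightarrow> sym_at (pair_word x y) (length x + 1 + q) = (if y ! q then 2 else 1)"
    "p \<noteq> length x \<Longrightarrow> sym_at (pair_word x y) p \<noteq> 3"
    by (auto simp: * pair_word_def bit_word_def nth_append nth_Cons')
qed

lemma bounded_value_eq:
  assumes "n + 1 + n * n \<le> length x"
  shows "bounded_value (pair_word x y) n (length x) =
    min n (horner_sum of_bool 2 (drop (n + 1 + n * n) x))"
proof -
  let ?h = "\<lambda>i acc. min n (2 * acc + of_bool (sym_at (pair_word x y) (length x - Suc i) = 2))"
  have "rec_nat 0 ?h i = min n (horner_sum of_bool 2 (drop (length x - i) x))" if "i \<le> length x" for i
    using that
  proof (induction i)
    case (Suc i)
    have "drop (length x - Suc i) x = x ! (length x - Suc i) # drop (length x - i) x"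
      using Suc.prems by (simp add: Cons_nth_drop_Suc[symmetric] Suc_diff_Suc)
    \<comment> \<open>Capping before doubling loses nothing: a value that has reached
      \<open>n\<close> never falls below it again.\<close>
    moreover have "min n (2 * min n a + b) = min n (b + 2 * a)" for a b by auto
    ultimately show ?case using Suc by (simp add: sym_at_pair_word)
  qed simp
  from this[of "length x - (n + 1 + n * n)"] show ?thesis
    using assms by (simp add: bounded_value_def)
qed

text \<open>At most \<open>n\<close> vertices have a partner, so a size bound above \<open>n\<close>
  is no restriction.\<close>

lemma cert_min: "cert n e c m (min n k) \<longleftrightarrow> cert n e c m k"
proof -
  have "(\<Sum>i<n. of_bool (\<exists>j<n. m i j)) \<le> n"
    unfolding cert_count using card_mono[of "{..<n}" "{i. i < n \<and> (\<exists>j<n. m i j)}"] by auto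
  then show ?thesis by (simp add: cert_def)
qed

lemma semipaired_domination_split_in_NP: "semipaired_domination_split \<in> NP"
\<comment> \<open>The polynomial \<open>X + X^2\<close> bounds the \<open>n * n + n\<close>
  certificate bits, as \<open>n\<close> is below the length of \<open>x\<close>.\<close>
proof (rule NP_I[where p = "[:0, 1, 1:]", OF PD_sds_verifier])
  fix x
  show "x \<in> semipaired_domination_split \<longleftrightarrow>
    (\<exists>y. length y \<le> poly [:0, 1, 1:] (length x) \<and> sds_verifier (pair_word x y))"
  proof
    assume "x \<in> semipaired_domination_split"
    then obtain n E k D where x: "x = encode_instance n E k" and E: "split_graph {..<n} E"
      "no_isolated_vertices {..<n} E" "k > 0" "semipaired_dominating_set {..<n} E D" "card D \<le> k"
      unfolding semipaired_domination_split_def by blast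
    obtain C I where CI: "simple_graph {..<n} E" "C \<union> I = {..<n}" "C \<inter> I = {}" "clique E C" "independent E I"
      using E(1) unfolding split_graph_def by blast
    obtain P where P: "dominating_set {..<n} E D" "partition_on D P"
      "\<And>B. B \<in> P \<Longrightarrow> \<exists>u v. u \<noteq> v \<and> B = {u, v} \<and> gdist {..<n} E u v \<le> 2"
      using E(4) unfolding semipaired_dominating_set_def by blast
    define y where "y = concat (map (\<lambda>i. map (\<lambda>j. {i, j} \<in> P) [0..<n]) [0..<n]) @ map (\<lambda>i. i \<in> C) [0..<n]"
    let ?l = "length (concat (map (\<lambda>i. map (\<lambda>j. {i, j} \<in> P) [0..<n]) [0..<n]))"
    have l: "?l = n * n" by (simp add: concat_rows)
    have y1: "y ! (i * n + j) \<longleftrightarrow> {i, j} \<in> P" "i * n + j < length y" if "i < n" "j < n" for i j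
      using nth_rows[OF that, of "\<lambda>i j. {i, j} \<in> P"] index_less_square[OF that] l
      by (auto simp: y_def nth_append)
    have y2: "y ! (n * n + i) \<longleftrightarrow> i \<in> C" "n * n + i < length y" if "i < n" for i
      using that l by (auto simp: y_def nth_append)
    note code = encode_instance_code[OF E(3) x]
    have xl: "n + 1 + n * n < length x" using code(1) by (simp add: code_ok_def)
    have x1: "n + 1 + i * n + j < length x" if "i < n" "j < n" for i j
      using index_less_square[OF that] xl by simp
    have "cert n (\<lambda>i j. sym_at (pair_word x y) (n + 1 + i * n + j) = 2)
        (\<lambda>i. sym_at (pair_word x y) (length x + 1 + (n * n + i)) = 2)
        (\<lambda>i j. sym_at (pair_word x y) (length x + 1 + (i * n + j)) = 2) k"
      by (rule cert_complete[OF CI E(2) P(1) E(5) P(2,3)])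
        (simp_all add: sym_at_pair_word(1)[OF x1] sym_at_pair_word(3)[OF y1(2)]
          sym_at_pair_word(3)[OF y2(2)] y1(1) y2(1) code(2) del: add_Suc_right add_Suc One_nat_def)
    then have "sds_verifier (pair_word x y)"
      unfolding sds_verifier_def
    proof (intro exI conjI)
      show "length x < length (pair_word x y)" "n < length (pair_word x y)"
        using xl by (auto simp: pair_word_def bit_word_def)
      show "cert n (\<lambda>i j. sym_at (pair_word x y) (n + 1 + i * n + j) = 2)
          (\<lambda>i. sym_at (pair_word x y) (length x + 1 + (n * n + i)) = 2)
          (\<lambda>i j. sym_at (pair_word x y) (length x + 1 + (i * n + j)) = 2)
          (bounded_value (pair_word x y) n (length x))"
        using \<open>cert _ _ _ _ _\<close> xl by (simp only: bounded_value_eq[OF less_imp_le] cert_min code(3))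
    qed (use code(1) xl in \<open>auto simp: code_ok_def sym_at_pair_word\<close>)
    moreover have "length y = n * n + n" using l by (simp add: y_def)
    then have "length y \<le> poly [:0, 1, 1:] (length x)" using xl mult_le_mono[of n "length x" n "length x"] by simp
    ultimately show "\<exists>y. length y \<le> poly [:0, 1, 1:] (length x) \<and> sds_verifier (pair_word x y)" by blast
  next
    assume "\<exists>y. length y \<le> poly [:0, 1, 1:] (length x) \<and> sds_verifier (pair_word x y)"
    then obtain y l n where v: "sym_at (pair_word x y) l = 3" "n + 1 + n * n < l"
      "\<forall>i<n. sym_at (pair_word x y) i = 2" "sym_at (pair_word x y) n = 1" "sym_at (pair_word x y) (l - 1) = 2"
      "cert n (\<lambda>i j. sym_at (pair_word x y) (n + 1 + i * n + j) = 2)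
        (\<lambda>i. sym_at (pair_word x y) (l + 1 + (n * n + i)) = 2)
        (\<lambda>i j. sym_at (pair_word x y) (l + 1 + (i * n + j)) = 2) (bounded_value (pair_word x y) n l)"
      unfolding sds_verifier_def by blast
    have l: "l = length x" using v(1) sym_at_pair_word(4) by blast
    let ?e = "\<lambda>i j. sym_at (pair_word x y) (n + 1 + i * n + j) = 2"
    let ?k = "horner_sum of_bool (2::nat) (drop (n + 1 + n * n) x)"
    define E where "E = {{i, j} | i j. i < n \<and> j < n \<and> ?e i j}"
    have ct: "cert n ?e (\<lambda>i. sym_at (pair_word x y) (l + 1 + (n * n + i)) = 2)
        (\<lambda>i j. sym_at (pair_word x y) (l + 1 + (i * n + j)) = 2) ?k"
      using v(6) v(2) unfolding l by (simp add: bounded_value_eq cert_min)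
    note s = cert_sound[OF ct E_def]
    have "code_ok x n"
      unfolding code_ok_def
    proof (intro conjI allI impI)
      have sym: "sym_at (pair_word x y) p = 2 \<longleftrightarrow> x ! p" if "p < length x" for p
        using sym_at_pair_word(1)[OF that, of y] by simp
      show "n + 1 + n * n < length x" using v(2) l by simp
      show "x ! i" if "i < n" for i
        using v(2,3) that sym[of i] l by simp
      show "\<not> x ! n" using v(4) sym[of n] v(2) l by (metis add_lessD1 numeral_eq_one_iff semiring_norm(85))
      show "x ! (length x - 1)" 
        using v(5) sym[of "length x - 1"] v(2) l by (metis diff_less less_nat_zero_code less_one neq0_conv)
    qed
    moreover have "x ! (n + 1 + i * n + j) \<longleftrightarrow> {i, j} \<in> E" if "i < n" "j < n" for i j
      using s(4)[OF that] index_less_square[OF that] v(2)[unfolded l] by (simp add: sym_at_pair_word)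
    ultimately have "x = encode_instance n E ?k \<and> ?k > 0" using code_encode_instance[of x n E] by blast
    then show "x \<in> semipaired_domination_split"
      unfolding semipaired_domination_split_def using s(1-3) by blast
  qed
qed

section \<open>Reducing satisfiability to semipaired domination\<close>

text \<open>A formula with variables \<open>v < m\<close> and clauses \<open>c < r\<close> is given by the predicate \<open>L c v b\<close>:
  setting variable \<open>v\<close> to \<open>b\<close> satisfies clause \<open>c\<close>. The vertices \<open>2 * v + of_bool b\<close> for the literals
  form a clique; the independent set consists of the vertices \<open>2 * m + v\<close> for the variables, adjacent
  to their two literals, and the vertices \<open>3 * m + c\<close> for the clauses.\<close>

definition sat_adj :: "nat \<Rightarrow> (nat \<Rightarrow> nat \<Rightarrow> bool \<Rightarrow> bool) \<Rightarrow> nat \<Rightarrow> nat \<Rightarrow> bool" where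
  "sat_adj m L i j \<longleftrightarrow> i < 2 * m \<and>
     (if j < 2 * m then i \<noteq> j else if j < 3 * m then i div 2 = j - 2 * m
      else (odd i \<and> L (j - 3 * m) (i div 2) True) \<or> (even i \<and> L (j - 3 * m) (i div 2) False))"

definition sat_graph :: "nat \<Rightarrow> nat \<Rightarrow> (nat \<Rightarrow> nat \<Rightarrow> bool \<Rightarrow> bool) \<Rightarrow> nat set set" where
  "sat_graph m r L = {{i, j} | i j. i < 3 * m + r \<and> j < 3 * m + r \<and> sat_adj m L i j}"

lemma sat_graph_iff:
  assumes "i < 3 * m + r" "j < 3 * m + r"
  shows "{i, j} \<in> sat_graph m r L \<longleftrightarrow> sat_adj m L i j \<or> sat_adj m L j i"
proof
  assume "{i, j} \<in> sat_graph m r L"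
  then show "sat_adj m L i j \<or> sat_adj m L j i"
    unfolding sat_graph_def by (auto simp: doubleton_eq_iff)
next
  assume "sat_adj m L i j \<or> sat_adj m L j i"
  moreover have "{i, j} = {j, i}" by auto
  ultimately show "{i, j} \<in> sat_graph m r L" using assms unfolding sat_graph_def by blast
qed

lemma split_sat_graph: "split_graph {..<3 * m + r} (sat_graph m r L)"
proof -
  let ?E = "sat_graph m r L"
  have irr: "\<not> sat_adj m L i i" for i by (simp add: sat_adj_def)
  have "simple_graph {..<3 * m + r} ?E"
    unfolding simple_graph_def
  proof (intro conjI ballI)
    fix e assume "e \<in> ?E"
    then obtain i j where "e = {i, j}" "i < 3 * m + r" "j < 3 * m + r" "sat_adj m L i j"
      unfolding sat_graph_def by blast
    moreover from this have "i \<noteq> j" using irr by blast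
    ultimately show "e \<subseteq> {..<3 * m + r}" "card e = 2" by auto
  qed simp
  moreover have "clique ?E {..<2 * m}"
    unfolding clique_def using sat_graph_iff[of _ m r _ L] by (simp add: sat_adj_def)
  moreover have "independent ?E {2 * m..<3 * m + r}"
    unfolding independent_def using sat_graph_iff[of _ m r _ L] by (simp add: sat_adj_def)
  moreover have "{..<2 * m} \<union> {2 * m..<3 * m + r} = {..<3 * m + r}"
    "{..<2 * m} \<inter> {2 * m..<3 * m + r} = {}" by auto
  ultimately show ?thesis unfolding split_graph_def by blast
qed

lemma sat_graph_complete:
  assumes m: "even m" "m > 0" and a: "\<And>c. c < r \<Longrightarrow> \<exists>v<m. L c v (a v)"
  shows "no_isolated_vertices {..<3 * m + r} (sat_graph m r L)"
    "\<exists>D. semipaired_dominating_set {..<3 * m + r} (sat_graph m r L) D \<and> card D \<le> m"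
proof -
  let ?E = "sat_graph m r L" and ?V = "{..<3 * m + r}"
  define l where "l v = 2 * v + of_bool (a v)" for v :: nat
  have l: "l v < 2 * m" "l v div 2 = v" "odd (l v) = a v" if "v < m" for v
    using that by (auto simp: l_def)
  have inj: "l v = l u \<longleftrightarrow> v = u" for u v
  proof
    assume "l v = l u"
    then have "l v div 2 = l u div 2" by simp
    then show "v = u" by (simp add: l_def)
  qed simp
  define D where "D = l ` {..<m}"
  have cl: "{i, j} \<in> ?E" if "i < 2 * m" "j < 2 * m" "i \<noteq> j" for i j
    using that sat_graph_iff[of i m r j L] by (simp add: sat_adj_def)
  have nb: "\<exists>u\<in>D. {u, j} \<in> ?E" if j: "2 * m \<le> j" "j < 3 * m + r" for j
  proof -
    obtain v where v: "v < m" "sat_adj m L (l v) j"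
    proof (cases "j < 3 * m")
      case True
      then show thesis using j l[of "j - 2 * m"] by (intro that[of "j - 2 * m"]) (auto simp: sat_adj_def)
    next
      case False
      then have "j - 3 * m < r" using j by linarith
      then obtain v where "v < m" "L (j - 3 * m) v (a v)" using a by blast
      then show thesis using l[of v] False j by (intro that[of v]) (auto simp: sat_adj_def)
    qed
    then show ?thesis using l(1)[of v] j sat_graph_iff[of "l v" m r j L] by (auto simp: D_def)
  qed
  have DV: "D \<subseteq> {..<2 * m}" using l by (auto simp: D_def)
  have dom: "\<exists>u\<in>D. {u, j} \<in> ?E" if "j < 3 * m + r" "j \<notin> D" for j
  proof (cases "j < 2 * m")
    case True
    have "l 0 \<in> D" using m by (auto simp: D_def)
    then show ?thesis using cl[of "l 0" j] True that l(1)[of 0] m by auto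
  qed (use nb that in simp)
  show "no_isolated_vertices ?V ?E"
    unfolding no_isolated_vertices_def
  proof
    fix v assume v: "v \<in> ?V"
    show "\<exists>u\<in>?V. {u, v} \<in> ?E"
    proof (cases "v < 2 * m")
      case True
      have "m \<ge> 2" using m by auto
      then have "{if v = 0 then 1 else 0, v} \<in> ?E" using cl[of "if v = 0 then 1 else 0" v] True by simp
      then show ?thesis using \<open>m \<ge> 2\<close> by (intro bexI[of _ "if v = 0 then 1 else 0"]) auto
    next
      case False
      then obtain u where "u \<in> D" "{u, v} \<in> ?E" using nb[of v] v by auto
      then show ?thesis using DV by (intro bexI[of _ u]) auto
    qed
  qed
  have "dominating_set ?V ?E D" unfolding dominating_set_def using DV dom by auto
  \<comment> \<open>The literals chosen for variables \<open>2 * u\<close> and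
    \<open>2 * u + 1\<close> are partners; an even \<open>m\<close> leaves none over.\<close>
  moreover have "partition_on D ((\<lambda>u. {l (2 * u), l (2 * u + 1)}) ` {..<m div 2})"
  proof (rule partition_onI)
    show "\<Union> ((\<lambda>u. {l (2 * u), l (2 * u + 1)}) ` {..<m div 2}) = D"
    proof
      show "\<Union> ((\<lambda>u. {l (2 * u), l (2 * u + 1)}) ` {..<m div 2}) \<subseteq> D"
        using m by (auto simp: D_def)
      show "D \<subseteq> \<Union> ((\<lambda>u. {l (2 * u), l (2 * u + 1)}) ` {..<m div 2})"
      proof
        fix x assume "x \<in> D"
        then obtain v where v: "v < m" "x = l v" by (auto simp: D_def)
        then have "v div 2 < m div 2" "v = 2 * (v div 2) \<or> v = 2 * (v div 2) + 1" using m by auto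
        then show "x \<in> \<Union> ((\<lambda>u. {l (2 * u), l (2 * u + 1)}) ` {..<m div 2})" using v(2)
          by (intro UN_I[of "v div 2"]) auto
      qed
    qed
  next
    fix B B' assume "B \<in> (\<lambda>u. {l (2 * u), l (2 * u + 1)}) ` {..<m div 2}"
      "B' \<in> (\<lambda>u. {l (2 * u), l (2 * u + 1)}) ` {..<m div 2}" "B \<noteq> B'"
    then obtain u u' where "B = {l (2 * u), l (2 * u + 1)}" "B' = {l (2 * u'), l (2 * u' + 1)}" "u \<noteq> u'"
      by auto
    moreover have "2 * u \<noteq> Suc (2 * u')" "Suc (2 * u) \<noteq> 2 * u'" by presburger+
    ultimately show "disjnt B B'" by (auto simp: disjnt_def inj)
  qed auto
  moreover have "\<exists>u v. u \<noteq> v \<and> B = {u, v} \<and> gdist ?V ?E u v \<le> 2"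
    if B: "B \<in> (\<lambda>u. {l (2 * u), l (2 * u + 1)}) ` {..<m div 2}" for B
  proof -
    obtain u where u: "u < m div 2" "B = {l (2 * u), l (2 * u + 1)}" using B by auto
    then have k: "2 * u < m" "2 * u + 1 < m" by auto
    have ne: "l (2 * u) \<noteq> l (2 * u + 1)" by (simp add: inj)
    have "gdist ?V ?E (l (2 * u)) (l (2 * u + 1)) \<le> 2"
      by (subst gdist_le_2_iff) (use l(1)[OF k(1)] l(1)[OF k(2)] ne cl in auto)
    then show ?thesis using u ne by blast
  qed
  moreover have "card D \<le> m" unfolding D_def using card_image_le[of "{..<m}" l] by simp
  ultimately show "\<exists>D. semipaired_dominating_set ?V ?E D \<and> card D \<le> m"
    unfolding semipaired_dominating_set_def by blast
qed

text \<open>\<open>G v\<close> is the closed neighbourhood of the vertex of variable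
  \<open>v\<close>, so \<open>D\<close> meets it. These \<open>m\<close> sets are disjoint, hence
  \<open>D\<close> consists of one vertex from each: it contains no clause vertex and never both
  literals of a variable. So every clause vertex is dominated by a literal in
  \<open>D\<close>.\<close>

lemma sat_graph_sound:
  assumes D: "dominating_set {..<3 * m + r} (sat_graph m r L) D" "card D \<le> m"
  shows "\<exists>a. \<forall>c<r. \<exists>v<m. L c v (a v)"
proof -
  let ?E = "sat_graph m r L"
  define G where "G v = {2 * v, 2 * v + 1, 2 * m + v}" for v
  have DV: "D \<subseteq> {..<3 * m + r}" using D by (simp add: dominating_set_def)
  have nb: "j \<in> D \<or> (\<exists>i\<in>D. i < 2 * m \<and> sat_adj m L i j)" if j: "2 * m \<le> j" "j < 3 * m + r" for j
  proof (cases "j \<in> D")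
    case False
    then obtain i where i: "i \<in> D" "{i, j} \<in> ?E" using D(1) j unfolding dominating_set_def by auto
    then have "sat_adj m L i j \<or> sat_adj m L j i" using sat_graph_iff[of i m r j L] DV j by auto
    then show ?thesis using i j by (auto simp: sat_adj_def)
  qed simp
  have "\<exists>x\<in>D. x \<in> G v" if v: "v < m" for v
    using nb[of "2 * m + v"]
  proof
    assume "\<exists>i\<in>D. i < 2 * m \<and> sat_adj m L i (2 * m + v)"
    then obtain i where "i \<in> D" "i div 2 = v" using v by (auto simp: sat_adj_def)
    moreover have "i = 2 * (i div 2) \<or> i = 2 * (i div 2) + 1" by presburger
    ultimately show ?thesis by (auto simp: G_def)
  qed (use v in \<open>auto simp: G_def\<close>)
  then obtain g where g: "\<And>v. v < m \<Longrightarrow> g v \<in> D \<and> g v \<in> G v" by metis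
  have G: "u = v" if "x \<in> G u" "x \<in> G v" "u < m" "v < m" for x u v
    using that unfolding G_def by auto
  have "inj_on g {..<m}" using g G by (intro inj_onI) (metis lessThan_iff)
  then have "card (g ` {..<m}) = m" by (simp add: card_image)
  moreover have "finite D" using DV finite_subset by blast
  ultimately have Dg: "g ` {..<m} = D" 
    using D(2) g card_mono[of D "g ` {..<m}"]
    by (intro card_subset_eq) (auto simp: image_subset_iff)
  have notboth: "\<not> (2 * v \<in> D \<and> 2 * v + 1 \<in> D)" if v: "v < m" for v
  proof
    assume "2 * v \<in> D \<and> 2 * v + 1 \<in> D"
    then obtain u u' where u: "u < m" "u' < m" "g u = 2 * v" "g u' = 2 * v + 1" using Dg by (auto simp: image_iff)
    have "u = v" by (rule G[of "g u"]) (use u v g[of u] in \<open>auto simp: G_def\<close>)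
    moreover have "u' = v" by (rule G[of "g u'"]) (use u v g[of u'] in \<open>auto simp: G_def\<close>)
    ultimately show False using u by simp
  qed
  \<comment> \<open>A variable represented in \<open>D\<close> by its own vertex is false by
    default. A negative literal in \<open>D\<close> makes its variable false because the positive
    one is then missing.\<close>
  have "\<exists>v<m. L c v (2 * v + 1 \<in> D)" if c: "c < r" for c
  proof -
    have "3 * m + c \<notin> D" using Dg g by (fastforce simp: G_def)
    then obtain i where i: "i \<in> D" "i < 2 * m" "sat_adj m L i (3 * m + c)" using nb[of "3 * m + c"] c by auto
    show ?thesis
    proof (cases "odd i")
      case True
      then have "i = 2 * (i div 2) + 1" by presburger
      then show ?thesis using i True by (intro exI[of _ "i div 2"]) (auto simp: sat_adj_def)
    next
      case False
      then have e: "i = 2 * (i div 2)" by presburger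
      then have "2 * (i div 2) + 1 \<notin> D" using notboth[of "i div 2"] i by auto
      then show ?thesis using i False by (intro exI[of _ "i div 2"]) (auto simp: sat_adj_def)
    qed
  qed
  then show ?thesis by (intro exI[of _ "\<lambda>v. 2 * v + 1 \<in> D"]) blast
qed

lemma sat_graph_correct:
  assumes "even m" "m > 0"
  shows "encode_instance (3 * m + r) (sat_graph m r L) m \<in> semipaired_domination_split \<longleftrightarrow>
    (\<exists>a. \<forall>c<r. \<exists>v<m. L c v (a v))"
proof
  assume "\<exists>a. \<forall>c<r. \<exists>v<m. L c v (a v)"
  then obtain a where a: "\<And>c. c < r \<Longrightarrow> \<exists>v<m. L c v (a v)" by blast
  note sat_graph_complete[where a = a and L = L and r = r, OF assms a]
  then show "encode_instance (3 * m + r) (sat_graph m r L) m \<in> semipaired_domination_split"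
    using encode_instance_in_semipaired_domination_split_iff[OF split_sat_graph] assms(2) by blast
next
  assume "encode_instance (3 * m + r) (sat_graph m r L) m \<in> semipaired_domination_split"
  then obtain n E k D where "encode_instance (3 * m + r) (sat_graph m r L) m = encode_instance n E k"
    "split_graph {..<n} E" "semipaired_dominating_set {..<n} E D" "card D \<le> k"
    unfolding semipaired_domination_split_def by blast
  moreover from this have "3 * m + r = n \<and> sat_graph m r L = E \<and> m = k"
    using split_sat_graph by (intro encode_instance_inj) (auto simp: split_graph_def)
  ultimately show "\<exists>a. \<forall>c<r. \<exists>v<m. L c v (a v)"
    using sat_graph_sound[of m r L D] unfolding semipaired_dominating_set_def by blast
qed

section \<open>Bits of the constructed instance\<close>

definition num_bits :: "nat \<Rightarrow> nat" where
  "num_bits k = (\<Sum>i<k. of_bool (0 < rec_nat k (\<lambda>_ a. a div 2) i))"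

text \<open>Halving step by step avoids the value \<open>2 ^ i\<close>, which no polynomial
  bounds.\<close>

lemma rec_halve: "rec_nat (k::nat) (\<lambda>_ a. a div 2) i = k div 2 ^ i"
  by (induction i) (simp_all add: div_mult2_eq[symmetric] mult.commute)

lemma bits_of_nat_nth:
  "(i < length (bits_of_nat k) \<longleftrightarrow> 0 < k div 2 ^ i) \<and>
   (i < length (bits_of_nat k) \<longrightarrow> bits_of_nat k ! i = odd (k div 2 ^ i))"
proof (induction i arbitrary: k)
  case 0
  then show ?case by (cases "k = 0") (simp_all add: bits_of_nat_pos)
next
  case (Suc i)
  show ?case
  proof (cases "k = 0")
    case False
    then show ?thesis using Suc[of "k div 2"] by (simp add: bits_of_nat_pos[of k] div_mult2_eq)
  qed simp
qed

lemma length_bits_of_nat: "length (bits_of_nat k) = num_bits k"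
proof -
  \<comment> \<open>Summing over \<open>i < k\<close> reaches all bits, since a bit at position
    \<open>i\<close> requires \<open>i < 2 ^ i <= k\<close>.\<close>
  have "i < k" if "0 < k div 2 ^ i" for i
    using that by (metis div_less less_exp less_irrefl less_le_trans linorder_not_le)
  then have "{..<k} \<inter> {i. 0 < k div 2 ^ i} = {i. 0 < k div 2 ^ i}" by auto
  also have "\<dots> = {..<length (bits_of_nat k)}" using bits_of_nat_nth by auto
  finally have "card ({..<k} \<inter> {i. 0 < k div 2 ^ i}) = length (bits_of_nat k)" by simp
  then show ?thesis unfolding num_bits_def rec_halve by simp
qed

text \<open>The reduction must present its output as a predicate on positions, so row and column are
  recovered from \<open>p\<close> by division.\<close>

definition sat_code_bit :: "nat \<Rightarrow> nat \<Rightarrow> (nat \<Rightarrow> nat \<Rightarrow> bool \<Rightarrow> bool) \<Rightarrow> nat \<Rightarrow> bool" where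
  "sat_code_bit m r L p \<longleftrightarrow> (if p < 3 * m + r then True else if p = 3 * m + r then False
     else if p < 3 * m + r + 1 + (3 * m + r) * (3 * m + r)
       then sat_adj m L ((p - (3 * m + r + 1)) div (3 * m + r)) ((p - (3 * m + r + 1)) mod (3 * m + r)) \<or>
         sat_adj m L ((p - (3 * m + r + 1)) mod (3 * m + r)) ((p - (3 * m + r + 1)) div (3 * m + r))
     else odd (rec_nat m (\<lambda>_ a. a div 2) (p - (3 * m + r + 1 + (3 * m + r) * (3 * m + r)))))"

lemma encode_sat_graph:
  "encode_instance (3 * m + r) (sat_graph m r L) m =
   map (sat_code_bit m r L) [0..<3 * m + r + 1 + (3 * m + r) * (3 * m + r) + num_bits m]"
proof (rule nth_equalityI)
  let ?N = "3 * m + r"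
  show "length (encode_instance ?N (sat_graph m r L) m) =
    length (map (sat_code_bit m r L) [0..<?N + 1 + ?N * ?N + num_bits m])"
    by (simp add: encode_instance_def length_adjacency_bits length_bits_of_nat)
  fix p assume "p < length (encode_instance ?N (sat_graph m r L) m)"
  then have p: "p < ?N + 1 + ?N * ?N + num_bits m"
    by (simp add: encode_instance_def length_adjacency_bits length_bits_of_nat)
  consider "p \<le> ?N" | q where "p = ?N + 1 + q" "q < ?N * ?N"
    | q where "p = ?N + 1 + ?N * ?N + q" "q < num_bits m"
    using p by (metis add_diff_inverse_nat add_le_cancel_left less_Suc_eq_le linorder_not_less nat_add_left_cancel_less Suc_eq_plus1)
  then have "encode_instance ?N (sat_graph m r L) m ! p = sat_code_bit m r L p"
  proof cases
    case 1
    then show ?thesis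
      by (auto simp: encode_instance_def sat_code_bit_def nth_append nth_Cons')
  next
    case 2
    then have "0 < ?N" by (cases ?N) auto
    then have "q div ?N < ?N" "q mod ?N < ?N" using 2 by (auto simp: less_mult_imp_div_less)
    then show ?thesis using 2 sat_graph_iff[of "q div ?N" m r "q mod ?N" L]
      by (simp add: encode_instance_def sat_code_bit_def nth_append length_adjacency_bits
          adjacency_bits_def[of ?N] concat_rows)
  next
    case 3
    then show ?thesis using bits_of_nat_nth[of q m]
      by (simp add: encode_instance_def sat_code_bit_def nth_append length_adjacency_bits
          rec_halve length_bits_of_nat)
  qed
  then show "encode_instance ?N (sat_graph m r L) m ! p =
      map (sat_code_bit m r L) [0..<?N + 1 + ?N * ?N + num_bits m] ! p"
    using p by (simp del: upt_Suc)
qed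

lemma PF_halve: assumes "PF W vs k" "PF W vs i" shows "PF W vs (\<lambda>e. rec_nat (k e) (\<lambda>_ a. a div 2) (i e))"
  by (rule PF_rec[OF assms(2,1) _ PF_bound[OF assms(1)]])
    (intro PF_intros, simp only: rec_halve, rule div_le_dividend)

text \<open>The closure rules are all stated for composed terms, without a general composition rule;
  therefore \<open>L\<close> is assumed decidable for arbitrary argument functions \<open>c\<close>
  and \<open>v\<close>.\<close>

lemma sat_reducible:
  assumes m: "PF (\<lambda>w. w) [length] m" "\<And>w. even (m w)" "\<And>w. m w > 0"
    and r: "PF (\<lambda>w. w) [length] r"
    and L: "\<And>c v (b::bool). PF fst (lift [length]) c \<Longrightarrow> PF fst (lift [length]) v \<Longrightarrow>
      PD fst (lift [length]) (\<lambda>z. L (fst z) (c z) (v z) b)"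
    and A: "\<And>x. x \<in> A \<longleftrightarrow> (\<exists>a. \<forall>c<r (bit_word x). \<exists>v<m (bit_word x). L (bit_word x) c v (a v))"
  shows "poly_time_reducible A semipaired_domination_split"
proof -
  have m': "PF fst (lift [length]) (\<lambda>z. m (fst z))" and r': "PF fst (lift [length]) (\<lambda>z. r (fst z))"
    using PF_fst[OF m(1)] PF_fst[OF r] by simp_all
  have p: "PF fst (lift [length]) snd" by (rule PF_snd)
  have "poly_time_computable (\<lambda>x. map (\<lambda>p. (\<lambda>z. sat_code_bit (m (fst z)) (r (fst z)) (L (fst z)) (snd z)) (bit_word x, p))
     [0..<(\<lambda>w. 3 * m w + r w + 1 + (3 * m w + r w) * (3 * m w + r w) + num_bits (m w)) (bit_word x)])"
  proof (rule PF_computable)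
    show "PF (\<lambda>w. w) [length] (\<lambda>w. 3 * m w + r w + 1 + (3 * m w + r w) * (3 * m w + r w) + num_bits (m w))"
      unfolding num_bits_def by (intro PF_add PF_mult PF_const m(1) r PF_sum PF_intros PF_halve)
    have if_PD: "PD W vs (\<lambda>e. if P e then Q e else R e)" if "PD W vs P" "PD W vs Q" "PD W vs R"
      for W :: "nat list \<times> nat \<Rightarrow> nat list" and vs P Q R
      using PD_disj[OF PD_conj[OF that(1,2)] PD_conj[OF PD_not[OF that(1)] that(3)]]
      by (simp only: if_bool_eq_disj)
    have adj: "PD fst (lift [length]) (\<lambda>z. sat_adj (m (fst z)) (L (fst z)) (i z) (j z))"
      if "PF fst (lift [length]) i" "PF fst (lift [length]) j" for i j
      unfolding sat_adj_def
      by (intro PD_conj PD_disj PD_not PD_less PD_eq PD_even if_PD L PF_diff PF_div PF_mult PF_const m' that)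
    show "PD fst (lift [length]) (\<lambda>z. sat_code_bit (m (fst z)) (r (fst z)) (L (fst z)) (snd z))"
      unfolding sat_code_bit_def
      by (intro if_PD PD_disj PD_not adj PD_less PD_eq PD_even PD_const PF_halve PF_add PF_mult PF_diff PF_div
          PF_mod PF_const p m' r')
  qed
  then have "poly_time_computable (\<lambda>x. encode_instance (3 * m (bit_word x) + r (bit_word x))
      (sat_graph (m (bit_word x)) (r (bit_word x)) (L (bit_word x))) (m (bit_word x)))"
    unfolding encode_sat_graph by simp
  moreover have "x \<in> A \<longleftrightarrow> encode_instance (3 * m (bit_word x) + r (bit_word x))
      (sat_graph (m (bit_word x)) (r (bit_word x)) (L (bit_word x))) (m (bit_word x)) \<in> semipaired_domination_split"
    for x unfolding sat_graph_correct[OF m(2,3)] by (rule A)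
  ultimately show ?thesis
    unfolding poly_time_reducible_def by (intro exI conjI allI)
qed

section \<open>Computation tables as formulas\<close>

text \<open>A finite table may hold an arbitrary \<open>F\<close>. The five zones are the central
  cell, its two neighbours and the two sides beyond them.\<close>

definition table5 :: "nat \<Rightarrow> (nat \<Rightarrow> nat \<Rightarrow> nat \<Rightarrow> nat \<Rightarrow> nat \<Rightarrow> nat) \<Rightarrow> nat \<Rightarrow> nat \<Rightarrow> nat \<Rightarrow> nat \<Rightarrow> nat \<Rightarrow> nat" where
  "table5 A F z a0 a1 a2 a3 = (if z < 5 then if a0 < A then if a1 < A then if a2 < A then if a3 < A
     then F z a0 a1 a2 a3 else 0 else 0 else 0 else 0 else 0)"

lemma PF_table5:
  assumes "PF W vs z" "PF W vs a0" "PF W vs a1" "PF W vs a2" "PF W vs a3"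
  shows "PF W vs (\<lambda>e. table5 A F (z e) (a0 e) (a1 e) (a2 e) (a3 e))"
  unfolding table5_def
  by (rule PF_cases[OF assms(1)], rule PF_cases[OF assms(2)], rule PF_cases[OF assms(3)],
      rule PF_cases[OF assms(4)], rule PF_cases[OF assms(5)], rule PF_const)

text \<open>A deterministic evolution of cells \<open>c t j\<close> with values below \<open>A\<close>, for times \<open>t \<le> T\<close>. The
  value of a cell is determined by \<open>F\<close> from its neighbourhood and from the central cell
  \<open>j = T\<close> at the previous time. Initially the word \<open>inp\<close> of length \<open>n\<close> starts at the centre and is
  followed by a separator and by a word \<open>y\<close> of length at most \<open>P\<close>, on which the evolution depends.
  All clauses on later cells are Horn clauses, so every satisfying assignment contains the evolution
  for the word \<open>y\<close> that it guesses.\<close>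

locale cells =
  fixes n P T A :: nat and inp :: "nat \<Rightarrow> bool"
    and F :: "nat \<Rightarrow> nat \<Rightarrow> nat \<Rightarrow> nat \<Rightarrow> nat \<Rightarrow> nat" and \<sigma> :: "nat \<Rightarrow> nat" and acc :: "nat \<Rightarrow> bool"
begin

definition initial_symbol :: "bool list \<Rightarrow> nat \<Rightarrow> nat" where
  "initial_symbol y j = (if j < T then 0 else if j - T < n then (if inp (j - T) then 2 else 1)
     else if j = T + n then 3 else if j - (T + n + 1) < length y
     then (if y ! (j - (T + n + 1)) then 2 else 1) else 0)"

text \<open>In the \<open>P\<close> cells behind the separator a bit or a blank is allowed; this
  freedom is the guess of the certificate.\<close>

definition initial_value :: "nat \<Rightarrow> nat \<Rightarrow> bool" where
  "initial_value j a \<longleftrightarrow> (if j < T then a = \<sigma> 0 else if j - T < n then a = (if inp (j - T) then \<sigma> 2 else \<sigma> 1)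
     else if j = T + n then a = \<sigma> 3 else a = \<sigma> 0 \<or> j \<le> T + n + P \<and> (a = \<sigma> 1 \<or> a = \<sigma> 2))"

text \<open>\<open>k\<close> selects the kind of clause: 0 is the evolution, 1 the initial row, 2
  makes blanks persist to the right so that the guessed word is contiguous, and 3 forbids
  nonaccepting values in the centre at time \<open>T\<close>. If the indices are out of range, every
  literal satisfies the clause.\<close>

definition clause_lit :: "nat \<Rightarrow> nat \<Rightarrow> nat \<Rightarrow> nat \<Rightarrow> nat \<Rightarrow> nat \<Rightarrow> nat \<Rightarrow> nat \<Rightarrow> nat \<Rightarrow> nat \<Rightarrow> bool \<Rightarrow> bool" where
  "clause_lit k t j a0 a1 a2 a3 t' j' a' b \<longleftrightarrow>
    (k = 0 \<longrightarrow> t < T \<and> 0 < j \<and> j < 2 * T \<and> a0 < A \<and> a1 < A \<and> a2 < A \<and> a3 < A \<longrightarrow>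
       b \<and> t' = t + 1 \<and> j' = j \<and> a' = table5 A F (min 4 (j + 2 - T)) a0 a1 a2 a3 \<or>
       \<not> b \<and> t' = t \<and> (j' = T \<and> a' = a0 \<or> j' + 1 = j \<and> a' = a1 \<or> j' = j \<and> a' = a2 \<or> j' = j + 1 \<and> a' = a3)) \<and>
    (k = 1 \<longrightarrow> j \<le> 2 * T \<longrightarrow> b \<and> t' = 0 \<and> j' = j \<and> initial_value j a') \<and>
    (k = 2 \<longrightarrow> T + n < j \<and> j < T + n + P \<longrightarrow>
       t' = 0 \<and> a' = \<sigma> 0 \<and> (\<not> b \<and> j' = j \<or> b \<and> j' = j + 1)) \<and>
    (k = 3 \<longrightarrow> a0 < A \<and> \<not> acc a0 \<longrightarrow> \<not> b \<and> t' = T \<and> j' = T \<and> a' = a0)"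

end

lemma PD_clause_lit:
  assumes "PF W vs n" "PF W vs P" "PF W vs T" "\<And>f. PF W vs f \<Longrightarrow> PD W vs (\<lambda>e. inp e (f e))"
    "PF W vs k" "PF W vs t" "PF W vs j" "PF W vs a0" "PF W vs a1" "PF W vs a2" "PF W vs a3"
    "PF W vs t'" "PF W vs j'" "PF W vs a'"
  shows "PD W vs (\<lambda>e. cells.clause_lit (n e) (P e) (T e) A (inp e) F \<sigma> acc (k e) (t e) (j e)
    (a0 e) (a1 e) (a2 e) (a3 e) (t' e) (j' e) (a' e) b)"
proof -
  have if_PD: "PD W vs (\<lambda>e. if P e then Q e else R e)" if "PD W vs P" "PD W vs Q" "PD W vs R" for P Q R
    using PD_disj[OF PD_conj[OF that(1,2)] PD_conj[OF PD_not[OF that(1)] that(3)]]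
    by (simp only: if_bool_eq_disj)
  have acc: "PD W vs (\<lambda>e. a0 e < A \<and> \<not> acc (a0 e))" by (rule PD_cases[OF assms(8)])
  show ?thesis
    unfolding cells.clause_lit_def cells.initial_value_def
    by (intro acc PD_conj PD_imp PD_disj PD_not PD_less PD_le PD_eq if_PD PF_if PD_const PF_table5 PF_min
        PF_add PF_mult PF_diff PF_const assms)
qed

context cells
begin

text \<open>An assignment may mark several values in one cell, and nothing has to forbid this: the
  clauses propagate the presence of the true values, and acceptance only excludes the presence of
  wrong ones in the final centre.\<close>

lemma satisfiable_iff:
  fixes c :: "bool list \<Rightarrow> nat \<Rightarrow> nat \<Rightarrow> nat"
  assumes B: "A \<le> B" "2 * T + n + P + 5 \<le> B"
    and init: "\<And>y j. c y 0 j = \<sigma> (initial_symbol y j)"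
    and step: "\<And>y t j. t < T \<Longrightarrow> 0 < j \<Longrightarrow> c y (Suc t) j =
      F (min 4 (j + 2 - T)) (c y t T) (c y t (j - 1)) (c y t j) (c y t (j + 1))"
    and range: "\<And>y t j. length y \<le> P \<Longrightarrow> c y t j < A"
    and inj: "inj \<sigma>"
  shows "(\<exists>\<phi>. \<forall>k<B. \<forall>t<B. \<forall>j<B. \<forall>a0<B. \<forall>a1<B. \<forall>a2<B. \<forall>a3<B.
      \<exists>t'<B. \<exists>j'<B. \<exists>a'<B. clause_lit k t j a0 a1 a2 a3 t' j' a' (\<phi> t' j' a')) \<longleftrightarrow>
    (\<exists>y. length y \<le> P \<and> acc (c y T T))" (is "?L \<longleftrightarrow> ?R")
proof
  assume ?L
  then obtain \<phi> where "\<forall>k<B. \<forall>t<B. \<forall>j<B. \<forall>a0<B. \<forall>a1<B. \<forall>a2<B. \<forall>a3<B.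
      \<exists>t'<B. \<exists>j'<B. \<exists>a'<B. clause_lit k t j a0 a1 a2 a3 t' j' a' (\<phi> t' j' a')" ..
  note \<phi> = this[rule_format]
  have s0: "\<phi> 0 (j + 1) (\<sigma> 0)" if "T + n < j" "j < T + n + P" "\<phi> 0 j (\<sigma> 0)" for j
    using \<phi>[of 2 0 j 0 0 0 0] that B by (auto simp: clause_lit_def)
  have s1: "\<exists>a. initial_value j a \<and> \<phi> 0 j a" if "j \<le> 2 * T" for j
    using \<phi>[of 1 0 j 0 0 0 0] that B by (auto simp: clause_lit_def)
  \<comment> \<open>The certificate ends at the first blank; the alternative \<open>i = P\<close>
    covers a block without blanks.\<close>
  define l where "l = (LEAST i. i = P \<or> \<phi> 0 (T + n + 1 + i) (\<sigma> 0))"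
  have l: "l = P \<or> \<phi> 0 (T + n + 1 + l) (\<sigma> 0)"
    unfolding l_def by (rule LeastI[of _ P]) simp
  have lP: "l \<le> P" unfolding l_def by (rule Least_le) simp
  have l': "\<not> \<phi> 0 (T + n + 1 + i) (\<sigma> 0)" if "i < l" for i
    using not_less_Least[of i] that unfolding l_def by blast
  have blank: "\<phi> 0 (T + n + 1 + i) (\<sigma> 0)" if "l \<le> i" "i < P" for i
    using that
  proof (induction i rule: dec_induct)
    case base
    then show ?case using l by simp
  next
    case (step i)
    then show ?case using s0[of "T + n + 1 + i"] by simp
  qed
  \<comment> \<open>A cell marked with both bits counts as \<open>True\<close>.\<close>
  define y where "y = map (\<lambda>i. \<phi> 0 (T + n + 1 + i) (\<sigma> 2)) [0..<l]"
  have row0: "\<phi> 0 j (c y 0 j)" if j: "j \<le> 2 * T" for j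
  proof -
    obtain a where a: "initial_value j a" "\<phi> 0 j a" using s1[OF j] by blast
    consider "j \<le> T + n" | "T + n + P < j" | i where "j = T + n + 1 + i" "i < P"
      by (metis Suc_eq_plus1 add.assoc less_eqE linorder_not_less nat_add_left_cancel_less not_less_eq_eq plus_1_eq_Suc add_less_cancel_left)
    then show ?thesis
    proof cases
      case 3
      show ?thesis
      proof (cases "i < l")
        case True
        then have "\<sigma> 0 \<noteq> a" using l' a 3 by auto
        then have "a = \<sigma> 1 \<or> a = \<sigma> 2" using a(1) 3 by (auto simp: initial_value_def)
        then show ?thesis using 3 a True by (auto simp: init initial_symbol_def y_def)
      next
        case False
        then show ?thesis using blank[of i] 3 by (simp add: init initial_symbol_def y_def)
      qed
    qed (use a lP in \<open>auto simp: init initial_value_def initial_symbol_def y_def split: if_splits\<close>)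
  qed
  have ly: "length y \<le> P" using lP by (simp add: y_def)
  note range = range[OF ly]
  have rB: "c y t j < B" for t j using range[of t j] B by simp
  \<comment> \<open>The known part of the window shrinks by one cell on both sides in each step; at
    time \<open>T\<close> it is exactly the centre.\<close>
  have row: "t \<le> T \<Longrightarrow> t \<le> j \<Longrightarrow> j + t \<le> 2 * T \<Longrightarrow> \<phi> t j (c y t j)" for t j
  proof (induction t arbitrary: j)
    case (Suc t)
    have ih: "\<phi> t T (c y t T)" "\<phi> t (j - 1) (c y t (j - 1))" "\<phi> t j (c y t j)" "\<phi> t (j + 1) (c y t (j + 1))"
      using Suc.prems by (auto intro!: Suc.IH)
    have F: "c y (Suc t) j = table5 A F (min 4 (j + 2 - T)) (c y t T) (c y t (j - 1)) (c y t j) (c y t (j + 1))"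
      using step[of t j y] Suc.prems range by (simp add: table5_def)
    have "0 < B" "t < B" "j < B" using Suc.prems B by auto
    then obtain t' j' a' where
      "clause_lit 0 t j (c y t T) (c y t (j - 1)) (c y t j) (c y t (j + 1)) t' j' a' (\<phi> t' j' a')"
      using \<phi>[OF _ _ _ rB rB rB rB] by blast
    then have "\<phi> t' j' a' \<and> t' = Suc t \<and> j' = j \<and> a' = c y (Suc t) j \<or>
        \<not> \<phi> t' j' a' \<and> t' = t \<and> (j' = T \<and> a' = c y t T \<or> j' = j - 1 \<and> a' = c y t (j - 1) \<or>
           j' = j \<and> a' = c y t j \<or> j' = j + 1 \<and> a' = c y t (j + 1))"
      using range Suc.prems unfolding clause_lit_def F by auto
    then show ?case using ih by metis
  qed (use row0 in auto)
  have "acc (c y T T)"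
  proof (rule ccontr)
    assume "\<not> acc (c y T T)"
    moreover have "3 < B" "0 < B" using B by auto
    then obtain t' j' a' where "clause_lit 3 0 0 (c y T T) 0 0 0 t' j' a' (\<phi> t' j' a')"
      using \<phi>[OF _ _ _ rB] by blast
    ultimately have "\<not> \<phi> T T (c y T T)" using range by (auto simp: clause_lit_def)
    then show False using row[of T T] by simp
  qed
  then show ?R using ly by blast
next
  assume ?R
  then obtain y where y: "length y \<le> P" "acc (c y T T)" by blast
  note range = range[OF y(1)]
  have rB: "c y t j < B" for t j using range[of t j] B by simp
  \<comment> \<open>The assignment is the computation on \<open>y\<close> itself, with exactly the
    actual value marked in each cell.\<close>
  have "\<exists>t'<B. \<exists>j'<B. \<exists>a'<B. clause_lit k t j a0 a1 a2 a3 t' j' a' (a' = c y t' j')"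
    if lt: "k < B" "t < B" "j < B" "a0 < B" "a1 < B" "a2 < B" "a3 < B" for k t j a0 a1 a2 a3
  proof -
    have wit: ?thesis if "t' < B" "j' < B" "a' < B" "clause_lit k t j a0 a1 a2 a3 t' j' a' (a' = c y t' j')" for t' j' a'
      using that by blast
    consider "k = 0" | "k = 1" | "k = 2" | "k = 3" | "k > 3" by linarith
    then show ?thesis
    proof cases
      case 1
      show ?thesis
      proof (cases "t < T \<and> 0 < j \<and> j < 2 * T \<and> a0 < A \<and> a1 < A \<and> a2 < A \<and> a3 < A")
        case True
        show ?thesis
        \<comment> \<open>If all premises are the actual values, so is the conclusion; otherwise a
          wrong premise supplies a true negative literal.\<close>
        proof (cases "a0 = c y t T \<and> a1 = c y t (j - 1) \<and> a2 = c y t j \<and> a3 = c y t (j + 1)")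
          case eq: True
          have "c y (Suc t) j = table5 A F (min 4 (j + 2 - T)) a0 a1 a2 a3"
            using step[of t j y] True eq by (simp add: table5_def)
          then show ?thesis using 1 lt True B rB[of "Suc t" j]
            by (intro wit[of "t + 1" j "c y (Suc t) j"]) (auto simp: clause_lit_def)
        next
          case False
          then consider "a0 \<noteq> c y t T" | "a1 \<noteq> c y t (j - 1)" | "a2 \<noteq> c y t j" | "a3 \<noteq> c y t (j + 1)" by blast
          then show ?thesis
          proof cases
            case 1
            then show ?thesis using \<open>k = 0\<close> lt B by (intro wit[of t T a0]) (auto simp: clause_lit_def)
          next
            case 2
            then show ?thesis using \<open>k = 0\<close> lt B by (intro wit[of t "j - 1" a1]) (auto simp: clause_lit_def)
          next
            case 3
            then show ?thesis using \<open>k = 0\<close> lt B by (intro wit[of t j a2]) (auto simp: clause_lit_def)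
          next
            case 4
            then show ?thesis using \<open>k = 0\<close> lt B True by (intro wit[of t "j + 1" a3]) (auto simp: clause_lit_def)
          qed
        qed
      next
        case False
        then show ?thesis using 1 B by (intro wit[of 0 0 0]) (auto simp: clause_lit_def)
      qed
    next
      case 2
      have "initial_value j (c y 0 j)"
        using y(1) by (auto simp: init initial_value_def initial_symbol_def)
      then show ?thesis using 2 lt B rB by (intro wit[of 0 j "c y 0 j"]) (auto simp: clause_lit_def)
    next
      case 3
      have \<sigma>: "\<sigma> 0 < B"
      proof -
        \<comment> \<open>A cell beyond the guessed block is always blank, so
          \<open>\<sigma> 0\<close> is the value of a cell and inherits its bound.\<close>
        have "c y 0 (T + n + P + 1) = \<sigma> 0" using y(1) by (auto simp: init initial_symbol_def)
        then show ?thesis using rB by metis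
      qed
      show ?thesis
      proof (cases "T + n < j \<and> j < T + n + P")
        case True
        show ?thesis
        proof (cases "c y 0 j = \<sigma> 0")
          case 0: True
          then have "initial_symbol y j = 0" using inj by (simp add: init inj_eq)
          then have "initial_symbol y (j + 1) = 0" using True by (auto simp: initial_symbol_def split: if_splits)
          then show ?thesis using 3 True \<sigma> B by (intro wit[of 0 "j + 1" "\<sigma> 0"]) (auto simp: clause_lit_def init)
        next
          case False
          then show ?thesis using 3 lt \<sigma> B by (intro wit[of 0 j "\<sigma> 0"]) (auto simp: clause_lit_def)
        qed
      next
        case False
        then show ?thesis using 3 B by (intro wit[of 0 0 0]) (auto simp: clause_lit_def)
      qed
    next
      case 4
      then show ?thesis using y(2) lt B by (intro wit[of T T a0]) (auto simp: clause_lit_def)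
    next
      case 5
      then show ?thesis using B by (intro wit[of 0 0 0]) (auto simp: clause_lit_def)
    qed
  qed
  then show ?L by (intro exI[of _ "\<lambda>t j a. a = c y t j"] allI impI)
qed

end

section \<open>Tuples as digits in base \<open>B\<close>\<close>

lemma digits_exist:
  assumes "\<And>d. d \<in> set ds \<Longrightarrow> d < (B::nat)"
  shows "\<exists>c<B ^ length ds. \<forall>i<length ds. c div B ^ i mod B = ds ! i"
  using assms
proof (induction ds)
  case (Cons d ds)
  then obtain c where c: "c < B ^ length ds" "\<forall>i<length ds. c div B ^ i mod B = ds ! i" by auto
  have d: "d < B" using Cons.prems by simp
  have "(d + B * c) div B ^ i mod B = (d # ds) ! i" if "i < Suc (length ds)" for i
  proof (cases i)
    case (Suc k)
    have "(d + B * c) div B ^ i = (d + B * c) div B div B ^ k" using Suc by (simp add: div_mult2_eq)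
    also have "(d + B * c) div B = c" using d by simp
    finally show ?thesis using c(2) Suc that by simp
  qed (use d in simp)
  moreover have "d + B * c < B ^ Suc (length ds)"
  proof -
    have "d + B * c < B * Suc c" using d by simp
    also have "\<dots> \<le> B * B ^ length ds" using c(1) by (intro mult_le_mono2) simp
    finally show ?thesis by simp
  qed
  ultimately show ?case by (intro exI[of _ "d + B * c"]) simp
qed simp

lemma digits3:
  fixes t j a B :: nat
  assumes "t < B" "j < B" "a < B"
  shows "t * (B * B) + j * B + a < B ^ 3" "(t * (B * B) + j * B + a) div (B * B) = t"
    "(t * (B * B) + j * B + a) div B mod B = j" "(t * (B * B) + j * B + a) mod B = a"
proof -
  have ja: "j * B + a < B * B" using index_less_square[of j B a B] assms by simp
  have "t * (B * B) + (j * B + a) < B * (B * B)" using index_less_square[of t B "j * B + a" "B * B"] ja assms by simp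
  then show "t * (B * B) + j * B + a < B ^ 3" by (simp add: power3_eq_cube add.assoc mult.assoc)
  have "B * B \<noteq> 0" using assms by auto
  then show "(t * (B * B) + j * B + a) div (B * B) = t"
    using ja by (metis add.assoc add.right_neutral div_less div_mult_self3)
  have "t * (B * B) + j * B + a = (t * B + j) * B + a" by (simp add: algebra_simps)
  then show "(t * (B * B) + j * B + a) div B mod B = j" "(t * (B * B) + j * B + a) mod B = a"
    using assms by simp_all
qed

lemma digits3_eq:
  fixes v B :: nat
  assumes "v < B ^ 3"
  shows "v div (B * B) < B" "v div B mod B < B" "v mod B < B"
    "v div (B * B) * (B * B) + v div B mod B * B + v mod B = v"
proof -
  have B: "B > 0" using assms by (cases B) auto
  show "v div (B * B) < B" using assms by (simp add: less_mult_imp_div_less power3_eq_cube mult.assoc)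
  show "v div B mod B < B" "v mod B < B" using B by simp_all
  have "v div (B * B) = v div B div B" by (simp add: div_mult2_eq)
  then have "v div (B * B) * (B * B) + v div B mod B * B = (v div B div B * B + v div B mod B) * B"
    by (simp only: mult.assoc add_mult_distrib)
  then show "v div (B * B) * (B * B) + v div B mod B * B + v mod B = v" by (simp only: div_mult_mod_eq)
qed

text \<open>Seven indices name a clause and three a variable. The graph construction expects single
  numbers, so both tuples are read as base \<open>B\<close> expansions.\<close>

lemma satisfiable_digits:
  fixes C :: "nat \<Rightarrow> nat \<Rightarrow> nat \<Rightarrow> nat \<Rightarrow> nat \<Rightarrow> nat \<Rightarrow> nat \<Rightarrow> nat \<Rightarrow> nat \<Rightarrow> nat \<Rightarrow> bool \<Rightarrow> bool"
  assumes "B > 0"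
  shows "(\<exists>a. \<forall>c<B ^ 7. \<exists>v<B ^ 3. C (c div B ^ 0 mod B) (c div B ^ 1 mod B) (c div B ^ 2 mod B) (c div B ^ 3 mod B)
      (c div B ^ 4 mod B) (c div B ^ 5 mod B) (c div B ^ 6 mod B) (v div (B * B)) (v div B mod B) (v mod B) (a v)) \<longleftrightarrow>
    (\<exists>\<phi>. \<forall>k<B. \<forall>t<B. \<forall>j<B. \<forall>a0<B. \<forall>a1<B. \<forall>a2<B. \<forall>a3<B.
      \<exists>t'<B. \<exists>j'<B. \<exists>a'<B. C k t j a0 a1 a2 a3 t' j' a' (\<phi> t' j' a'))" (is "?L \<longleftrightarrow> ?R")
proof
  assume ?L
  then obtain a where a: "\<And>c. c < B ^ 7 \<Longrightarrow> \<exists>v<B ^ 3. C (c div B ^ 0 mod B) (c div B ^ 1 mod B) (c div B ^ 2 mod B)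
     (c div B ^ 3 mod B) (c div B ^ 4 mod B) (c div B ^ 5 mod B) (c div B ^ 6 mod B)
     (v div (B * B)) (v div B mod B) (v mod B) (a v)" by auto
  have "\<exists>t'<B. \<exists>j'<B. \<exists>a'<B. C k t j a0 a1 a2 a3 t' j' a' (a (t' * (B * B) + j' * B + a'))"
    if "k < B" "t < B" "j < B" "a0 < B" "a1 < B" "a2 < B" "a3 < B" for k t j a0 a1 a2 a3
  proof -
    have l: "length [k, t, j, a0, a1, a2, a3] = 7" and
      s: "\<And>d. d \<in> set [k, t, j, a0, a1, a2, a3] \<Longrightarrow> d < B" using that by auto
    have "\<exists>c<B ^ 7. \<forall>i<7. c div B ^ i mod B = [k, t, j, a0, a1, a2, a3] ! i"
      using digits_exist[of "[k, t, j, a0, a1, a2, a3]" B, OF s] by (simp only: l)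
    then obtain c where "c < B ^ 7 \<and> (\<forall>i<7. c div B ^ i mod B = [k, t, j, a0, a1, a2, a3] ! i)" ..
    then have c: "c < B ^ 7" "\<And>i. i < 7 \<Longrightarrow> c div B ^ i mod B = [k, t, j, a0, a1, a2, a3] ! i"
      by blast+
    have "c div B ^ 0 mod B = k" "c div B ^ 1 mod B = t" "c div B ^ 2 mod B = j" "c div B ^ 3 mod B = a0"
      "c div B ^ 4 mod B = a1" "c div B ^ 5 mod B = a2" "c div B ^ 6 mod B = a3"
      using c(2)[of 0] c(2)[of 1] c(2)[of 2] c(2)[of 3] c(2)[of 4] c(2)[of 5] c(2)[of 6] by simp_all
    then obtain v where v: "v < B ^ 3" "C k t j a0 a1 a2 a3 (v div (B * B)) (v div B mod B) (v mod B) (a v)"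
      using a[OF c(1)] by auto
    then show ?thesis using digits3_eq[OF v(1)] by metis
  qed
  then show ?R by (intro exI[of _ "\<lambda>t' j' a'. a (t' * (B * B) + j' * B + a')"] allI impI)
next
  assume ?R
  then obtain \<phi> where "\<forall>k<B. \<forall>t<B. \<forall>j<B. \<forall>a0<B. \<forall>a1<B. \<forall>a2<B. \<forall>a3<B.
      \<exists>t'<B. \<exists>j'<B. \<exists>a'<B. C k t j a0 a1 a2 a3 t' j' a' (\<phi> t' j' a')" ..
  note \<phi> = this[rule_format]
  have m: "c div B ^ i mod B < B" for c i using assms by simp
  show ?L
  proof (intro exI[of _ "\<lambda>v. \<phi> (v div (B * B)) (v div B mod B) (v mod B)"] allI impI)
    fix c assume "c < B ^ 7"
    obtain t' j' a' where d: "t' < B" "j' < B" "a' < B" and C: "C (c div B ^ 0 mod B) (c div B ^ 1 mod B) (c div B ^ 2 mod B)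
     (c div B ^ 3 mod B) (c div B ^ 4 mod B) (c div B ^ 5 mod B) (c div B ^ 6 mod B) t' j' a' (\<phi> t' j' a')"
      using \<phi>[OF m m m m m m m, of c 0 c 1 c 2 c 3 c 4 c 5 c 6] by blast
    show "\<exists>v<B ^ 3. C (c div B ^ 0 mod B) (c div B ^ 1 mod B) (c div B ^ 2 mod B)
     (c div B ^ 3 mod B) (c div B ^ 4 mod B) (c div B ^ 5 mod B) (c div B ^ 6 mod B) (v div (B * B)) (v div B mod B) (v mod B)
     (\<phi> (v div (B * B)) (v div B mod B) (v mod B))"
      by (rule exI[of _ "t' * (B * B) + j' * B + a'"]) (use C digits3[OF d] in simp)
  qed
qed

section \<open>Every problem in NP reduces to semipaired domination\<close>

definition cfg_ok :: "tm \<Rightarrow> config \<Rightarrow> bool" where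
  "cfg_ok M c \<longleftrightarrow> fst c < num_states M \<and> length (snd c) = num_tapes M \<and>
     (\<forall>tp\<in>set (snd c). \<forall>i. fst tp i < num_symbols M)"

lemma tm_step_not_halted:
  assumes "turing_machine M" "cfg_ok M c" "\<not> halted M c"
  obtains q acts where "delta M (fst c) (map tape_read (snd c)) = (q, acts)" "q < num_states M"
    "length acts = num_tapes M" "fst ` set acts \<subseteq> {..<num_symbols M}"
    "tm_step M c = (q, map2 tape_act acts (snd c))"
proof -
  obtain q acts where d: "delta M (fst c) (map tape_read (snd c)) = (q, acts)" by fastforce
  have "set (map tape_read (snd c)) \<subseteq> {..<num_symbols M}"
    using assms(2) by (auto simp: cfg_ok_def tape_read_def)
  moreover have "fst c < num_states M" "length (map tape_read (snd c)) = num_tapes M"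
    using assms(2) by (auto simp: cfg_ok_def)
  ultimately have "let (q', acts) = delta M (fst c) (map tape_read (snd c))
      in q' < num_states M \<and> length acts = num_tapes M \<and> fst ` set acts \<subseteq> {..<num_symbols M}"
    using assms(1) unfolding turing_machine_def by blast
  then show thesis using that[OF d] d assms(3) by (simp add: tm_step_def)
qed

lemma cfg_ok_step: assumes "turing_machine M" "cfg_ok M c" shows "cfg_ok M (tm_step M c)"
proof (cases "halted M c")
  case False
  then obtain q acts where s: "q < num_states M" "length acts = num_tapes M"
    "fst ` set acts \<subseteq> {..<num_symbols M}" "tm_step M c = (q, map2 tape_act acts (snd c))"
    using tm_step_not_halted[OF assms] by metis
  have "fst tp i < num_symbols M" if tp: "tp \<in> set (map2 tape_act acts (snd c))" for tp i
  proof -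
    obtain a tp0 where "(a, tp0) \<in> set (zip acts (snd c))" "tp = tape_act a tp0" using tp by auto
    moreover from this have "a \<in> set acts" "tp0 \<in> set (snd c)" by (auto dest: set_zip_leftD set_zip_rightD)
    ultimately show ?thesis using s(3) assms(2) by (auto simp: tape_act_def cfg_ok_def)
  qed
  then show ?thesis using s assms(2) by (auto simp: cfg_ok_def)
qed (use assms in \<open>simp add: tm_step_def\<close>)

lemma cfg_ok_run:
  assumes "turing_machine M" "set w \<subseteq> {..<4}" shows "cfg_ok M (run M w t)"
proof (induction t)
  case 0
  have M: "4 \<le> num_symbols M" using assms(1) by (simp add: turing_machine_def)
  have "w ! k < num_symbols M" if "k < length w" for k
    using that assms(2) M by (meson lessThan_iff nth_mem order_less_le_trans subsetD)
  then have "word_contents w i < num_symbols M" "word_contents [] i < num_symbols M" for i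
    using M by (auto simp: word_contents_def)
  then show ?case using assms(1) by (auto simp: run_def cfg_ok_def init_config_def turing_machine_def)
next
  case (Suc t)
  then show ?case using cfg_ok_step[OF assms(1)] by (simp add: run_def)
qed

text \<open>The state and the symbols on all tapes at distance \<open>d\<close> from the heads. Relative to the heads
  the evolution of a machine is local, except that it depends on the symbols under the heads.\<close>

definition view :: "config \<Rightarrow> int \<Rightarrow> nat \<times> nat list" where
  "view c d = (fst c, map (\<lambda>tp. fst tp (snd tp + d)) (snd c))"

text \<open>After a move, the cell at distance \<open>d\<close> is the one formerly at
  \<open>d + offset\<close>. If this is 0, it has just been written; otherwise its symbol shifts in
  from \<open>ls\<close>, \<open>cs\<close> or \<open>rs\<close>, the old symbols at distances
  \<open>d - 1\<close>, \<open>d\<close> and \<open>d + 1\<close>.\<close>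

definition view_step :: "tm \<Rightarrow> int \<Rightarrow> nat \<times> nat list \<Rightarrow> nat list \<Rightarrow> nat list \<Rightarrow> nat list \<Rightarrow> nat \<times> nat list" where
  "view_step M d v ls cs rs =
    (if fst v = accept_state M \<or> fst v = reject_state M then (fst v, cs)
     else let (q, acts) = delta M (fst v) (snd v) in
       (q, map (\<lambda>i. if d + offset (snd (acts ! i)) = 0 then fst (acts ! i)
          else case snd (acts ! i) of MoveLeft \<Rightarrow> ls ! i | Stay \<Rightarrow> cs ! i | MoveRight \<Rightarrow> rs ! i) [0..<num_tapes M]))"

lemma view_tm_step:
  assumes "turing_machine M" "cfg_ok M c"
  shows "view (tm_step M c) d =
    view_step M d (view c 0) (snd (view c (d - 1))) (snd (view c d)) (snd (view c (d + 1)))"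
proof (cases "halted M c")
  case True
  then show ?thesis by (simp add: view_step_def tm_step_def view_def halted_def)
next
  case False
  then obtain q acts where s: "delta M (fst c) (map tape_read (snd c)) = (q, acts)"
    "length acts = num_tapes M" "tm_step M c = (q, map2 tape_act acts (snd c))"
    using tm_step_not_halted[OF assms] by metis
  have l: "length (snd c) = num_tapes M" using assms(2) by (simp add: cfg_ok_def)
  have v0: "view c 0 = (fst c, map tape_read (snd c))" by (simp add: view_def tape_read_def)
  have key: "fst (tape_act a tp) (snd (tape_act a tp) + d) = (if d + offset (snd a) = 0 then fst a
      else case snd a of MoveLeft \<Rightarrow> fst tp (snd tp + (d - 1)) | Stay \<Rightarrow> fst tp (snd tp + d)
        | MoveRight \<Rightarrow> fst tp (snd tp + (d + 1)))" for a tp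
    by (cases "snd a") (auto simp: tape_act_def algebra_simps)
  have "map (\<lambda>tp. fst tp (snd tp + d)) (map2 tape_act acts (snd c)) =
      map (\<lambda>i. if d + offset (snd (acts ! i)) = 0 then fst (acts ! i)
          else case snd (acts ! i) of MoveLeft \<Rightarrow> snd (view c (d - 1)) ! i | Stay \<Rightarrow> snd (view c d) ! i
            | MoveRight \<Rightarrow> snd (view c (d + 1)) ! i) [0..<num_tapes M]"
  proof (rule nth_equalityI)
    fix i assume i: "i < length (map (\<lambda>tp. fst tp (snd tp + d)) (map2 tape_act acts (snd c)))"
    then have i': "i < num_tapes M" "i < length acts" "i < length (snd c)" using s l by auto
    show "map (\<lambda>tp. fst tp (snd tp + d)) (map2 tape_act acts (snd c)) ! i = map (\<lambda>i. if d + offset (snd (acts ! i)) = 0 then fst (acts ! i)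
          else case snd (acts ! i) of MoveLeft \<Rightarrow> snd (view c (d - 1)) ! i | Stay \<Rightarrow> snd (view c d) ! i
            | MoveRight \<Rightarrow> snd (view c (d + 1)) ! i) [0..<num_tapes M] ! i"
      using i' by (simp add: key view_def split: move.split)
  qed (use s l in simp)
  then show ?thesis using False s unfolding view_step_def v0
    by (simp add: view_def halted_def)
qed

text \<open>The distance is only compared with head offsets, which are at most 1 in absolute value,
  so it may be clipped to the range from -2 to 2. Truncated subtraction does the clipping on the
  left.\<close>

lemma view_step_zone:
  "view_step M (int (min 4 (j + 2 - T)) - 2) v ls cs rs = view_step M (int j - int T) v ls cs rs"
proof -
  have "int (min 4 (j + 2 - T)) - 2 + offset mv = 0 \<longleftrightarrow> int j - int T + offset mv = 0" for mv
    by (cases mv) auto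
  then show ?thesis by (simp add: view_step_def)
qed

lemma view_init:
  assumes "num_tapes M \<ge> 1"
  shows "view (init_config M (pair_word x y)) (int j - int T) =
   (start_state M, cells.initial_symbol (length x) T (\<lambda>i. x ! i) y j # replicate (num_tapes M - 1) 0)"
proof -
  have "word_contents (pair_word x y) (int j - int T) = cells.initial_symbol (length x) T (\<lambda>i. x ! i) y j"
    by (auto simp: word_contents_def cells.initial_symbol_def pair_word_def bit_word_def nth_append
        nth_Cons' nat_diff_distrib)
  then show ?thesis by (simp add: view_def init_config_def word_contents_def)
qed

lemma poly_nat_mono: "a \<le> b \<Longrightarrow> poly p a \<le> poly p (b::nat)"
  by (induction p) (auto intro: add_mono mult_mono)

definition view_fun :: "tm \<Rightarrow> nat \<Rightarrow> nat \<Rightarrow> nat \<Rightarrow> nat \<Rightarrow> nat \<Rightarrow> nat" where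
  "view_fun M z a0 a1 a2 a3 = to_nat (view_step M (int z - 2) (from_nat a0)
     (snd (from_nat a1 :: nat \<times> nat list)) (snd (from_nat a2 :: nat \<times> nat list))
     (snd (from_nat a3 :: nat \<times> nat list)))"

text \<open>The bound depends on the machine alone, as the transition table has to be a constant of
  the reduction.\<close>

lemma finite_views: "\<exists>A. \<forall>c d. cfg_ok M c \<longrightarrow> to_nat (view c d) < A"
proof -
  let ?S = "{..<num_states M} \<times> {ss. set ss \<subseteq> {..<num_symbols M} \<and> length ss = num_tapes M}"
  have "finite ?S" by (intro finite_cartesian_product finite_lists_length_eq) auto
  then have "finite (to_nat ` ?S)" by blast
  then obtain A where "\<forall>a\<in>to_nat ` ?S. a < A" using finite_nat_set_iff_bounded by blast
  moreover have "view c d \<in> ?S" if "cfg_ok M c" for c d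
    using that by (auto simp: view_def cfg_ok_def)
  ultimately show ?thesis by blast
qed

lemma NP_reducible:
  assumes "L \<in> NP" shows "poly_time_reducible L semipaired_domination_split"
proof -
  obtain M p where V: "poly_time_verifier M" and
    L: "\<And>x. x \<in> L \<longleftrightarrow> (\<exists>y. length y \<le> poly p (length x) \<and> accepts M (pair_word x y))"
    using assms unfolding NP_def by blast
  have M: "turing_machine M" using V by (simp add: poly_time_verifier_def)
  obtain q where q: "\<And>x y. halted M (run M (pair_word x y) (poly q (length (pair_word x y))))"
    using V unfolding poly_time_verifier_def by blast
  obtain A where A: "\<And>c d. cfg_ok M c \<Longrightarrow> to_nat (view c d) < A" using finite_views by blast
  define P where "P n = poly p n" for n
  \<comment> \<open>One running time for all certificates: \<open>n + 1 + P n\<close> bounds the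
    length of the paired words.\<close>
  define T where "T n = poly q (n + 1 + P n)" for n
  \<comment> \<open>The factor 2 makes the number \<open>B ^ 3\<close> of variables even.\<close>
  define B where "B n = 2 * (2 * T n + n + P n + A + 5)" for n
  define \<sigma> where "\<sigma> s = to_nat (start_state M, s # replicate (num_tapes M - 1) 0)" for s :: nat
  define acc where "acc a \<longleftrightarrow> fst (from_nat a :: nat \<times> nat list) = accept_state M" for a
  define C where "C w = cells.clause_lit (length w) (P (length w)) (T (length w)) A
    (\<lambda>i. sym_at w i = 2) (view_fun M) \<sigma> acc" for w
  define D where "D w c v b \<longleftrightarrow> C w (c div B (length w) ^ 0 mod B (length w))
        (c div B (length w) ^ 1 mod B (length w)) (c div B (length w) ^ 2 mod B (length w))
        (c div B (length w) ^ 3 mod B (length w)) (c div B (length w) ^ 4 mod B (length w))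
        (c div B (length w) ^ 5 mod B (length w)) (c div B (length w) ^ 6 mod B (length w))
        (v div (B (length w) * B (length w))) (v div B (length w) mod B (length w)) (v mod B (length w)) b"
    for w c v b
  show ?thesis
  proof (rule sat_reducible[where m = "\<lambda>w. B (length w) ^ 3" and r = "\<lambda>w. B (length w) ^ 7" and L = D])
    have len: "PF (\<lambda>w. w) [length] length" by (rule PF_var) simp
    have fs: "PF (\<lambda>w. w) [length] (\<lambda>w. P (length w))" "PF (\<lambda>w. w) [length] (\<lambda>w. T (length w))"
      unfolding P_def T_def by (intro PF_poly PF_add PF_const len)+
    then have fB: "PF (\<lambda>w. w) [length] (\<lambda>w. B (length w))"
      unfolding B_def by (intro PF_add PF_mult PF_const len)
    show "PF (\<lambda>w. w) [length] (\<lambda>w. B (length w) ^ 3)" "PF (\<lambda>w. w) [length] (\<lambda>w. B (length w) ^ 7)"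
      by (intro PF_power fB)+
    show "even (B (length w) ^ 3)" "0 < B (length w) ^ 3" for w :: "nat list" by (simp_all add: B_def)
    have lift': "PF fst (lift [length]) (\<lambda>z. f (fst z))" if "PF (\<lambda>w. w) [length] f" for f
      using PF_fst[OF that] by simp
    show "PD fst (lift [length]) (\<lambda>z. D (fst z) (c z) (v z) b)"
      if "PF fst (lift [length]) c" "PF fst (lift [length]) v" for c v b
      unfolding D_def C_def
      by (intro PD_clause_lit PD_eq PF_sym_at PF_mod PF_div PF_mult PF_power PF_const that
          lift'[OF len] lift'[OF fs(1)] lift'[OF fs(2)] lift'[OF fB])
    fix x
    define w where "w = bit_word x"
    let ?n = "length x"
    have w: "length w = ?n" by (simp add: w_def bit_word_def)
    have inp: "cells.initial_symbol ?n (T ?n) (\<lambda>i. sym_at w i = 2) y j =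
        cells.initial_symbol ?n (T ?n) (\<lambda>i. x ! i) y j" for y j
    proof -
      have "sym_at w i = 2 \<longleftrightarrow> x ! i" if "i < ?n" for i
        using that by (simp add: sym_at_def w_def word_contents_def bit_word_def)
      then show ?thesis by (simp add: cells.initial_symbol_def)
    qed
    define c where "c y t j = to_nat (view (run M (pair_word x y) t) (int j - int (T ?n)))" for y t j
    have ok: "cfg_ok M (run M (pair_word x y) t)" for y t
      by (rule cfg_ok_run[OF M]) (auto simp: pair_word_def bit_word_def)
    have Bn: "B ?n > 0" by (simp add: B_def)
    have "(\<exists>a. \<forall>c<B ?n ^ 7. \<exists>v<B ?n ^ 3. C w (c div B ?n ^ 0 mod B ?n) (c div B ?n ^ 1 mod B ?n) (c div B ?n ^ 2 mod B ?n)
       (c div B ?n ^ 3 mod B ?n) (c div B ?n ^ 4 mod B ?n) (c div B ?n ^ 5 mod B ?n) (c div B ?n ^ 6 mod B ?n)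
       (v div (B ?n * B ?n)) (v div B ?n mod B ?n) (v mod B ?n) (a v)) \<longleftrightarrow>
      (\<exists>y. length y \<le> P ?n \<and> acc (c y (T ?n) (T ?n)))"
      unfolding satisfiable_digits[OF Bn] unfolding C_def w
    proof (rule cells.satisfiable_iff[where c = c])
      show "A \<le> B ?n" "2 * T ?n + ?n + P ?n + 5 \<le> B ?n" by (simp_all add: B_def)
      show "c y 0 j = \<sigma> (cells.initial_symbol ?n (T ?n) (\<lambda>i. sym_at w i = 2) y j)" for y j
        unfolding inp c_def \<sigma>_def using view_init[of M x y j "T ?n"] M
        by (simp add: run_def turing_machine_def)
      show "c y (Suc t) j = view_fun M (min 4 (j + 2 - T ?n)) (c y t (T ?n)) (c y t (j - 1)) (c y t j) (c y t (j + 1))"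
        if "t < T ?n" "0 < j" for y t j
      proof -
        have "run M (pair_word x y) (Suc t) = tm_step M (run M (pair_word x y) t)" by (simp add: run_def)
        moreover have "int (j - 1) - int (T ?n) = int j - int (T ?n) - 1"
          "int (j + 1) - int (T ?n) = int j - int (T ?n) + 1" using that by auto
        ultimately show ?thesis
          using view_tm_step[OF M ok] by (simp only: c_def view_fun_def view_step_zone from_nat_to_nat diff_self)
      qed
      show "c y t j < A" for y t j unfolding c_def by (rule A[OF ok])
      show "inj \<sigma>" unfolding \<sigma>_def by (intro injI) simp
    qed
    also have "(\<exists>y. length y \<le> P ?n \<and> acc (c y (T ?n) (T ?n))) \<longleftrightarrow> x \<in> L"
    proof -
      have "acc (c y (T ?n) (T ?n)) \<longleftrightarrow> accepts M (pair_word x y)" if y: "length y \<le> P ?n" for y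
      proof -
        have "length (pair_word x y) \<le> ?n + 1 + P ?n" using y by (simp add: pair_word_def bit_word_def)
        then have "poly q (length (pair_word x y)) \<le> T ?n" unfolding T_def by (rule poly_nat_mono)
        \<comment> \<open>A halted configuration no longer changes, so certificates of any
          admissible length can be judged at the common time \<open>T\<close>.\<close>
        then have "halted M (run M (pair_word x y) (T ?n))" using run_halted[OF q] q by metis
        then show ?thesis using accepts_iff_halted[OF M] by (simp add: acc_def c_def view_def)
      qed
      then show ?thesis unfolding L P_def by blast
    qed
    finally show "x \<in> L \<longleftrightarrow> (\<exists>a. \<forall>c<B (length (bit_word x)) ^ 7. \<exists>v<B (length (bit_word x)) ^ 3.
D (bit_word x) c v (a v))"
      by (simp only: D_def w w_def[symmetric])
  qed
qed

theorem theorem5: "NP_complete semipaired_domination_split"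
  unfolding NP_complete_def using semipaired_domination_split_in_NP NP_reducible by blast

end
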